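(* Let $(Q,\lhd)$ be a quandle, $R$ a commutative ring, $A$ an $R$-module, and $\alpha\in R^*$ a unit. An $\alpha$-twisted quandle cocycle invariant does not change if all its elements are scaled by $\alpha$: for every $\alpha$-twisted quandle $2$-cocycle $\omega\colon Q\times Q\to A$ and every knot diagram $D$, the multisets $\{\,\mathcal{W}^{tw}_\omega(D,\mathcal{C},\alpha)\mid\mathcal{C}\in\mathscr{C}_Q(D)\,\}$ and $\{\,\alpha\,\mathcal{W}^{tw}_\omega(D,\mathcal{C},\alpha)\mid\mathcal{C}\in\mathscr{C}_Q(D)\,\}$ coincide.
   Context: Quandle: a set $Q$ with operations $\lhd,\widetilde{\lhd}$ such that $(a\lhd b)\lhd c=(a\lhd c)\lhd(b\lhd c)$, $(a\lhd b)\,\widetilde{\lhd}\,b=(a\,\widetilde{\lhd}\,b)\lhd b=a$, $a\lhd a=a$ for all $a,b,c\in Q$. Quandles are assumed nonempty. Knots: "knot" means oriented knot or link in $\mathbb{R}^3$; a knot diagram $D$ is a diagram in $\mathbb{R}^2$ of such a link. Arcs run from undercrossing to undercrossing (or are closed curves). Regions are the connected components of $\mathbb{R}^2\setminus D$; $\Delta_{ex}(D)$ is the exterior (unbounded) region. Left and right of an oriented arc are as seen when travelling along it. A $Q$-coloring $\mathcal{C}$ of $D$ assigns an element of $Q$ to each arc such that at each crossing, if the over-arc has color $b$ and the under-arc on the right of the over-arc has color $a$, then the under-arc on the left of the over-arc has color $a\lhd b$. The set of $Q$-colorings is $\mathscr{C}_Q(D)$. The index $i(\Delta)$ of a region $\Delta$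 is the algebraic intersection number of $D$ with a path from $\Delta$ to $\Delta_{ex}(D)$ (finitely many simple transverse intersections), where a crossing of the path over $D$ from the left side to the right side of the oriented $D$ counts $+1$ and from right to left counts $-1$. The source region $\Delta(x)$ of a crossing $x$ is the one of the four regions at $x$ lying on the right of both strands. Put $i(x)=i(\Delta(x))$. The $\alpha$-twisted $\omega$-weight is $\mathcal{W}^{tw}_\omega(D,\mathcal{C},\alpha)=\sum_x\varepsilon(x)\alpha^{-i(x)}\omega(a_x,b_x)$, summed over all crossings, where $\varepsilon(x)=\pm1$ is the usual sign, $b_x$ is the color of the over-arc and $a_x$ the color of the under-arc lying on the right of the over-arc. The $\alpha$-twisted quandle cocycle invariant is the multiset of these weights over all $\mathcal{C}\in\mathscr{C}_Q(D)$. An $\alpha$-twisted quandle $2$-cocycle is a map $\omega\colon Q\times Q\to A$ with $\omega(a,a)=0$ and $\omega(a\lhd c,b\lhd c)-\alpha\omega(a,b)-\omega(a\lhd b,c)+\alpha\omega(a,c)+(1-\alpha)\omega(b,c)=0$ for all $a,b,c$. Two multisets given as indexed families coincide if there is a bijection of index sets preserving values. *)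

theory Defs
  imports "HOL-Analysis.Analysis" "HOL-Algebra.Module"
begin

section \<open>Quandles and twisted cocycles\<close>

locale quandle =
  fixes Q :: "'q set"
    and tri :: "'q \<Rightarrow> 'q \<Rightarrow> 'q" (infixl \<open>\<lhd>\<close> 70)
    and tri_inv :: "'q \<Rightarrow> 'q \<Rightarrow> 'q" (infixl \<open>\<lhd>''\<close> 70)
  assumes nonempty: "Q \<noteq> {}"
    and tri_closed: "\<lbrakk>a \<in> Q; b \<in> Q\<rbrakk> \<Longrightarrow> a \<lhd> b \<in> Q"
    and tri_inv_closed: "\<lbrakk>a \<in> Q; b \<in> Q\<rbrakk> \<Longrightarrow> a \<lhd>' b \<in> Q"
    and self_distrib: "\<lbrakk>a \<in> Q; b \<in> Q; c \<in> Q\<rbrakk> \<Longrightarrow> (a \<lhd> b) \<lhd> c = (a \<lhd> c) \<lhd> (b \<lhd> c)"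
    and tri_tri_inv: "\<lbrakk>a \<in> Q; b \<in> Q\<rbrakk> \<Longrightarrow> (a \<lhd> b) \<lhd>' b = a"
    and tri_inv_tri: "\<lbrakk>a \<in> Q; b \<in> Q\<rbrakk> \<Longrightarrow> (a \<lhd>' b) \<lhd> b = a"
    and idem: "a \<in> Q \<Longrightarrow> a \<lhd> a = a"

definition twisted_cocycle ::
  "'q set \<Rightarrow> ('q \<Rightarrow> 'q \<Rightarrow> 'q) \<Rightarrow> ('r, 'm) ring_scheme \<Rightarrow> ('r, 'a, 'n) module_scheme
    \<Rightarrow> 'r \<Rightarrow> ('q \<Rightarrow> 'q \<Rightarrow> 'a) \<Rightarrow> bool" where
  "twisted_cocycle Q tri R A \<alpha> \<omega> \<longleftrightarrow>
     (\<forall>a\<in>Q. \<forall>b\<in>Q. \<omega> a b \<in> carrier A) \<and>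
     (\<forall>a\<in>Q. \<omega> a a = \<zero>\<^bsub>A\<^esub>) \<and>
     (\<forall>a\<in>Q. \<forall>b\<in>Q. \<forall>c\<in>Q.
        \<omega> (tri a c) (tri b c)
          \<ominus>\<^bsub>A\<^esub> (\<alpha> \<odot>\<^bsub>A\<^esub> \<omega> a b)
          \<ominus>\<^bsub>A\<^esub> \<omega> (tri a b) c
          \<oplus>\<^bsub>A\<^esub> (\<alpha> \<odot>\<^bsub>A\<^esub> \<omega> a c)
          \<oplus>\<^bsub>A\<^esub> ((\<one>\<^bsub>R\<^esub> \<ominus>\<^bsub>R\<^esub> \<alpha>) \<odot>\<^bsub>A\<^esub> \<omega> b c) = \<zero>\<^bsub>A\<^esub>)"


section \<open>Knot diagrams\<close>

text \<open>
  The plane is \<^typ>\<open>complex\<close>.  A diagram consists of finitely many closed curves, each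
  parametrised by the unit circle and oriented by the counterclockwise direction of the circle.
  A \<^emph>\<open>parameter\<close> \<open>(j, z)\<close> is the point \<open>z\<close> of the circle parametrising the \<open>j\<close>-th curve;
  \<open>under D\<close> is the set of parameters at which the diagram passes under a crossing.
\<close>

record link_diagram =
  ncomp :: nat
  curve :: "nat \<Rightarrow> complex \<Rightarrow> complex"
  under :: "(nat \<times> complex) set"

definition params :: "link_diagram \<Rightarrow> (nat \<times> complex) set" where
  "params D = {..<ncomp D} \<times> sphere 0 1"

definition pt :: "link_diagram \<Rightarrow> nat \<times> complex \<Rightarrow> complex" where
  "pt D p = curve D (fst p) (snd p)"

definition shift :: "nat \<times> complex \<Rightarrow> real \<Rightarrow> nat \<times> complex" where
  "shift p s = (fst p, snd p * cis s)"

definition smooth_at :: "link_diagram \<Rightarrow> nat \<times> complex \<Rightarrow> bool" where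
  "smooth_at D p \<longleftrightarrow> (\<lambda>s. pt D (shift p s)) differentiable (at 0)"

definition tangent :: "link_diagram \<Rightarrow> nat \<times> complex \<Rightarrow> complex" where
  "tangent D p = vector_derivative (\<lambda>s. pt D (shift p s)) (at 0)"

text \<open>
  \<open>Im (cnj u * v)\<close> is the determinant of the pair \<open>(u, v)\<close> of plane vectors; it is negative iff
  \<open>v\<close> points to the right of the direction of travel \<open>u\<close>.
\<close>

definition det2 :: "complex \<Rightarrow> complex \<Rightarrow> real" where
  "det2 u v = Im (cnj u * v)"

definition right_of :: "complex \<Rightarrow> complex \<Rightarrow> bool" where
  "right_of u v \<longleftrightarrow> det2 u v < 0"

text \<open>
  Piecewise continuously differentiable closed curves with nonvanishing one-sided derivatives and
  without cusps: both smooth and polygonal curves are covered.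
\<close>

definition regular_closed_curve :: "(complex \<Rightarrow> complex) \<Rightarrow> bool" where
  "regular_closed_curve f \<longleftrightarrow>
     (\<lambda>t. f (cis t)) piecewise_C1_differentiable_on {0..2 * pi} \<and>
     (\<forall>t. \<exists>u v. ((\<lambda>s. vector_derivative (\<lambda>t. f (cis t)) (at s)) \<longlongrightarrow> u) (at_left t) \<and>
                ((\<lambda>s. vector_derivative (\<lambda>t. f (cis t)) (at s)) \<longlongrightarrow> v) (at_right t) \<and>
                u \<noteq> 0 \<and> v \<noteq> 0 \<and> (\<forall>c>0. v \<noteq> - (c *\<^sub>R u)))"

definition double_params :: "link_diagram \<Rightarrow> (nat \<times> complex) set" where
  "double_params D = {p \<in> params D. \<exists>q \<in> params D. q \<noteq> p \<and> pt D q = pt D p}"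

definition knot_diagram :: "link_diagram \<Rightarrow> bool" where
  "knot_diagram D \<longleftrightarrow>
     0 < ncomp D \<and>
     (\<forall>j<ncomp D. regular_closed_curve (curve D j)) \<and>
     finite (double_params D) \<and>
     (\<forall>p\<in>params D. \<forall>q\<in>params D. \<forall>r\<in>params D.
        pt D p = pt D q \<and> pt D q = pt D r \<longrightarrow> p = q \<or> q = r \<or> p = r) \<and>
     (\<forall>p\<in>double_params D. smooth_at D p) \<and>
     (\<forall>p\<in>params D. \<forall>q\<in>params D. p \<noteq> q \<and> pt D p = pt D q \<longrightarrow>
        det2 (tangent D p) (tangent D q) \<noteq> 0 \<and> (p \<in> under D \<longleftrightarrow> q \<notin> under D)) \<and>
     under D \<subseteq> double_params D"

text \<open>A crossing is the pair of its over-parameter and its under-parameter.\<close>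

definition crossings :: "link_diagram \<Rightarrow> ((nat \<times> complex) \<times> (nat \<times> complex)) set" where
  "crossings D = {(p, q). p \<in> params D \<and> q \<in> under D \<and> p \<noteq> q \<and> pt D p = pt D q}"

text \<open>
  The sign is positive iff the under-strand passes from the right to the left of the over-strand.
\<close>

definition crossing_sign :: "link_diagram \<Rightarrow> (nat \<times> complex) \<times> (nat \<times> complex) \<Rightarrow> int" where
  "crossing_sign D = (\<lambda>(p, q). if 0 < det2 (tangent D p) (tangent D q) then 1 else - 1)"


section \<open>Arcs and colorings\<close>

text \<open>
  Arcs are cut at undercrossings only, so they live on the parametrising circles and not in the
  plane: an arc is a connected component of a circle minus its under-parameters.
\<close>

definition arcs :: "link_diagram \<Rightarrow> (nat \<times> complex set) set" where
  "arcs D = {(j, K). j < ncomp D \<and> K \<in> components (sphere 0 1 - {z. (j, z) \<in> under D})}"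

definition lies_on :: "nat \<times> complex \<Rightarrow> nat \<times> complex set \<Rightarrow> bool" where
  "lies_on p a \<longleftrightarrow> fst p = fst a \<and> snd p \<in> snd a"

definition over_arc ::
  "link_diagram \<Rightarrow> (nat \<times> complex) \<times> (nat \<times> complex) \<Rightarrow> nat \<times> complex set" where
  "over_arc D = (\<lambda>(p, q). THE a. a \<in> arcs D \<and> lies_on p a)"

definition arc_out :: "link_diagram \<Rightarrow> nat \<times> complex \<Rightarrow> nat \<times> complex set" where
  "arc_out D q = (THE a. a \<in> arcs D \<and> (\<forall>\<^sub>F s in at_right 0. lies_on (shift q s) a))"

definition arc_in :: "link_diagram \<Rightarrow> nat \<times> complex \<Rightarrow> nat \<times> complex set" where
  "arc_in D q = (THE a. a \<in> arcs D \<and> (\<forall>\<^sub>F s in at_left 0. lies_on (shift q s) a))"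

text \<open>
  The outgoing under-arc leaves the crossing in the direction of the tangent of the under-strand,
  the incoming one lies on the opposite side of the over-strand.
\<close>

definition under_arc_right ::
  "link_diagram \<Rightarrow> (nat \<times> complex) \<times> (nat \<times> complex) \<Rightarrow> nat \<times> complex set" where
  "under_arc_right D =
     (\<lambda>(p, q). if right_of (tangent D p) (tangent D q) then arc_out D q else arc_in D q)"

definition under_arc_left ::
  "link_diagram \<Rightarrow> (nat \<times> complex) \<times> (nat \<times> complex) \<Rightarrow> nat \<times> complex set" where
  "under_arc_left D =
     (\<lambda>(p, q). if right_of (tangent D p) (tangent D q) then arc_in D q else arc_out D q)"

definition colorings ::
  "'q set \<Rightarrow> ('q \<Rightarrow> 'q \<Rightarrow> 'q) \<Rightarrow> link_diagram \<Rightarrow> (nat \<times> complex set \<Rightarrow> 'q) set" where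
  "colorings Q tri D =
     {C \<in> arcs D \<rightarrow>\<^sub>E Q. \<forall>x\<in>crossings D.
        C (under_arc_left D x) = tri (C (under_arc_right D x)) (C (over_arc D x))}"


section \<open>Regions and their indices\<close>

definition regions :: "link_diagram \<Rightarrow> complex set set" where
  "regions D = components (- (pt D ` params D))"

definition exterior_region :: "link_diagram \<Rightarrow> complex set" where
  "exterior_region D = (THE \<Delta>. \<Delta> \<in> regions D \<and> \<not> bounded \<Delta>)"

text \<open>
  The intersections of a path with the diagram, as pairs of a parameter of the diagram and a
  parameter of the path.
\<close>

definition intersections ::
  "link_diagram \<Rightarrow> (real \<Rightarrow> complex) \<Rightarrow> ((nat \<times> complex) \<times> real) set" where
  "intersections D \<beta> = {(p, s). p \<in> params D \<and> s \<in> {0..1} \<and> \<beta> s = pt D p}"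

definition transverse_path :: "link_diagram \<Rightarrow> (real \<Rightarrow> complex) \<Rightarrow> bool" where
  "transverse_path D \<beta> \<longleftrightarrow>
     path \<beta> \<and> finite (intersections D \<beta>) \<and>
     (\<forall>(p, s)\<in>intersections D \<beta>.
        p \<notin> double_params D \<and> smooth_at D p \<and> \<beta> differentiable (at s) \<and>
        det2 (tangent D p) (vector_derivative \<beta> (at s)) \<noteq> 0)"

definition intersection_number :: "link_diagram \<Rightarrow> (real \<Rightarrow> complex) \<Rightarrow> int" where
  "intersection_number D \<beta> =
     (\<Sum>(p, s)\<in>intersections D \<beta>.
        if right_of (tangent D p) (vector_derivative \<beta> (at s)) then 1 else - 1)"

definition region_index :: "link_diagram \<Rightarrow> complex set \<Rightarrow> int" where
  "region_index D \<Delta> =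
     (THE n. \<exists>\<beta>. transverse_path D \<beta> \<and> pathstart \<beta> \<in> \<Delta> \<and>
                 pathfinish \<beta> \<in> exterior_region D \<and> n = intersection_number D \<beta>)"

text \<open>
  The source region contains the points close to the crossing in each direction that is to the
  right of both strands.
\<close>

definition source_region ::
  "link_diagram \<Rightarrow> (nat \<times> complex) \<times> (nat \<times> complex) \<Rightarrow> complex set" where
  "source_region D =
     (\<lambda>(p, q). THE \<Delta>. \<Delta> \<in> regions D \<and>
        (\<forall>w. right_of (tangent D p) w \<and> right_of (tangent D q) w \<longrightarrow>
             (\<forall>\<^sub>F s in at_right 0. pt D p + s *\<^sub>R w \<in> \<Delta>)))"

definition crossing_index :: "link_diagram \<Rightarrow> (nat \<times> complex) \<times> (nat \<times> complex) \<Rightarrow> int" where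
  "crossing_index D x = region_index D (source_region D x)"


section \<open>The twisted weight\<close>

definition twisted_weight ::
  "('r, 'm) ring_scheme \<Rightarrow> ('r, 'a, 'n) module_scheme \<Rightarrow> 'r \<Rightarrow> ('q \<Rightarrow> 'q \<Rightarrow> 'a)
    \<Rightarrow> link_diagram \<Rightarrow> (nat \<times> complex set \<Rightarrow> 'q) \<Rightarrow> 'a" where
  "twisted_weight R A \<alpha> \<omega> D C =
     (\<Oplus>\<^bsub>A\<^esub>x\<in>crossings D.
        [crossing_sign D x] \<cdot>\<^bsub>A\<^esub>
          ((\<alpha> [^]\<^bsub>R\<^esub> (- crossing_index D x)) \<odot>\<^bsub>A\<^esub>
             \<omega> (C (under_arc_right D x)) (C (over_arc D x))))"

text \<open>Equality of the multisets \<open>{f i | i \<in> I}\<close> and \<open>{g j | j \<in> J}\<close>, which may be infinite.\<close>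

definition same_multiset :: "'i set \<Rightarrow> ('i \<Rightarrow> 'v) \<Rightarrow> 'j set \<Rightarrow> ('j \<Rightarrow> 'v) \<Rightarrow> bool" where
  "same_multiset I f J g \<longleftrightarrow> (\<exists>\<phi>. bij_betw \<phi> I J \<and> (\<forall>i\<in>I. g (\<phi> i) = f i))"

end

theory Submission
  imports Defs "HOL-Complex_Analysis.Riemann_Mapping" "HOL-Algebra.IntRing"
begin

text \<open>
  Fix \<open>c\<close> in the quandle. The map \<open>C \<mapsto> C \<lhd> c\<close> is a bijection of the colorings, and it multiplies
  the weight by \<open>\<alpha>\<close>: consider the function \<open>\<alpha>\<^sup>-\<^sup>r \<omega>(a, c)\<close> on the parametrising circles, where \<open>a\<close> is
  the color of the arc and \<open>r\<close> the index of the region on its right. It is locally constant off the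
  double points, so its jumps at the double points add up to zero. By the cocycle identity the two
  jumps at a crossing of sign \<open>\<epsilon>\<close> and index \<open>i\<close> add up to
  \<open>\<epsilon> \<alpha>\<^sup>-\<^sup>i\<^sup>-\<^sup>1 (\<omega>(a \<lhd> c, b \<lhd> c) - \<alpha> \<omega>(a, b))\<close>, whence the weights of \<open>C \<lhd> c\<close> and \<open>C\<close> differ by the factor \<open>\<alpha>\<close>.

  The index of a region is the sum of the winding numbers of the components about it. It drops by
  one from the left to the right of a strand, because the quotient of the distance vectors from
  two points facing each other across the strand to the moving point of the strand turns around
  the origin once.
\<close>


section \<open>Determinants and one-sided monotonicity\<close>

text \<open>Curves are only piecewise C1, so at a corner a side cannot be read off a tangent. Sides
  are therefore encoded by \<open>right_dir\<close>, strict monotonicity of a linear functional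
  along the strand: it makes sense at corners, it is a convex condition on the direction, and no
  right direction is a chord of the strand. These two properties supply connected sets that miss the
  diagram, and on them winding numbers are constant. A second obstacle: \<open>region_index\<close>,
  \<open>source_region\<close> and the arcs at a crossing are definite descriptions, so each needs
  existence and uniqueness. For the index, uniqueness holds because every admissible path counts a
  difference of winding numbers, and existence takes Sard's theorem. The function \<alpha>^-r
  \<omega>(a, c) is dictated by the cocycle identity: of its five terms, the three with second
  argument c are what the four half-strands at a crossing contribute; the coefficients \<alpha> and
  1 - \<alpha> record that the index changes by one across a strand. Translation by c is a quandle
  automorphism, hence acts bijectively on colorings.\<close>

lemma det2_Re_Im: "det2 u v = Re u * Im v - Im u * Re v"
  by (simp add: det2_def)

lemma det2_self [simp]: "det2 z z = 0"
  by (simp add: det2_Re_Im)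

lemma det2_add_left: "det2 (u + v) w = det2 u w + det2 v w"
  and det2_add_right: "det2 w (u + v) = det2 w u + det2 w v"
  and det2_diff_right: "det2 w (u - v) = det2 w u - det2 w v"
  and det2_scaleR_left: "det2 (a *\<^sub>R u) v = a * det2 u v"
  and det2_minus_left [simp]: "det2 (- u) v = - det2 u v"
  and det2_minus_right [simp]: "det2 u (- v) = - det2 u v"
  and det2_zero_right [simp]: "det2 u 0 = 0"
  by (simp_all add: det2_Re_Im algebra_simps)

lemma det2_commute: "det2 v u = - det2 u v"
  by (simp add: det2_Re_Im)

text \<open>Cramer's rule. Membership in the cone spanned by \<open>u\<close> and \<open>v\<close>
  thus becomes a question about the signs of two determinants.\<close>

lemma det2_basis:
  assumes "det2 u v \<noteq> 0"
  shows "z = (det2 z v / det2 u v) *\<^sub>R u + (det2 u z / det2 u v) *\<^sub>R v"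
proof -
  have "det2 u v *\<^sub>R z = det2 z v *\<^sub>R u + det2 u z *\<^sub>R v"
    by (simp add: complex_eq_iff det2_Re_Im algebra_simps)
  then have "(1 / det2 u v) *\<^sub>R (det2 u v *\<^sub>R z)
      = (1 / det2 u v) *\<^sub>R (det2 z v *\<^sub>R u + det2 u z *\<^sub>R v)"
    by simp
  then show ?thesis
    using assms by (simp add: scaleR_add_right)
qed

lemma continuous_on_det2 [continuous_intros]:
  assumes "continuous_on S f" "continuous_on S g"
  shows "continuous_on S (\<lambda>x. det2 (f x) (g x))"
  unfolding det2_def by (intro continuous_intros assms)

lemma tendsto_det2 [tendsto_intros]:
  assumes "(f \<longlongrightarrow> a) F" "(g \<longlongrightarrow> b) F"
  shows "((\<lambda>x. det2 (f x) (g x)) \<longlongrightarrow> det2 a b) F"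
  unfolding det2_def by (intro tendsto_intros assms)

lemma has_vector_derivative_det2:
  assumes "(g has_vector_derivative v) (at s)"
  shows "((\<lambda>s. det2 w (g s)) has_real_derivative det2 w v) (at s)"
proof -
  have "bounded_linear (det2 w)"
    unfolding det2_def
    by (intro bounded_linear_compose[OF bounded_linear_Im] bounded_linear_mult_right)
  from bounded_linear.has_vector_derivative[OF this assms] show ?thesis
    by (simp add: has_real_derivative_iff_has_vector_derivative)
qed

text \<open>
  A vector \<open>w\<close> with this property plays the role of a vector on the right of the curve \<open>g\<close>
  near the parameter \<open>0\<close>; the definition makes sense at a corner, too.
\<close>

definition right_dir :: "(real \<Rightarrow> complex) \<Rightarrow> real \<Rightarrow> complex \<Rightarrow> bool" where
  "right_dir g e w \<longleftrightarrow> (\<forall>s s'. - e \<le> s \<longrightarrow> s < s' \<longrightarrow> s' \<le> e \<longrightarrow> 0 < det2 w (g s' - g s))"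

lemma right_dirD:
  "\<lbrakk>right_dir g e w; - e \<le> s; s < s'; s' \<le> e\<rbrakk> \<Longrightarrow> 0 < det2 w (g s' - g s)"
  unfolding right_dir_def by blast

lemma right_dir_mono:
  assumes "right_dir g e w" "e' \<le> e"
  shows "right_dir g e' w"
  using assms unfolding right_dir_def by (meson le_minus_iff minus_le_iff order_trans)

text \<open>The defining condition is linear in the direction. The resulting convexity makes the set
  of nearby points on one side of a strand connected.\<close>

lemma right_dir_cone:
  assumes "right_dir g e w" "right_dir g e w'" "0 \<le> a" "0 \<le> b" "a \<noteq> 0 \<or> b \<noteq> 0"
  shows "right_dir g e (a *\<^sub>R w + b *\<^sub>R w')"
  unfolding right_dir_def
proof (intro allI impI)
  fix s s' assume s: "- e \<le> s" "s < s'" "s' \<le> e"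
  have "0 < a \<or> 0 < b"
    using assms by auto
  then show "0 < det2 (a *\<^sub>R w + b *\<^sub>R w') (g s' - g s)"
    using right_dirD[OF assms(1) s] right_dirD[OF assms(2) s] assms(3,4)
    by (auto simp: det2_add_left det2_scaleR_left intro: add_pos_nonneg add_nonneg_pos)
qed

lemma right_dir_scaleR:
  assumes "right_dir g e w" "0 < a"
  shows "right_dir g e (a *\<^sub>R w)"
  using right_dir_cone[OF assms(1) assms(1), of a 0] assms(2) by simp

lemma right_dir_nonzero:
  assumes "right_dir g e w" "0 < e"
  shows "w \<noteq> 0"
  using right_dirD[OF assms(1), of 0 e] assms(2) by (auto simp: det2_Re_Im)

lemma right_dir_reverse:
  assumes "right_dir g e w"
  shows "right_dir (\<lambda>s. g (- s)) e (- w)"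
  unfolding right_dir_def
proof (intro allI impI)
  fix s s' :: real assume s: "- e \<le> s" "s < s'" "s' \<le> e"
  show "0 < det2 (- w) (g (- s') - g (- s))"
    using right_dirD[OF assms, of "- s'" "- s"] s by (simp add: det2_diff_right)
qed

text \<open>A vector has determinant zero with itself, but a right direction has a positive one with
  every forward chord. So a point of the strand moved in a right direction does not land on the same
  piece of strand.\<close>

lemma right_dir_avoids:
  assumes "right_dir g e w" "\<bar>s\<bar> \<le> e" "\<bar>t\<bar> \<le> e" "w = g t - g s"
  shows "w = 0"
proof (cases s t rule: linorder_cases)
  case less
  then have "0 < det2 w (g t - g s)"
    using right_dirD[OF assms(1), of s t] assms(2,3) by linarith
  then show ?thesis using assms(4) by simp
next
  case greater
  then have "0 < det2 w (g s - g t)"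
    using right_dirD[OF assms(1), of t s] assms(2,3) by linarith
  moreover have "g s - g t = - w" using assms by simp
  ultimately show ?thesis by simp
qed (use assms in simp)

text \<open>No derivative at 0 is assumed, which admits corners: the functional increases strictly
  on each side by the sign of its derivative, and the two halves are joined at 0 by
  continuity.\<close>

lemma right_dir_if_derivative:
  assumes cont: "continuous_on UNIV g"
    and right: "\<forall>\<^sub>F s in at_right 0. \<exists>v. (g has_vector_derivative v) (at s) \<and> 0 < det2 w v"
    and left: "\<forall>\<^sub>F s in at_left 0. \<exists>v. (g has_vector_derivative v) (at s) \<and> 0 < det2 w v"
  shows "\<exists>e>0. right_dir g e w"
proof -
  obtain b where b: "0 < b" and br: "\<And>s. \<lbrakk>0 < s; s < b\<rbrakk> \<Longrightarrow>
      \<exists>v. (g has_vector_derivative v) (at s) \<and> 0 < det2 w v"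
    using right unfolding eventually_at_right_field by auto
  obtain a where a: "a < 0" and al: "\<And>s. \<lbrakk>a < s; s < 0\<rbrakk> \<Longrightarrow>
      \<exists>v. (g has_vector_derivative v) (at s) \<and> 0 < det2 w v"
    using left unfolding eventually_at_left_field by auto
  \<comment> \<open>Halving puts the closed interval from \<open>- e\<close> to \<open>e\<close>
    inside the open range in which the derivatives are controlled.\<close>
  define e where "e = min b (- a) / 2"
  have e: "0 < e" "e < b" "a < - e"
    using a b by (auto simp: e_def min_def)
  let ?f = "\<lambda>s. det2 w (g s)"
  have cf: "continuous_on S ?f" for S
    by (intro continuous_intros continuous_on_subset[OF cont]) auto
  have piece: "?f s < ?f s'" if "s < s'" "- e \<le> s" "s' \<le> e" "0 \<le> s \<or> s' \<le> 0" for s s'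
  proof (rule DERIV_pos_imp_increasing_open[OF that(1) _ cf])
    fix x assume x: "s < x" "x < s'"
    then have "\<exists>v. (g has_vector_derivative v) (at x) \<and> 0 < det2 w v"
      using that e br[of x] al[of x] by fastforce
    then show "\<exists>y. DERIV ?f x :> y \<and> y > 0"
      using has_vector_derivative_det2 by blast
  qed
  have "?f s < ?f s'" if "s < s'" "- e \<le> s" "s' \<le> e" for s s'
  proof (cases "0 \<le> s \<or> s' \<le> 0")
    case False
    then have "?f s < ?f 0" "?f 0 < ?f s'"
      using that e by (auto intro!: piece)
    then show ?thesis by linarith
  qed (use piece that in blast)
  then have "right_dir g e w"
    unfolding right_dir_def by (auto simp: det2_diff_right)
  then show ?thesis
    using e by blast
qed


section \<open>The strands of a diagram\<close>

abbreviation strand :: "link_diagram \<Rightarrow> nat \<times> complex \<Rightarrow> real \<Rightarrow> complex" where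
  "strand D p \<equiv> (\<lambda>s. pt D (shift p s))"

lemma shift_shift [simp]: "shift (shift p s) t = shift p (s + t)"
  by (simp add: shift_def cis_mult mult.assoc)

lemma shift_0 [simp]: "shift p 0 = p"
  by (simp add: shift_def)

lemma fst_shift [simp]: "fst (shift p s) = fst p"
  by (simp add: shift_def)

lemma shift_in_params [simp]: "shift p s \<in> params D \<longleftrightarrow> p \<in> params D"
  by (cases p) (simp add: shift_def params_def dist_norm norm_mult)

lemma shift_2pi [simp]: "shift p (2 * pi) = p"
  by (simp add: shift_def complex_eq_iff)

lemma params_eq_shift:
  assumes "p \<in> params D"
  obtains t where "0 \<le> t" "t < 2 * pi" "p = shift (fst p, 1) t"
proof -
  have "norm (snd p) = 1"
    using assms by (auto simp: params_def)
  then have "snd p = cis (Arg2pi (snd p))"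
    using Arg2pi_eq[of "snd p"] by (simp add: cis_conv_exp)
  then show thesis
    using that[of "Arg2pi (snd p)"] Arg2pi[of "snd p"]
    by (cases p) (auto simp: shift_def)
qed

text \<open>Because 1 < pi, \<open>Arg\<close> recovers \<open>s\<close> from \<open>cis s\<close>
  on the interval from -1 to 1, so only finitely many short shifts can hit a finite set.\<close>

lemma eventually_shift_notin:
  assumes "finite F" "p \<in> params D"
  shows "\<forall>\<^sub>F s in at 0. shift p s \<notin> F"
proof -
  have p: "snd p \<noteq> 0"
    using assms by (auto simp: params_def)
  have "inj_on (shift p) {- 1<..<1}"
  proof (rule inj_onI)
    fix s t :: real assume st: "s \<in> {- 1<..<1}" "t \<in> {- 1<..<1}" "shift p s = shift p t"
    then have "cis s = cis t"
      using p by (simp add: shift_def)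
    moreover have "Arg (cis x) = x" if "x \<in> {- 1<..<1}" for x
      using that pi_gt3 by (intro cis_Arg_unique) (auto simp: sgn_div_norm)
    ultimately show "s = t"
      using st by metis
  qed
  then have "finite (shift p -` F \<inter> {- 1<..<1})"
    using assms(1) finite_vimage_IntI by blast
  then have "\<forall>\<^sub>F s in at 0. s \<notin> shift p -` F \<inter> {- 1<..<1}"
    using islimpt_finite unfolding islimpt_iff_eventually by blast
  moreover have "\<forall>\<^sub>F s::real in at 0. s \<in> {- 1<..<1}"
    by (rule eventually_at_in_open') auto
  ultimately show ?thesis
    by eventually_elim auto
qed

locale diagram =
  fixes D :: link_diagram
  assumes knot_diagram: "knot_diagram D"
begin

lemma regular: "j < ncomp D \<Longrightarrow> regular_closed_curve (curve D j)"
  and finite_double: "finite (double_params D)"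
  and no_triple: "\<lbrakk>p \<in> params D; q \<in> params D; r \<in> params D; pt D p = pt D q; pt D q = pt D r\<rbrakk>
    \<Longrightarrow> p = q \<or> q = r \<or> p = r"
  and smooth_double: "p \<in> double_params D \<Longrightarrow> smooth_at D p"
  and transverse: "\<lbrakk>p \<in> params D; q \<in> params D; p \<noteq> q; pt D p = pt D q\<rbrakk>
    \<Longrightarrow> det2 (tangent D p) (tangent D q) \<noteq> 0"
  and under_over: "\<lbrakk>p \<in> params D; q \<in> params D; p \<noteq> q; pt D p = pt D q\<rbrakk>
    \<Longrightarrow> p \<in> under D \<longleftrightarrow> q \<notin> under D"
  and under_double: "under D \<subseteq> double_params D"
  using knot_diagram unfolding knot_diagram_def by blast+

text \<open>Regularity gives continuity only after composition with \<open>cis\<close> on a closed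
  interval. That interval is compact, so the preimage of a closed set on the circle is the
  \<open>cis\<close>-image of a compact set and hence closed.\<close>

lemma curve_continuous:
  assumes "j < ncomp D"
  shows "continuous_on (sphere 0 1) (curve D j)"
proof -
  let ?G = "\<lambda>t. curve D j (cis t)"
  have "continuous_on {0..2 * pi} ?G"
    using regular[OF assms] by (simp add: regular_closed_curve_def piecewise_C1_differentiable_on_def)
  then have G: "closed (?G -` B \<inter> {0..2 * pi})" if "closed B" for B
    using that continuous_on_closed_vimage[of "{0..2 * pi}" ?G] by auto
  have "closed (curve D j -` B \<inter> sphere 0 1)" if "closed B" for B
  proof -
    have "compact (?G -` B \<inter> {0..2 * pi})"
      using G[OF that] by (simp add: compact_eq_bounded_closed bounded_Int)
    then have "closed (cis ` (?G -` B \<inter> {0..2 * pi}))"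
      by (intro compact_imp_closed compact_continuous_image continuous_intros)
    moreover have "curve D j -` B \<inter> sphere 0 1 = cis ` (?G -` B \<inter> {0..2 * pi})"
    proof (intro equalityI subsetI)
      fix z assume z: "z \<in> curve D j -` B \<inter> sphere 0 1"
      then have "z = cis (Arg2pi z)"
        using Arg2pi_eq[of z] by (simp add: cis_conv_exp)
      moreover have "Arg2pi z \<in> {0..2 * pi}"
        using Arg2pi[of z] by auto
      ultimately show "z \<in> cis ` (?G -` B \<inter> {0..2 * pi})"
        using z by (metis IntD1 IntI imageI vimageE vimageI)
    qed auto
    ultimately show ?thesis by simp
  qed
  then show ?thesis
    by (simp add: continuous_on_closed_vimage)
qed

lemma strand_continuous:
  assumes "p \<in> params D"
  shows "continuous_on S (strand D p)"
proof -
  have "continuous_on S (\<lambda>s. curve D (fst p) (snd p * cis s))"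
    by (rule continuous_on_compose2[OF curve_continuous])
      (use assms in \<open>auto simp: params_def norm_mult intro!: continuous_intros\<close>)
  then show ?thesis
    by (simp add: pt_def shift_def)
qed

lemma finite_not_smooth: "finite {p \<in> params D. \<not> smooth_at D p}"
proof -
  have "finite {z. norm z = 1 \<and> \<not> smooth_at D (j, z)}" if j: "j < ncomp D" for j
  proof -
    let ?G = "\<lambda>t. curve D j (cis t)"
    obtain S where S: "finite S" "?G C1_differentiable_on ({0..2 * pi} - S)"
      using regular[OF j] by (auto simp: regular_closed_curve_def piecewise_C1_differentiable_on_def)
    have "{z. norm z = 1 \<and> \<not> smooth_at D (j, z)} \<subseteq> cis ` S"
    proof
      fix z assume z: "z \<in> {z. norm z = 1 \<and> \<not> smooth_at D (j, z)}"
      define t where "t = Arg2pi z"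
      have zt: "z = cis t" "t \<in> {0..2 * pi}"
        using z Arg2pi_eq[of z] Arg2pi[of z] by (auto simp: t_def cis_conv_exp)
      have "t \<in> S"
      proof (rule ccontr)
        assume "t \<notin> S"
        then have "?G differentiable (at (t + 0))"
          using S(2) zt unfolding C1_differentiable_on_eq by simp
        then obtain v where "(?G has_vector_derivative v) (at ((\<lambda>s. t + s) 0))"
          using vector_derivative_works by auto
        then have "((?G \<circ> (\<lambda>s. t + s)) has_vector_derivative 1 *\<^sub>R v) (at 0)"
          by (intro vector_diff_chain_at) (auto intro!: derivative_eq_intros)
        then have "(?G \<circ> (\<lambda>s. t + s)) differentiable (at 0)"
          by (rule differentiableI_vector)
        moreover have "?G \<circ> (\<lambda>s. t + s) = strand D (j, z)"
          by (simp add: fun_eq_iff pt_def shift_def zt(1) cis_mult)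
        ultimately show False
          using z by (simp add: smooth_at_def)
      qed
      then show "z \<in> cis ` S" using zt by blast
    qed
    then show ?thesis using S(1) finite_surj by blast
  qed
  then have "finite (SIGMA j:{..<ncomp D}. {z. norm z = 1 \<and> \<not> smooth_at D (j, z)})"
    by (intro finite_SigmaI) auto
  then show ?thesis
    by (rule rev_finite_subset) (auto simp: params_def)
qed

lemma strand_has_derivative:
  assumes "smooth_at D (shift p s)"
  shows "(strand D p has_vector_derivative tangent D (shift p s)) (at s)"
proof -
  have "(strand D (shift p s) has_vector_derivative tangent D (shift p s)) (at ((\<lambda>x. x - s) s))"
    using assms vector_derivative_works unfolding smooth_at_def tangent_def by auto
  then have "((strand D (shift p s) \<circ> (\<lambda>x. x - s)) has_vector_derivative 1 *\<^sub>R tangent D (shift p s)) (at s)"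
    by (intro vector_diff_chain_at) (auto intro!: derivative_eq_intros)
  then show ?thesis
    by (simp add: o_def)
qed

lemma eventually_strand_derivative:
  assumes "p \<in> params D"
  shows "\<forall>\<^sub>F s in at 0. (strand D p has_vector_derivative tangent D (shift p s)) (at s)"
  using eventually_shift_notin[OF finite_not_smooth assms]
  by eventually_elim (use assms in \<open>auto intro: strand_has_derivative\<close>)

text \<open>Regularity speaks of the derivative along the circle parametrised from 1. Near
  \<open>p\<close>, \<open>tangent\<close> is that same derivative except at finitely many
  parameters, which one-sided limits do not see.\<close>

lemma tangent_limits:
  assumes "p \<in> params D"
  obtains u v where
    "((\<lambda>s. tangent D (shift p s)) \<longlongrightarrow> u) (at_left 0)"
    "((\<lambda>s. tangent D (shift p s)) \<longlongrightarrow> v) (at_right 0)"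
    "u \<noteq> 0" "v \<noteq> 0" "\<And>c. c > 0 \<Longrightarrow> v \<noteq> - (c *\<^sub>R u)"
proof -
  obtain t where t: "p = shift (fst p, 1) t"
    using params_eq_shift[OF assms] by metis
  let ?G = "\<lambda>t. curve D (fst p) (cis t)"
  have j: "fst p < ncomp D"
    using assms by (auto simp: params_def)
  have GF: "?G = strand D (fst p, 1)"
    by (simp add: fun_eq_iff pt_def shift_def)
  have tan: "tangent D (shift p s) = vector_derivative ?G (at (t + s))"
    if "(strand D p has_vector_derivative tangent D (shift p s)) (at s)" for s
  proof -
    have "(strand D p has_vector_derivative tangent D (shift p s)) (at ((\<lambda>x. x - t) (t + s)))"
      using that by simp
    then have "((strand D p \<circ> (\<lambda>x. x - t)) has_vector_derivative 1 *\<^sub>R tangent D (shift p s)) (at (t + s))"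
      by (intro vector_diff_chain_at) (auto intro!: derivative_eq_intros)
    moreover have "strand D p \<circ> (\<lambda>x. x - t) = ?G"
      unfolding GF by (subst t) (simp add: o_def)
    ultimately show ?thesis
      by (simp add: vector_derivative_at)
  qed
  have ev: "\<forall>\<^sub>F s in at 0. vector_derivative ?G (at (t + s)) = tangent D (shift p s)"
    using eventually_strand_derivative[OF assms] by eventually_elim (rule tan[symmetric])
  obtain u v where uv: "((\<lambda>s. vector_derivative ?G (at s)) \<longlongrightarrow> u) (at_left t)"
      "((\<lambda>s. vector_derivative ?G (at s)) \<longlongrightarrow> v) (at_right t)"
      "u \<noteq> 0" "v \<noteq> 0" "\<And>c. c > 0 \<Longrightarrow> v \<noteq> - (c *\<^sub>R u)"
    using regular[OF j, unfolded regular_closed_curve_def, THEN conjunct2, THEN spec, of t] by blast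
  have "at_left t = filtermap (\<lambda>x. x + t) (at_left 0)"
    using filtermap_at_left_shift[of "- t" 0] by simp
  from uv(1)[unfolded this filterlim_filtermap]
  have "((\<lambda>s. vector_derivative ?G (at (t + s))) \<longlongrightarrow> u) (at_left 0)"
    by (simp add: add.commute)
  then have l: "((\<lambda>s. tangent D (shift p s)) \<longlongrightarrow> u) (at_left 0)"
    by (rule Lim_transform_eventually) (use ev in \<open>auto simp: eventually_at_split\<close>)
  have "((\<lambda>s. vector_derivative ?G (at (t + s))) \<longlongrightarrow> v) (at_right 0)"
    using uv(2) unfolding filterlim_at_right_to_0[of _ _ t] by (simp add: add.commute)
  then have r: "((\<lambda>s. tangent D (shift p s)) \<longlongrightarrow> v) (at_right 0)"
    by (rule Lim_transform_eventually) (use ev in \<open>auto simp: eventually_at_split\<close>)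
  show thesis
    by (rule that[OF l r uv(3-5)])
qed

lemma right_dir_if_limits:
  assumes p: "p \<in> params D"
    and u: "((\<lambda>s. tangent D (shift p s)) \<longlongrightarrow> u) (at_left 0)" "0 < det2 w u"
    and v: "((\<lambda>s. tangent D (shift p s)) \<longlongrightarrow> v) (at_right 0)" "0 < det2 w v"
  shows "\<exists>e>0. right_dir (strand D p) e w"
proof (rule right_dir_if_derivative[OF strand_continuous[OF p]])
  have "\<forall>\<^sub>F s in at_left 0. 0 < det2 w (tangent D (shift p s))"
    by (rule order_tendstoD(1)[OF tendsto_det2[OF tendsto_const u(1)] u(2)])
  moreover have "\<forall>\<^sub>F s in at_left 0. (strand D p has_vector_derivative tangent D (shift p s)) (at s)"
    using eventually_strand_derivative[OF p] by (auto simp: eventually_at_split)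
  ultimately show "\<forall>\<^sub>F s in at_left 0. \<exists>v. (strand D p has_vector_derivative v) (at s) \<and> 0 < det2 w v"
    by eventually_elim auto
  have "\<forall>\<^sub>F s in at_right 0. 0 < det2 w (tangent D (shift p s))"
    by (rule order_tendstoD(1)[OF tendsto_det2[OF tendsto_const v(1)] v(2)])
  moreover have "\<forall>\<^sub>F s in at_right 0. (strand D p has_vector_derivative tangent D (shift p s)) (at s)"
    using eventually_strand_derivative[OF p] by (auto simp: eventually_at_split)
  ultimately show "\<forall>\<^sub>F s in at_right 0. \<exists>v. (strand D p has_vector_derivative v) (at s) \<and> 0 < det2 w v"
    by eventually_elim auto
qed

text \<open>Even at a corner the two one-sided tangents are not opposite, since cusps are excluded;
  so some vector has both of them strictly on its left.\<close>

lemma right_dir_exists: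
  assumes "p \<in> params D"
  shows "\<exists>w. \<exists>e>0. right_dir (strand D p) e w"
proof -
  obtain u v where uv: "((\<lambda>s. tangent D (shift p s)) \<longlongrightarrow> u) (at_left 0)"
    "((\<lambda>s. tangent D (shift p s)) \<longlongrightarrow> v) (at_right 0)"
    "u \<noteq> 0" "v \<noteq> 0" "\<And>c. c > 0 \<Longrightarrow> v \<noteq> - (c *\<^sub>R u)"
    using tangent_limits[OF assms] by metis
  \<comment> \<open>The bisector of the two one-sided tangents, turned clockwise by a right angle.\<close>
  define w where "w = - \<i> * (norm v *\<^sub>R u + norm u *\<^sub>R v)"
  have det: "det2 w z = norm v * (u \<bullet> z) + norm u * (v \<bullet> z)" for z
    by (simp add: w_def det2_Re_Im inner_complex_def algebra_simps)
  \<comment> \<open>Equality would be the extreme case of the Cauchy-Schwarz inequality and make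
    \<open>v\<close> a negative multiple of \<open>u\<close>, that is, a cusp.\<close>
  have "u \<bullet> v \<noteq> - (norm u * norm v)"
  proof
    assume "u \<bullet> v = - (norm u * norm v)"
    then have "\<bar>u \<bullet> v\<bar> = norm u * norm v" "u \<bullet> v \<noteq> norm u * norm v"
      using uv by auto
    then have "norm u *\<^sub>R v = - (norm v *\<^sub>R u)"
      using norm_cauchy_schwarz_abs_eq[of u v] norm_cauchy_schwarz_eq[of u v] by auto
    then have "v = - ((norm v / norm u) *\<^sub>R u)"
      using uv(3) by (metis (no_types, lifting) divideR_right divide_inverse_commute norm_eq_zero
          scaleR_right.minus scaleR_scaleR)
    then show False
      using uv(3-5) by simp
  qed
  then have "norm u * norm v + u \<bullet> v > 0"
    using Cauchy_Schwarz_ineq2[of u v] by linarith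
  then have "0 < norm u * (norm u * norm v + u \<bullet> v)" "0 < norm v * (norm u * norm v + u \<bullet> v)"
    using uv by auto
  then have "0 < det2 w u" "0 < det2 w v"
    unfolding det by (auto simp: algebra_simps inner_commute power2_norm_eq_inner[symmetric] power2_eq_square)
  then show ?thesis
    using right_dir_if_limits[OF assms uv(1) _ uv(2)] by blast
qed

text \<open>Differentiability at \<open>p\<close> alone does not make the tangent there a limit of
  nearby tangents. Since the one-sided limits exist, l'Hopital's rule for the difference quotient
  identifies them with it; testing against \<open>w\<close> reduces this to real functions.\<close>

lemma tangent_limit_smooth:
  assumes p: "p \<in> params D" "smooth_at D p"
  shows "((\<lambda>s. tangent D (shift p s)) \<longlongrightarrow> u) (at_left 0) \<Longrightarrow> det2 w u = det2 w (tangent D p)"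
    and "((\<lambda>s. tangent D (shift p s)) \<longlongrightarrow> u) (at_right 0) \<Longrightarrow> det2 w u = det2 w (tangent D p)"
proof -
  let ?f = "\<lambda>s. det2 w (strand D p s) - det2 w (pt D p)"
  have ev: "\<forall>\<^sub>F s in at 0. DERIV ?f s :> det2 w (tangent D (shift p s))"
    using eventually_strand_derivative[OF p(1)]
    by eventually_elim (auto intro!: derivative_eq_intros has_vector_derivative_det2)
  have "DERIV ?f 0 :> det2 w (tangent D p)"
    using strand_has_derivative[of p 0] p
    by (auto intro!: derivative_eq_intros has_vector_derivative_det2)
  then have "((\<lambda>s. ?f s / s) \<longlongrightarrow> det2 w (tangent D p)) (at 0)"
    by (simp add: has_field_derivative_iff)
  then have lim: "((\<lambda>s. ?f s / s) \<longlongrightarrow> det2 w (tangent D p)) (at_left 0)"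
    "((\<lambda>s. ?f s / s) \<longlongrightarrow> det2 w (tangent D p)) (at_right 0)"
    by (auto simp: filterlim_at_split)
  have "isCont ?f 0"
    using \<open>DERIV ?f 0 :> _\<close> DERIV_isCont by blast
  then have "(?f \<longlongrightarrow> 0) (at 0)"
    by (simp add: isCont_def)
  then have f0: "(?f \<longlongrightarrow> 0) (at_left 0)" "(?f \<longlongrightarrow> 0) (at_right 0)"
    by (auto simp: filterlim_at_split)
  have evs: "\<forall>\<^sub>F s in at_left 0. DERIV ?f s :> det2 w (tangent D (shift p s))"
    "\<forall>\<^sub>F s in at_right 0. DERIV ?f s :> det2 w (tangent D (shift p s))"
    using ev by (auto simp: eventually_at_split)
  show "det2 w u = det2 w (tangent D p)" if "((\<lambda>s. tangent D (shift p s)) \<longlongrightarrow> u) (at_left 0)"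
  proof -
    have "((\<lambda>s. ?f s / s) \<longlongrightarrow> det2 w u) (at_left 0)"
      by (rule lhopital_left[OF f0(1) _ _ _ evs(1), of "\<lambda>s. s" "\<lambda>_. 1"])
        (use that in \<open>auto intro!: tendsto_eq_intros derivative_eq_intros eventually_at_leftI[of "- 1"]\<close>)
    then show ?thesis
      using lim(1) tendsto_unique trivial_limit_at_left_real by blast
  qed
  show "det2 w u = det2 w (tangent D p)" if "((\<lambda>s. tangent D (shift p s)) \<longlongrightarrow> u) (at_right 0)"
  proof -
    have "((\<lambda>s. ?f s / s) \<longlongrightarrow> det2 w u) (at_right 0)"
      by (rule lhopital_right[OF f0(2) _ _ _ evs(2), of "\<lambda>s. s" "\<lambda>_. 1"])
        (use that in \<open>auto intro!: tendsto_eq_intros derivative_eq_intros eventually_at_rightI[of 0 1]\<close>)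
    then show ?thesis
      using lim(2) tendsto_unique trivial_limit_at_right_real by blast
  qed
qed

lemma right_dir_smooth:
  assumes "p \<in> params D" "smooth_at D p" "right_of (tangent D p) w"
  shows "\<exists>e>0. right_dir (strand D p) e w"
proof -
  obtain u v where uv: "((\<lambda>s. tangent D (shift p s)) \<longlongrightarrow> u) (at_left 0)"
    "((\<lambda>s. tangent D (shift p s)) \<longlongrightarrow> v) (at_right 0)"
    using tangent_limits[OF assms(1)] by metis
  have "0 < det2 w (tangent D p)"
    using assms(3) by (simp add: right_of_def det2_commute[of w])
  then show ?thesis
    using right_dir_if_limits[OF assms(1) uv(1) _ uv(2)] tangent_limit_smooth[OF assms(1,2)] uv
    by metis
qed

end


section \<open>Winding numbers\<close>

definition loop :: "link_diagram \<Rightarrow> nat \<Rightarrow> real \<Rightarrow> complex" where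
  "loop D j t = strand D (j, 1) (2 * pi * t)"

text \<open>Winding numbers are complex-valued here; off the diagram their sum is an integer, and
  the floor of the real part merely changes its type. On the diagram the value is junk.\<close>

definition wind :: "link_diagram \<Rightarrow> complex \<Rightarrow> int" where
  "wind D z = \<lfloor>Re (\<Sum>j<ncomp D. winding_number (loop D j) z)\<rfloor>"

abbreviation drawn :: "link_diagram \<Rightarrow> complex set" where
  "drawn D \<equiv> pt D ` params D"

lemma right_dir_shift:
  assumes "right_dir (strand D p) e w" "\<bar>s\<bar> \<le> e - e'"
  shows "right_dir (strand D (shift p s)) e' w"
  unfolding right_dir_def
proof (intro allI impI)
  fix t t' assume t: "- e' \<le> t" "t < t'" "t' \<le> e'"
  have "0 < det2 w (strand D p (s + t') - strand D p (s + t))"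
    by (rule right_dirD[OF assms(1)]) (use t assms(2) in linarith)+
  then show "0 < det2 w (strand D (shift p s) t' - strand D (shift p s) t)"
    by simp
qed

lemma shift_eq_self:
  assumes "shift p s = p" "p \<in> params D"
  shows "\<exists>n::int. s = 2 * pi * n"
proof -
  have "snd p \<noteq> 0"
    using assms by (auto simp: params_def)
  then have "cis s = 1"
    using assms by (simp add: shift_def prod_eq_iff)
  then have "cos s = 1"
    by (simp add: complex_eq_iff)
  then show ?thesis
    using cos_one_2pi_int[of s] by (auto simp: mult_ac)
qed

text \<open>Continuity of \<open>Arg\<close> at 1, applied to the quotient \<open>z' / z\<close>,
  gives one \<open>d\<close> for all points of the circle.\<close>

lemma near_on_circle:
  assumes "0 < e"
  obtains d where "0 < d"
    "\<And>z z' :: complex. \<lbrakk>norm z = 1; norm z' = 1; dist z z' < d\<rbrakk> \<Longrightarrow> \<exists>s. \<bar>s\<bar> < e \<and> z' = z * cis s"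
proof -
  have "isCont Arg 1"
    by (rule continuous_at_Arg) simp
  then obtain d where d: "0 < d" "\<And>x. dist x 1 < d \<Longrightarrow> dist (Arg x) (Arg 1) < e"
    using assms unfolding continuous_at_eps_delta dist_norm by metis
  have "\<exists>s. \<bar>s\<bar> < e \<and> z' = z * cis s" if "norm z = 1" "norm z' = 1" "dist z z' < d" for z z' :: complex
  proof (intro exI conjI)
    have "z \<noteq> 0"
      using that by auto
    then have "z' / z - 1 = (z' - z) / z"
      by (simp add: field_simps)
    then have "dist (z' / z) 1 < d"
      using that by (simp add: dist_norm norm_divide norm_minus_commute)
    from d(2)[OF this] show "\<bar>Arg (z' / z)\<bar> < e"
      by (simp add: dist_norm)
    have "norm (z' / z) = 1"
      using that by (simp add: norm_divide)
    then have "z' / z = cis (Arg (z' / z))"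
      using Arg_eq[of "z' / z"] by (cases "z' / z = 0") (simp_all add: cis_conv_exp)
    then show "z' = z * cis (Arg (z' / z))"
      using \<open>z \<noteq> 0\<close> by (metis nonzero_mult_div_cancel_left times_divide_eq_right)
  qed
  then show thesis
    using that d(1) by blast
qed

context diagram
begin

lemma compact_drawn: "compact (drawn D)"
proof -
  have "drawn D = (\<Union>j<ncomp D. curve D j ` sphere 0 1)"
    by (force simp: params_def pt_def)
  then show ?thesis
    by (auto intro!: compact_continuous_image curve_continuous)
qed

lemma path_loop: "j < ncomp D \<Longrightarrow> path (loop D j)"
  unfolding path_def loop_def
  by (rule continuous_on_compose2[OF strand_continuous[of "(j, 1)" UNIV]])
    (auto simp: params_def intro!: continuous_intros)

lemma loop_closed: "pathfinish (loop D j) = pathstart (loop D j)"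
  by (simp add: pathfinish_def pathstart_def loop_def)

lemma path_image_loop: "j < ncomp D \<Longrightarrow> path_image (loop D j) \<subseteq> drawn D"
  by (auto simp: path_image_def loop_def params_def shift_def)

lemma of_int_wind:
  assumes "z \<notin> drawn D"
  shows "of_int (wind D z) = (\<Sum>j<ncomp D. winding_number (loop D j) z)"
proof -
  have "(\<Sum>j<ncomp D. winding_number (loop D j) z) \<in> \<int>"
    using assms path_image_loop
    by (intro Ints_sum integer_winding_number path_loop loop_closed) auto
  then obtain n where "(\<Sum>j<ncomp D. winding_number (loop D j) z) = of_int n"
    by (auto elim: Ints_cases)
  then show ?thesis
    by (simp add: wind_def)
qed

lemma wind_eq:
  assumes "connected X" "X \<inter> drawn D = {}" "x \<in> X" "y \<in> X"
  shows "wind D x = wind D y"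
proof -
  have "winding_number (loop D j) x = winding_number (loop D j) y" if "j < ncomp D" for j
    using assms path_image_loop[OF that]
    by (intro winding_number_eq[OF path_loop[OF that] loop_closed assms(3,4,1)]) auto
  then show ?thesis
    by (simp add: wind_def)
qed

text \<open>Compactness: once balls around the points of \<open>S\<close> are removed, what remains
  of the circles has compact image at a positive distance from \<open>P\<close>.\<close>

lemma preimage_near:
  assumes S: "\<And>q. q \<in> params D \<Longrightarrow> pt D q = P \<Longrightarrow> q \<in> S" and e: "0 < e"
  shows "\<exists>\<delta>>0. \<forall>q\<in>params D. dist (pt D q) P < \<delta> \<longrightarrow> (\<exists>p\<in>S. \<exists>s. \<bar>s\<bar> < e \<and> q = shift p s)"
proof -
  obtain d where d: "0 < d"
    "\<And>z z' :: complex. \<lbrakk>norm z = 1; norm z' = 1; dist z z' < d\<rbrakk> \<Longrightarrow> \<exists>s. \<bar>s\<bar> < e \<and> z' = z * cis s"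
    using near_on_circle[OF e] by blast
  define K where "K j = sphere 0 1 - (\<Union>p\<in>S \<inter> params D \<inter> {p. fst p = j}. ball (snd p) d)" for j
  have ev: "\<forall>\<^sub>F \<delta> in at_right 0. \<forall>z\<in>K j. \<delta> \<le> dist (curve D j z) P" if j: "j < ncomp D" for j
  proof -
    have "compact (K j)"
      unfolding K_def by (intro compact_diff compact_sphere open_UN ballI open_ball)
    then have "closed (curve D j ` K j)"
      by (intro compact_imp_closed compact_continuous_image continuous_on_subset[OF curve_continuous[OF j]])
        (auto simp: K_def)
    moreover have "P \<notin> curve D j ` K j"
    proof
      assume "P \<in> curve D j ` K j"
      then obtain z where z: "z \<in> K j" "P = curve D j z" by blast
      then have "(j, z) \<in> params D" "pt D (j, z) = P"
        using j by (auto simp: K_def params_def pt_def)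
      then have "(j, z) \<in> S" using S by blast
      then have "(j, z) \<in> S \<inter> params D \<inter> {p. fst p = j}" "z \<in> ball (snd (j, z)) d"
        using d(1) \<open>(j, z) \<in> params D\<close> by auto
      then have "z \<in> (\<Union>p\<in>S \<inter> params D \<inter> {p. fst p = j}. ball (snd p) d)"
        by blast
      moreover have "z \<notin> (\<Union>p\<in>S \<inter> params D \<inter> {p. fst p = j}. ball (snd p) d)"
        using z(1) unfolding K_def by simp
      ultimately show False
        by simp
    qed
    ultimately obtain \<eta> where "0 < \<eta>" "\<forall>x\<in>curve D j ` K j. \<eta> \<le> dist P x"
      using separate_point_closed[of "curve D j ` K j" P] by blast
    then show ?thesis
      by (intro eventually_at_rightI[of 0 \<eta>]) (force simp: dist_commute)+
  qed
  have "\<forall>\<^sub>F \<delta> in at_right 0. \<forall>j\<in>{..<ncomp D}. \<forall>z\<in>K j. \<delta> \<le> dist (curve D j z) P"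
    by (intro eventually_ball_finite ballI ev) auto
  moreover have "\<forall>\<^sub>F \<delta>::real in at_right 0. 0 < \<delta>"
    by (rule eventually_at_right_less)
  ultimately have "\<forall>\<^sub>F \<delta> in at_right 0. 0 < \<delta> \<and> (\<forall>j\<in>{..<ncomp D}. \<forall>z\<in>K j. \<delta> \<le> dist (curve D j z) P)"
    by eventually_elim blast
  then obtain \<delta> where \<delta>: "0 < \<delta>" "\<And>j z. \<lbrakk>j < ncomp D; z \<in> K j\<rbrakk> \<Longrightarrow> \<delta> \<le> dist (curve D j z) P"
    using eventually_happens'[OF trivial_limit_at_right_real] by blast
  have "\<exists>p\<in>S. \<exists>s. \<bar>s\<bar> < e \<and> q = shift p s" if q: "q \<in> params D" "dist (pt D q) P < \<delta>" for q
  proof -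
    have "snd q \<notin> K (fst q)" "norm (snd q) = 1"
      using \<delta>(2)[of "fst q" "snd q"] q by (auto simp: params_def pt_def)
    then obtain p where p: "p \<in> S" "p \<in> params D" "fst p = fst q" "dist (snd p) (snd q) < d"
      by (auto simp: K_def)
    then obtain s where "\<bar>s\<bar> < e" "snd q = snd p * cis s"
      using d(2)[of "snd p" "snd q"] \<open>norm (snd q) = 1\<close> by (auto simp: params_def)
    then show ?thesis
      using p by (metis prod.collapse shift_def)
  qed
  then show ?thesis
    using \<delta>(1) by blast
qed

text \<open>Near \<open>P\<close> the diagram consists of short pieces of strand through
  \<open>S\<close>, and a short vector that is a right or left direction of each of them is a chord
  of none.\<close>

lemma right_dir_clear:
  assumes S: "\<And>q. q \<in> params D \<Longrightarrow> pt D q = P \<Longrightarrow> q \<in> S" "\<And>p. p \<in> S \<Longrightarrow> pt D p = P" and e: "0 < e"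
  obtains \<delta> where "0 < \<delta>"
    "\<And>z. \<lbrakk>norm z < \<delta>; \<forall>p\<in>S. right_dir (strand D p) e z \<or> right_dir (strand D p) e (- z)\<rbrakk>
      \<Longrightarrow> z = 0 \<or> P + z \<notin> drawn D"
proof -
  obtain \<delta> where \<delta>: "0 < \<delta>"
    "\<And>q. \<lbrakk>q \<in> params D; dist (pt D q) P < \<delta>\<rbrakk> \<Longrightarrow> \<exists>p\<in>S. \<exists>s. \<bar>s\<bar> < e \<and> q = shift p s"
    using preimage_near[of P S, OF S(1) e] by metis
  have "z = 0" if z: "norm z < \<delta>" "P + z \<in> drawn D"
    "\<forall>p\<in>S. right_dir (strand D p) e z \<or> right_dir (strand D p) e (- z)" for z
  proof -
    obtain q where q: "q \<in> params D" "P + z = pt D q"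
      using z by blast
    then have "dist (pt D q) P < \<delta>"
      using z(1) by (metis add_diff_cancel_left' dist_norm)
    then obtain p s where p: "p \<in> S" "\<bar>s\<bar> < e" "q = shift p s"
      using \<delta>(2) q by blast
    have zs: "z = strand D p s - strand D p 0" "- z = strand D p 0 - strand D p s"
      using q(2) p S(2)[OF p(1)] by (auto simp: algebra_simps)
    from z(3) p(1) consider "right_dir (strand D p) e z" | "right_dir (strand D p) e (- z)"
      by blast
    then show "z = 0"
    proof cases
      case 1
      show ?thesis by (rule right_dir_avoids[OF 1 _ _ zs(1)]) (use p e in auto)
    next
      case 2
      have "- z = 0" by (rule right_dir_avoids[OF 2 _ _ zs(2)]) (use p e in auto)
      then show ?thesis by simp
    qed
  qed
  then show thesis
    by (auto intro: that[OF \<delta>(1)])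
qed

lemma unique_param:
  assumes "p \<in> params D" "p \<notin> double_params D" "q \<in> params D" "pt D q = pt D p"
  shows "q \<in> {p}"
  using assms by (auto simp: double_params_def)

end

text \<open>
  At a double point the winding number jumps along the strand itself and the value is junk; only
  the values at nearby parameters are used there.
\<close>

definition right_wind :: "link_diagram \<Rightarrow> nat \<times> complex \<Rightarrow> int" where
  "right_wind D p = (SOME n. \<exists>w. \<exists>e>0. right_dir (strand D p) e w \<and>
     (\<forall>\<^sub>F y in at_right 0. wind D (pt D p + y *\<^sub>R w) = n))"

lemma eventually_norm_scaleR_less:
  fixes w :: "'a::real_normed_vector"
  assumes "0 < \<delta>"
  shows "\<forall>\<^sub>F y in at_right 0. norm (y *\<^sub>R w) < \<delta>"
proof -
  have "((\<lambda>y. norm (y *\<^sub>R w)) \<longlongrightarrow> norm (0 *\<^sub>R w)) (at_right 0)"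
    by (intro tendsto_intros)
  then show ?thesis
    using assms by (intro order_tendstoD(2)) auto
qed

context diagram
begin

text \<open>The short right directions form a convex set, and its translate to \<open>pt D p\<close>
  misses the diagram. The bound depends on \<open>e\<close> but not on the directions.\<close>

lemma wind_right_dirs:
  assumes p: "p \<in> params D" "p \<notin> double_params D" and e: "0 < e"
  obtains \<delta> where "0 < \<delta>"
    "\<And>w w'. \<lbrakk>right_dir (strand D p) e w; right_dir (strand D p) e w'; norm w < \<delta>; norm w' < \<delta>\<rbrakk>
      \<Longrightarrow> wind D (pt D p + w) = wind D (pt D p + w')"
proof -
  obtain \<delta> where \<delta>: "0 < \<delta>"
    "\<And>z. \<lbrakk>norm z < \<delta>; \<forall>q\<in>{p}. right_dir (strand D q) e z \<or> right_dir (strand D q) e (- z)\<rbrakk>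
      \<Longrightarrow> z = 0 \<or> pt D p + z \<notin> drawn D"
    by (rule right_dir_clear[of "pt D p" "{p}", OF unique_param[OF p] _ e]) blast+
  let ?X = "{w. right_dir (strand D p) e w} \<inter> ball 0 \<delta>"
  have "convex {w. right_dir (strand D p) e w}"
    unfolding convex_def by (auto intro!: right_dir_cone)
  then have "connected ((+) (pt D p) ` ?X)"
    by (intro convex_connected convex_translation convex_Int convex_ball)
  moreover have "(+) (pt D p) ` ?X \<inter> drawn D = {}"
    using \<delta>(2) right_dir_nonzero[OF _ e] by force
  ultimately have "wind D (pt D p + w) = wind D (pt D p + w')" if "w \<in> ?X" "w' \<in> ?X" for w w'
    using that by (intro wind_eq[of "(+) (pt D p) ` ?X"]) auto
  then show thesis
    by (auto intro: that[OF \<delta>(1)])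
qed

text \<open>This frees \<open>right_wind\<close> from its choice operator: two right directions,
  valid on different ranges, are compared on the smaller range.\<close>

lemma eventually_right_wind:
  assumes p: "p \<in> params D" "p \<notin> double_params D" and e: "0 < e" and w: "right_dir (strand D p) e w"
  shows "\<forall>\<^sub>F y in at_right 0. wind D (pt D p + y *\<^sub>R w) = right_wind D p"
proof -
  let ?P = "\<lambda>n. \<exists>w. \<exists>e>0. right_dir (strand D p) e w \<and>
     (\<forall>\<^sub>F y in at_right 0. wind D (pt D p + y *\<^sub>R w) = n)"
  have near: "\<exists>\<delta>>0. \<forall>y y'. 0 < y \<longrightarrow> norm (y *\<^sub>R w) < \<delta> \<longrightarrow> 0 < y' \<longrightarrow> norm (y' *\<^sub>R w') < \<delta> \<longrightarrow>
      wind D (pt D p + y *\<^sub>R w) = wind D (pt D p + y' *\<^sub>R w')"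
    if w: "0 < e" "right_dir (strand D p) e w" "0 < e'" "right_dir (strand D p) e' w'" for w w' e e'
  proof -
    have e'': "0 < min e e'"
      using that by simp
    have rd: "right_dir (strand D p) (min e e') (y *\<^sub>R w)" "right_dir (strand D p) (min e e') (y *\<^sub>R w')"
      if "0 < y" for y
      using w that by (auto intro!: right_dir_scaleR intro: right_dir_mono)
    obtain \<delta> where "0 < \<delta>"
      "\<And>w w'. \<lbrakk>right_dir (strand D p) (min e e') w; right_dir (strand D p) (min e e') w';
        norm w < \<delta>; norm w' < \<delta>\<rbrakk> \<Longrightarrow> wind D (pt D p + w) = wind D (pt D p + w')"
      by (rule wind_right_dirs[OF p e'']) blast
    then show ?thesis
      using rd by blast
  qed
  have "\<exists>n. ?P n"
  proof -
    obtain \<delta> where \<delta>: "0 < \<delta>" "\<And>y y'. \<lbrakk>0 < y; norm (y *\<^sub>R w) < \<delta>; 0 < y'; norm (y' *\<^sub>R w) < \<delta>\<rbrakk>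
        \<Longrightarrow> wind D (pt D p + y *\<^sub>R w) = wind D (pt D p + y' *\<^sub>R w)"
      using near[OF e w e w] by blast
    have ev: "\<forall>\<^sub>F y in at_right 0. 0 < y \<and> norm (y *\<^sub>R w) < \<delta>"
      using eventually_norm_scaleR_less[OF \<delta>(1)] eventually_at_right_less by eventually_elim auto
    then obtain y0 where y0: "0 < y0 \<and> norm (y0 *\<^sub>R w) < \<delta>"
      using eventually_happens'[OF trivial_limit_at_right_real] by blast
    have "\<forall>\<^sub>F y in at_right 0. wind D (pt D p + y *\<^sub>R w) = wind D (pt D p + y0 *\<^sub>R w)"
      using ev by eventually_elim (use \<delta>(2) y0 in blast)
    then show ?thesis
      using e w by blast
  qed
  then have "?P (right_wind D p)"
    unfolding right_wind_def by (rule someI_ex)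
  then obtain w' e' where w': "0 < e'" "right_dir (strand D p) e' w'"
    and ev': "\<forall>\<^sub>F y in at_right 0. wind D (pt D p + y *\<^sub>R w') = right_wind D p"
    by blast
  obtain \<delta> where \<delta>: "0 < \<delta>" "\<And>y y'. \<lbrakk>0 < y; norm (y *\<^sub>R w) < \<delta>; 0 < y'; norm (y' *\<^sub>R w') < \<delta>\<rbrakk>
        \<Longrightarrow> wind D (pt D p + y *\<^sub>R w) = wind D (pt D p + y' *\<^sub>R w')"
    using near[OF e w w'] by blast
  show ?thesis
    using ev' eventually_norm_scaleR_less[OF \<delta>(1), of w] eventually_norm_scaleR_less[OF \<delta>(1), of w']
      eventually_at_right_less[of 0]
    by eventually_elim (metis \<delta>(2))
qed

text \<open>The bound is uniform in the direction. This matters when a path approaches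
  \<open>p\<close> along directions that vary with time.\<close>

lemma wind_eq_right_wind:
  assumes p: "p \<in> params D" "p \<notin> double_params D" and e: "0 < e"
  obtains \<delta> where "0 < \<delta>"
    "\<And>w. \<lbrakk>right_dir (strand D p) e w; norm w < \<delta>\<rbrakk> \<Longrightarrow> wind D (pt D p + w) = right_wind D p"
proof -
  obtain \<delta> where \<delta>: "0 < \<delta>"
    "\<And>w w'. \<lbrakk>right_dir (strand D p) e w; right_dir (strand D p) e w'; norm w < \<delta>; norm w' < \<delta>\<rbrakk>
      \<Longrightarrow> wind D (pt D p + w) = wind D (pt D p + w')"
    by (rule wind_right_dirs[OF p e]) blast
  have "wind D (pt D p + w) = right_wind D p" if w: "right_dir (strand D p) e w" "norm w < \<delta>" for w
  proof -
    have "\<forall>\<^sub>F y in at_right 0. wind D (pt D p + y *\<^sub>R w) = right_wind D p \<and> 0 < y \<and> norm (y *\<^sub>R w) < \<delta>"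
      using eventually_right_wind[OF p e w(1)] eventually_norm_scaleR_less[OF \<delta>(1), of w]
        eventually_at_right_less[of 0] by eventually_elim auto
    then obtain y where "wind D (pt D p + y *\<^sub>R w) = right_wind D p" "0 < y" "norm (y *\<^sub>R w) < \<delta>"
      using eventually_happens'[OF trivial_limit_at_right_real] by blast
    then show ?thesis
      using \<delta>(2)[OF w(1) right_dir_scaleR[OF w(1)] w(2)] by metis
  qed
  then show thesis
    by (auto intro: that[OF \<delta>(1)])
qed

text \<open>Pushing a short piece of strand off itself along one fixed right direction sweeps out a
  connected collar that misses the diagram and touches every nearby parameter from the
  right.\<close>

lemma right_wind_locally_constant:
  assumes p: "p \<in> params D" "p \<notin> double_params D"
  shows "\<forall>\<^sub>F s in at 0. right_wind D (shift p s) = right_wind D p"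
proof -
  obtain w e where e: "0 < e" and w: "right_dir (strand D p) e w"
    using right_dir_exists[OF p(1)] by blast
  obtain \<delta> where \<delta>: "0 < \<delta>"
    "\<And>q. \<lbrakk>q \<in> params D; dist (pt D q) (pt D p) < \<delta>\<rbrakk> \<Longrightarrow> \<exists>p'\<in>{p}. \<exists>s. \<bar>s\<bar> < e \<and> q = shift p' s"
    using preimage_near[of "pt D p" "{p}", OF unique_param[OF p] e] by metis
  let ?h = "\<lambda>(s, y). strand D p s + y *\<^sub>R w"
  have cont: "continuous_on UNIV ?h"
    unfolding case_prod_unfold
    by (intro continuous_intros continuous_on_compose2[OF strand_continuous[OF p(1), of UNIV]]) auto
  then have "isCont ?h (0, 0)"
    by (simp add: continuous_on_eq_continuous_at)
  then obtain \<eta> where \<eta>: "0 < \<eta>" "\<And>x. dist x (0, 0) < \<eta> \<Longrightarrow> dist (?h x) (?h (0, 0)) < \<delta>"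
    using \<delta>(1) unfolding continuous_at_eps_delta dist_norm by metis
  \<comment> \<open>With \<open>\<eta> / 2\<close> the coordinates \<open>s\<close> and
    \<open>y\<close> together stay within \<open>\<eta>\<close>; with \<open>e / 2\<close> the
    direction \<open>w\<close> is still right on a range \<open>e / 2\<close> after a shift by
    \<open>s\<close>.\<close>
  define a where "a = min (\<eta> / 2) (e / 2)"
  have a: "0 < a" "a \<le> \<eta> / 2" "a \<le> e / 2"
    using \<eta> e by (auto simp: a_def)
  let ?X = "?h ` ({- a<..<a} \<times> {0<..<a})"
  have "connected ?X"
    by (intro connected_continuous_image continuous_on_subset[OF cont] connected_Times) auto
  moreover have "?X \<inter> drawn D = {}"
  proof (rule ccontr)
    assume "?X \<inter> drawn D \<noteq> {}"
    then obtain s y q where "s \<in> {- a<..<a}" "y \<in> {0<..<a}" and q: "q \<in> params D" "pt D q = ?h (s, y)"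
      by force
    then have sy: "\<bar>s\<bar> < a" "0 < y" "y < a"
      by auto
    have "dist (s, y) (0, 0) \<le> \<bar>s\<bar> + \<bar>y\<bar>"
      by (simp add: dist_Pair_Pair sqrt_sum_squares_le_sum_abs)
    then have "dist (?h (s, y)) (?h (0, 0)) < \<delta>"
      using sy a by (intro \<eta>(2)) auto
    then obtain s' where s': "\<bar>s'\<bar> < e" "q = shift p s'"
      using \<delta>(2)[OF q(1)] q(2) by auto
    have "y *\<^sub>R w = 0"
    proof (rule right_dir_avoids)
      show "right_dir (strand D p) e (y *\<^sub>R w)"
        using w sy by (rule_tac right_dir_scaleR)
      show "y *\<^sub>R w = strand D p s' - strand D p s"
        using q s' by (simp add: algebra_simps)
    qed (use sy s' a in auto)
    then show False
      using sy right_dir_nonzero[OF w e] by simp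
  qed
  ultimately have const: "wind D (?h x) = wind D (?h x')"
    if "x \<in> {- a<..<a} \<times> {0<..<a}" "x' \<in> {- a<..<a} \<times> {0<..<a}" for x x'
    using that by (intro wind_eq[of ?X]) auto
  have eq: "right_wind D (shift p s) = wind D (?h (0, a / 2))"
    if s: "\<bar>s\<bar> < a" "shift p s \<notin> double_params D" for s
  proof -
    have "right_dir (strand D (shift p s)) (e / 2) w"
      by (rule right_dir_shift[OF w]) (use s a in auto)
    then have "\<forall>\<^sub>F y in at_right 0. wind D (pt D (shift p s) + y *\<^sub>R w) = right_wind D (shift p s)"
      using eventually_right_wind[of "shift p s" "e / 2" w] s p e by simp
    moreover have "\<forall>\<^sub>F y in at_right 0. 0 < y \<and> y < a"
      using a(1) by (intro eventually_at_rightI[of 0 a]) auto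
    ultimately have "\<forall>\<^sub>F y in at_right 0. 0 < y \<and> y < a \<and>
        wind D (pt D (shift p s) + y *\<^sub>R w) = right_wind D (shift p s)"
      by eventually_elim auto
    then obtain y where "0 < y" "y < a" "wind D (pt D (shift p s) + y *\<^sub>R w) = right_wind D (shift p s)"
      using eventually_happens'[OF trivial_limit_at_right_real] by blast
    then show ?thesis
      using const[of "(s, y)" "(0, a / 2)"] s a by (auto simp: abs_less_iff)
  qed
  have "\<forall>\<^sub>F s in at 0. \<bar>s\<bar> < a"
    using a(1) by (auto simp: eventually_at dist_real_def)
  with eventually_shift_notin[OF finite_double p(1)] show ?thesis
    by eventually_elim (use eq eq[of 0] a p in auto)
qed

end


section \<open>The jump of the winding number\<close>

text \<open>The logarithms of 1 are the multiples of 2 pi i, and distinct ones are at least 2 pi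
  apart.\<close>

lemma exp_discrete_constant:
  fixes h :: "real \<Rightarrow> complex"
  assumes "connected S" "continuous_on S h" "\<And>t. t \<in> S \<Longrightarrow> exp (h t) = 1" "x \<in> S" "y \<in> S"
  shows "h x = h y"
proof -
  have "h constant_on S"
  proof (rule continuous_discrete_range_constant[OF assms(1,2)])
    fix x assume x: "x \<in> S"
    show "\<exists>e>0. \<forall>y. y \<in> S \<and> h y \<noteq> h x \<longrightarrow> e \<le> norm (h y - h x)"
    proof (intro exI conjI allI impI)
      fix y assume y: "y \<in> S \<and> h y \<noteq> h x"
      then have "exp (h y - h x) = 1"
        using assms(3) x by (simp add: exp_diff)
      then obtain n :: int where n: "Re (h y - h x) = 0" "Im (h y - h x) = of_int (2 * n) * pi"
        using exp_eq_1 by blast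
      then have "n \<noteq> 0"
        using y by (auto simp: complex_eq_iff)
      then have "1 \<le> \<bar>real_of_int n\<bar>"
        by linarith
      then have "2 * pi * 1 \<le> 2 * pi * \<bar>real_of_int n\<bar>"
        by (intro mult_left_mono) auto
      also have "\<dots> = \<bar>Im (h y - h x)\<bar>"
        by (simp only: n(2)) (simp add: abs_mult)
      also have "\<dots> \<le> norm (h y - h x)"
        by (rule abs_Im_le_cmod)
      finally show "2 * pi \<le> norm (h y - h x)"
        by simp
    qed simp
  qed
  then show ?thesis
    using assms(4,5) unfolding constant_on_def by metis
qed

lemma Im_ratio_sign:
  "Im ((x + w) / (x - w)) = - (2 * det2 w x / (norm (x - w))\<^sup>2)"
  by (simp add: Im_divide det2_Re_Im cmod_power2 algebra_simps diff_divide_distrib)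

text \<open>The quotient is a nonpositive real exactly when \<open>x\<close> sees \<open>- w\<close>
  and \<open>w\<close> in opposite directions or coincides with \<open>- w\<close>, that is, on the
  segment joining the two.\<close>

lemma ratio_nonpos_Reals:
  fixes x w :: complex
  assumes "(x + w) / (x - w) \<in> \<real>\<^sub>\<le>\<^sub>0" "x \<noteq> w"
  obtains c :: real where "\<bar>c\<bar> \<le> 1" "x = c *\<^sub>R w"
proof -
  obtain r where r: "r \<le> 0" "(x + w) / (x - w) = complex_of_real r"
    using assms by (auto simp: complex_nonpos_Reals_iff complex_eq_iff)
  then have "x + w = of_real r * (x - w)"
    using assms(2) by (simp add: field_simps)
  then have "of_real (1 - r) * x = of_real (- 1 - r) * w"
    by (simp add: algebra_simps)
  then have "x = of_real ((- 1 - r) / (1 - r)) * w"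
    using r(1) by (simp add: field_simps)
  then have "x = ((- 1 - r) / (1 - r)) *\<^sub>R w"
    by (simp add: scaleR_conv_of_real)
  moreover have "\<bar>(- 1 - r) / (1 - r)\<bar> \<le> 1"
    using r(1) by (auto simp: abs_le_iff field_simps)
  ultimately show thesis
    using that by blast
qed

text \<open>
  The quotient of the two loops based at the points to be compared starts and ends at \<open>-1\<close> and
  stays off the negative real axis in between, so the principal logarithm computes its change of
  argument.
\<close>

lemma winding_number_jump:
  assumes g: "path g" "pathstart g = P" "pathfinish g = P"
    and seg: "\<And>t c. \<lbrakk>0 < t; t < 1; \<bar>c\<bar> \<le> 1\<rbrakk> \<Longrightarrow> g t \<noteq> P + c *\<^sub>R w" and w: "w \<noteq> 0"
    and right: "\<forall>\<^sub>F t in at_right 0. 0 < det2 w (g t - P)"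
    and left: "\<forall>\<^sub>F t in at_left 1. det2 w (g t - P) < 0"
  shows "winding_number g (P - w) = winding_number g (P + w) + 1"
proof -
  define \<rho> where "\<rho> t = (g t - (P - w)) / (g t - (P + w))" for t
  \<comment> \<open>The values at the ends are the one-sided limits of \<open>Ln (\<rho> t)\<close>
    at the branch cut: \<open>\<rho>\<close> leaves -1 into the lower half-plane and returns to it
    through the upper one.\<close>
  define L where "L t = (if t = 0 then - (\<i> * pi) else if t = 1 then \<i> * pi else Ln (\<rho> t))" for t :: real
  have ends: "g 0 = P" "g 1 = P"
    using g by (auto simp: pathstart_def pathfinish_def)
  have avoid: "g t \<noteq> P + c *\<^sub>R w" if "t \<in> {0..1}" "\<bar>c\<bar> \<le> 1" "c \<noteq> 0" for t c
    using seg[of t c] that ends w by (cases "t = 0 \<or> t = 1") auto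
  have ne: "g t - (P - w) \<noteq> 0" "g t - (P + w) \<noteq> 0" if "t \<in> {0..1}" for t
    using avoid[OF that, of "-1"] avoid[OF that, of 1] by auto
  have \<rho>_eq: "\<rho> t = ((g t - P) + w) / ((g t - P) - w)" for t
    by (simp add: \<rho>_def algebra_simps)
  have cont_\<rho>: "continuous_on {0..1} \<rho>"
    unfolding \<rho>_def using g(1) ne by (auto simp: path_def intro!: continuous_intros)
  have \<rho>_ne: "\<rho> t \<noteq> 0" if "t \<in> {0..1}" for t
    using ne[OF that] by (simp add: \<rho>_def)
  have \<rho>_ends: "\<rho> 0 = - 1" "\<rho> 1 = - 1"
    using w by (simp_all add: \<rho>_def ends)
  have slit: "\<rho> t \<notin> \<real>\<^sub>\<le>\<^sub>0" if t: "0 < t" "t < 1" for t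
  proof
    assume "\<rho> t \<in> \<real>\<^sub>\<le>\<^sub>0"
    moreover have "g t - P \<noteq> w"
      using ne(2)[of t] t by (auto simp: algebra_simps)
    ultimately obtain c where "\<bar>c\<bar> \<le> 1" "g t - P = c *\<^sub>R w"
      using ratio_nonpos_Reals[of "g t - P" w] unfolding \<rho>_eq by blast
    then show False
      using seg[OF t, of c] by (simp add: algebra_simps)
  qed
  have Im_\<rho>: "Im (\<rho> t) = - (2 * det2 w (g t - P) / (norm (g t - P - w))\<^sup>2)" for t
    unfolding \<rho>_eq by (rule Im_ratio_sign)
  have exp_L: "exp (L t) = \<rho> t" if "t \<in> {0..1}" for t
    using that \<rho>_ends \<rho>_ne[OF that] by (auto simp: L_def exp_minus)
  have cont_L: "continuous_on {0..1} L"
  proof (rule continuous_on_subset, unfold continuous_on_eq_continuous_within, rule ballI)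
    fix t :: real assume t: "t \<in> {0..1}"
    consider "t = 0" | "t = 1" | "0 < t" "t < 1" using t by fastforce
    then show "continuous (at t within {0..1}) L"
    proof cases
      case 1
      have "(\<rho> \<longlongrightarrow> \<rho> 0) (at 0 within {0..1})"
        using cont_\<rho> unfolding continuous_on_def by simp
      \<comment> \<open>\<open>Ln\<close> jumps at -1, so the limit is taken for
        \<open>Ln (- \<rho> t)\<close>, whose argument tends to 1; the sign of the imaginary part of
        \<open>\<rho>\<close> decides whether \<open>\<i> * pi\<close> is subtracted or, at the
        other end, added.\<close>
      then have "((\<lambda>t. Ln (- \<rho> t)) \<longlongrightarrow> Ln (- \<rho> 0)) (at 0 within {0..1})"
        by (intro tendsto_Ln tendsto_minus) (simp_all add: \<rho>_ends)
      then have lim: "((\<lambda>t. Ln (- \<rho> t) - \<i> * pi) \<longlongrightarrow> Ln (- \<rho> 0) - \<i> * pi) (at 0 within {0..1})"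
        by (intro tendsto_diff tendsto_const)
      have ev: "\<forall>\<^sub>F t in at 0 within {0..1}. Ln (- \<rho> t) - \<i> * pi = L t"
      proof -
        have "\<forall>\<^sub>F t in at_right 0. t < (1::real)"
          by (intro eventually_at_rightI[of 0 1]) auto
        with right have "\<forall>\<^sub>F t in at_right 0. Ln (- \<rho> t) - \<i> * pi = L t"
          using eventually_at_right_less[of 0]
        proof eventually_elim
          case (elim t)
          then have "Im (\<rho> t) < 0"
            using ne(2)[of t] by (auto simp: Im_\<rho> diff_diff_eq intro!: divide_pos_pos)
          moreover have "\<rho> t \<noteq> 0"
            using \<rho>_ne[of t] elim by simp
          ultimately show ?case
            using elim by (simp add: L_def Ln_minus)
        qed
        then show ?thesis
          by (simp add: at_within_Icc_at_right)
      qed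
      have "L 0 = Ln (- \<rho> 0) - \<i> * pi"
        by (simp add: L_def \<rho>_ends)
      then show ?thesis
        using Lim_transform_eventually[OF lim ev] 1 by (simp add: continuous_within)
    next
      case 2
      have "(\<rho> \<longlongrightarrow> \<rho> 1) (at 1 within {0..1})"
        using cont_\<rho> unfolding continuous_on_def by simp
      then have "((\<lambda>t. Ln (- \<rho> t)) \<longlongrightarrow> Ln (- \<rho> 1)) (at 1 within {0..1})"
        by (intro tendsto_Ln tendsto_minus) (simp_all add: \<rho>_ends)
      then have lim: "((\<lambda>t. Ln (- \<rho> t) + \<i> * pi) \<longlongrightarrow> Ln (- \<rho> 1) + \<i> * pi) (at 1 within {0..1})"
        by (intro tendsto_add tendsto_const)
      have ev: "\<forall>\<^sub>F t in at 1 within {0..1}. Ln (- \<rho> t) + \<i> * pi = L t"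
      proof -
        have "\<forall>\<^sub>F t in at_left 1. (0::real) < t \<and> t < 1"
          by (intro eventually_at_leftI[of 0]) auto
        with left have "\<forall>\<^sub>F t in at_left 1. Ln (- \<rho> t) + \<i> * pi = L t"
        proof eventually_elim
          case (elim t)
          then have "Im (\<rho> t) > 0"
            using ne(2)[of t] by (auto simp: Im_\<rho> diff_diff_eq intro!: divide_neg_pos)
          moreover have "\<rho> t \<noteq> 0"
            using \<rho>_ne[of t] elim by simp
          ultimately show ?case
            using elim by (simp add: L_def Ln_minus)
        qed
        then show ?thesis
          by (simp add: at_within_Icc_at_left)
      qed
      have "L 1 = Ln (- \<rho> 1) + \<i> * pi"
        by (simp add: L_def \<rho>_ends)
      then show ?thesis
        using Lim_transform_eventually[OF lim ev] 2 by (simp add: continuous_within)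
    next
      case 3
      have "isCont \<rho> t"
        by (rule continuous_on_interior[OF cont_\<rho>]) (use 3 in simp)
      then have "(\<rho> \<longlongrightarrow> \<rho> t) (at t)"
        by (simp add: isCont_def)
      then have lim: "((\<lambda>t. Ln (\<rho> t)) \<longlongrightarrow> Ln (\<rho> t)) (at t)"
        by (rule tendsto_Ln[OF _ slit[OF 3]])
      have ev: "\<forall>\<^sub>F t in at t. Ln (\<rho> t) = L t"
        using eventually_at_in_open'[of "{0<..<1}" t] 3
        by (auto simp: L_def elim!: eventually_mono)
      have "L t = Ln (\<rho> t)"
        using 3 by (simp add: L_def)
      then have "isCont L t"
        using Lim_transform_eventually[OF lim ev] by (simp add: isCont_def)
      then show ?thesis
        by (rule continuous_at_imp_continuous_within)
    qed
  qed simp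
  have notin: "P - w \<notin> path_image g" "P + w \<notin> path_image g"
    using ne unfolding path_image_def by force+
  obtain a where a: "path a" "pathfinish a - pathstart a = 2 * of_real pi * \<i> * winding_number g (P - w)"
      "\<And>t. t \<in> {0..1} \<Longrightarrow> g t = P - w + exp (a t)"
    using winding_number_as_continuous_log[OF g(1) notin(1)] by blast
  obtain b where b: "path b" "pathfinish b - pathstart b = 2 * of_real pi * \<i> * winding_number g (P + w)"
      "\<And>t. t \<in> {0..1} \<Longrightarrow> g t = P + w + exp (b t)"
    using winding_number_as_continuous_log[OF g(1) notin(2)] by blast
  \<comment> \<open>Both \<open>a - b\<close> and \<open>L\<close> are continuous logarithms of
    \<open>\<rho>\<close>, so they have the same total change, which for \<open>L\<close> is 2 pi
    i.\<close>
  have "a 0 - b 0 - L 0 = a 1 - b 1 - L 1"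
  proof (rule exp_discrete_constant[of "{0..1}" "\<lambda>t. a t - b t - L t"])
    show "continuous_on {0..1} (\<lambda>t. a t - b t - L t)"
      using a(1) b(1) cont_L by (auto simp: path_def intro!: continuous_intros)
    show "exp (a t - b t - L t) = 1" if "t \<in> {0..1}" for t
    proof -
      have "exp (a t) = g t - (P - w)" "exp (b t) = g t - (P + w)"
        using a(3)[OF that] b(3)[OF that] by (simp_all add: algebra_simps)
      then have "exp (a t) / exp (b t) = exp (L t)"
        by (simp add: exp_L[OF that] \<rho>_def)
      then show ?thesis
        by (simp add: exp_diff)
    qed
  qed auto
  then have "(pathfinish a - pathstart a) - (pathfinish b - pathstart b) = L 1 - L 0"
    by (simp add: pathfinish_def pathstart_def algebra_simps)
  also have "\<dots> = 2 * of_real pi * \<i>"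
    by (simp add: L_def)
  finally have "2 * of_real pi * \<i> * (winding_number g (P - w) - winding_number g (P + w)) = 2 * of_real pi * \<i> * 1"
    unfolding a(2) b(2) by (simp add: algebra_simps)
  then have "winding_number g (P - w) - winding_number g (P + w) = 1"
    by (subst (asm) mult_cancel_left) auto
  then show ?thesis
    by (simp add: algebra_simps)
qed

context diagram
begin

text \<open>Only the component through \<open>p\<close> contributes. All other components miss the
  short segment across the strand, so their winding numbers agree at its two ends.\<close>

lemma wind_jump:
  assumes p: "p \<in> params D" "p \<notin> double_params D" and e: "0 < e" and w: "right_dir (strand D p) e w"
  shows "\<forall>\<^sub>F y in at_right 0. wind D (pt D p - y *\<^sub>R w) = wind D (pt D p + y *\<^sub>R w) + 1"
proof -
  define P where "P = pt D p"
  define j where "j = fst p"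
  have j: "j < ncomp D"
    using p by (auto simp: params_def j_def)
  have w0: "w \<noteq> 0"
    by (rule right_dir_nonzero[OF w e])
  obtain \<delta> where \<delta>: "0 < \<delta>"
    "\<And>z. \<lbrakk>norm z < \<delta>; \<forall>q\<in>{p}. right_dir (strand D q) e z \<or> right_dir (strand D q) e (- z)\<rbrakk>
      \<Longrightarrow> z = 0 \<or> P + z \<notin> drawn D"
    by (rule right_dir_clear[of P "{p}", OF unique_param[OF p, folded P_def] _ e]) (auto simp: P_def)
  obtain t0 where t0: "0 \<le> t0" "t0 < 2 * pi" "p = shift (j, 1) t0"
    using params_eq_shift[OF p(1)] unfolding j_def by metis
  define g where "g t = strand D p (2 * pi * t)" for t
  \<comment> \<open>\<open>winding_number_jump\<close> needs a loop based at \<open>p\<close>;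
    rotating the parameter provides one without changing winding numbers.\<close>
  have g_shift: "shiftpath (t0 / (2 * pi)) (loop D j) = g"
  proof
    fix t
    have "shift (j, 1) (2 * pi * (t0 / (2 * pi) + t - 1)) = shift (shift (j, 1) (t0 + 2 * pi * t - 2 * pi)) (2 * pi)"
      unfolding shift_2pi by (simp add: algebra_simps)
    then show "shiftpath (t0 / (2 * pi)) (loop D j) t = g t"
      by (simp add: shiftpath_def loop_def g_def t0(3) algebra_simps)
  qed
  have g_wind: "winding_number g z = winding_number (loop D j) z" if "z \<notin> drawn D" for z
    unfolding g_shift[symmetric] using that path_image_loop[OF j] t0
    by (intro winding_number_shiftpath path_loop[OF j] loop_closed) auto
  have path_g: "path g"
    unfolding g_shift[symmetric] using t0
    by (intro path_shiftpath path_loop[OF j] loop_closed) auto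
  have ends: "pathstart g = P" "pathfinish g = P"
    by (simp_all add: g_def pathstart_def pathfinish_def P_def)
  have hit: "g t \<noteq> P" if "0 < t" "t < 1" for t
  proof
    assume "g t = P"
    then have "shift p (2 * pi * t) = p"
      using unique_param[OF p, of "shift p (2 * pi * t)"] p by (simp add: g_def P_def)
    then obtain n :: int where "2 * pi * t = 2 * pi * n"
      using shift_eq_self p(1) by blast
    then show False
      using that by simp
  qed
  have right: "\<forall>\<^sub>F t in at_right 0. 0 < det2 w (g t - P)"
  proof (rule eventually_at_rightI)
    show "0 < det2 w (g t - P)" if "t \<in> {0<..<e / (2 * pi)}" for t
      using right_dirD[OF w, of 0 "2 * pi * t"] that e by (simp add: g_def P_def field_simps)
  qed (use e in simp)
  have left: "\<forall>\<^sub>F t in at_left 1. det2 w (g t - P) < 0"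
  proof (rule eventually_at_leftI)
    show "det2 w (g t - P) < 0" if "t \<in> {1 - e / (2 * pi)<..<1}" for t
    proof -
      \<comment> \<open>Periodicity turns a time shortly before 1 into a small negative parameter,
        where \<open>w\<close> is known to be a right direction.\<close>
      have "g t = strand D p (2 * pi * (t - 1))"
        using shift_2pi[of "shift p (2 * pi * (t - 1))"] by (simp add: g_def algebra_simps)
      moreover have "2 * pi * (1 - t) < 2 * pi * (e / (2 * pi))"
        using that by (intro mult_strict_left_mono) auto
      ultimately show ?thesis
        using right_dirD[OF w, of "2 * pi * (t - 1)" 0] that e
        by (simp add: P_def det2_diff_right algebra_simps)
    qed
  qed (use e in simp)
  have jump: "wind D (P - v) = wind D (P + v) + 1" if v: "right_dir (strand D p) e v" "norm v < \<delta>" "v \<noteq> 0" "\<exists>a>0. v = a *\<^sub>R w" for v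
  proof -
    have off: "P + c *\<^sub>R v \<notin> drawn D" if "\<bar>c\<bar> \<le> 1" "c \<noteq> 0" for c
    proof -
      have "norm (c *\<^sub>R v) < \<delta>"
        using that v(2) mult_right_mono[of "\<bar>c\<bar>" 1 "norm v"] by simp
      moreover have "right_dir (strand D p) e (c *\<^sub>R v) \<or> right_dir (strand D p) e (- (c *\<^sub>R v))"
        using right_dir_scaleR[OF v(1), of c] right_dir_scaleR[OF v(1), of "- c"] that by (cases "0 < c") auto
      ultimately show ?thesis
        using \<delta>(2)[of "c *\<^sub>R v"] that v by auto
    qed
    have off': "P + v \<notin> drawn D" "P - v \<notin> drawn D"
      using off[of 1] off[of "-1"] by auto
    have "winding_number (loop D j) (P - v) = winding_number (loop D j) (P + v) + 1"
      unfolding g_wind[OF off'(1), symmetric] g_wind[OF off'(2), symmetric]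
    proof (rule winding_number_jump[OF path_g ends])
      fix t c :: real assume t: "0 < t" "t < 1" "\<bar>c\<bar> \<le> 1"
      have "g t \<in> drawn D"
        using p by (simp add: g_def)
      then show "g t \<noteq> P + c *\<^sub>R v"
        using off[of c] hit[of t] t by (cases "c = 0") auto
    next
      obtain a where a: "a > 0" "v = a *\<^sub>R w" using v by blast
      show "\<forall>\<^sub>F t in at_right 0. 0 < det2 v (g t - P)"
        using right by eventually_elim (use a in \<open>simp add: det2_scaleR_left\<close>)
      show "\<forall>\<^sub>F t in at_left 1. det2 v (g t - P) < 0"
        using left by eventually_elim (use a in \<open>simp add: det2_scaleR_left mult_pos_neg\<close>)
    qed (use v in auto)
    \<comment> \<open>Another component could meet the segment only in its midpoint
      \<open>P\<close>, and then \<open>p\<close> would be a double parameter.\<close>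
    moreover have "winding_number (loop D i) (P - v) = winding_number (loop D i) (P + v)"
      if i: "i < ncomp D" "i \<noteq> j" for i
    proof (rule winding_number_eq[OF path_loop[OF i(1)] loop_closed, of _ "(\<lambda>c. P + c *\<^sub>R v) ` {-1..1}"])
      show "connected ((\<lambda>c. P + c *\<^sub>R v) ` {- 1..1})"
        by (intro connected_continuous_image continuous_intros) auto
      show "(\<lambda>c. P + c *\<^sub>R v) ` {- 1..1} \<inter> path_image (loop D i) = {}"
      proof (rule ccontr)
        assume "\<not> ?thesis"
        then obtain c where "c \<in> {-1..1}" and cP: "P + c *\<^sub>R v \<in> path_image (loop D i)" by blast
        then have c: "\<bar>c\<bar> \<le> 1" "P + c *\<^sub>R v \<in> path_image (loop D i)" by auto
        have "c = 0"
          using off[OF c(1)] c(2) path_image_loop[OF i(1)] by auto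
        with c(2) obtain t where "strand D (i, 1) (2 * pi * t) = P"
          by (auto simp: path_image_def loop_def)
        moreover have "shift (i, 1) (2 * pi * t) \<in> params D"
          using i unfolding shift_in_params by (simp add: params_def)
        ultimately have "shift (i, 1) (2 * pi * t) = p"
          using unique_param[OF p] by (simp add: P_def)
        then show False
          using i by (metis fst_conv fst_shift j_def)
      qed
      show "P - v \<in> (\<lambda>c. P + c *\<^sub>R v) ` {- 1..1}" "P + v \<in> (\<lambda>c. P + c *\<^sub>R v) ` {- 1..1}"
        by (rule image_eqI[of _ _ "-1"] image_eqI[of _ _ 1]; simp)+
    qed
    ultimately have "(\<Sum>i<ncomp D. winding_number (loop D i) (P - v))
        = (\<Sum>i<ncomp D. winding_number (loop D i) (P + v) + (if i = j then 1 else 0))"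
      by (intro sum.cong) auto
    also have "\<dots> = (\<Sum>i<ncomp D. winding_number (loop D i) (P + v)) + 1"
      using j by (simp add: sum.distrib)
    finally have "complex_of_int (wind D (P - v)) = of_int (wind D (P + v) + 1)"
      by (simp add: of_int_wind[OF off'(1)] of_int_wind[OF off'(2)])
    then show ?thesis
      by (simp only: of_int_eq_iff)
  qed
  show ?thesis
    using eventually_norm_scaleR_less[OF \<delta>(1), of w] eventually_at_right_less[of 0]
  proof eventually_elim
    case (elim y)
    then show ?case
      using jump[of "y *\<^sub>R w"] right_dir_scaleR[OF w, of y] w0 unfolding P_def by auto
  qed
qed

lemma eventually_left_wind:
  assumes p: "p \<in> params D" "p \<notin> double_params D" and e: "0 < e" and w: "right_dir (strand D p) e w"
  shows "\<forall>\<^sub>F y in at_right 0. wind D (pt D p - y *\<^sub>R w) = right_wind D p + 1"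
  using wind_jump[OF assms] eventually_right_wind[OF assms] by eventually_elim simp

end


section \<open>The four regions at a crossing\<close>

context diagram
begin

text \<open>The sign selects the direction of travel; running the strand backwards exchanges its
  sides, whence the passage to \<open>- w\<close>.\<close>

lemma right_dir_signed:
  assumes "p \<in> params D" "smooth_at D p" "\<sigma> = 1 \<or> \<sigma> = - 1" "0 < det2 w (\<sigma> *\<^sub>R tangent D p)"
  shows "\<exists>e>0. right_dir (\<lambda>s. strand D p (\<sigma> * s)) e w"
proof (cases "\<sigma> = 1")
  case True
  then have "right_of (tangent D p) w"
    using assms(4) by (simp add: right_of_def det2_commute[of w])
  then show ?thesis
    using right_dir_smooth[OF assms(1,2)] True by auto
next
  case False
  then have "right_of (tangent D p) (- w)" "\<sigma> = - 1"
    using assms(3,4) by (simp_all add: right_of_def det2_commute[of w])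
  then obtain e where "0 < e" "right_dir (strand D p) e (- w)"
    using right_dir_smooth[OF assms(1,2)] by blast
  then show ?thesis
    using right_dir_reverse[of "strand D p" e "- w"] \<open>\<sigma> = - 1\<close> by auto
qed

text \<open>
  The directions \<open>w\<^sub>1\<close> and \<open>w\<^sub>2\<close> span a cone on the right of \<open>h\<close> which \<open>g\<close> enters through its
  apex; since the cone consists of right directions of \<open>h\<close>, it is disjoint from \<open>h\<close>.
\<close>

lemma right_dir_in_sector:
  assumes g: "right_dir g e w1" "right_dir g e (- w2)" and h: "right_dir h e w1" "right_dir h e w2"
    and d: "0 < det2 w1 w2" and s: "0 \<le> s" "s \<le> e" and y: "0 < y" and w: "w = w1 \<or> w = w2"
  shows "right_dir h e (g s - g 0 + y *\<^sub>R w)"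
proof -
  let ?z = "g s - g 0"
  obtain a b where ab: "0 \<le> a" "0 \<le> b" "?z = a *\<^sub>R w1 + b *\<^sub>R w2"
  proof
    show "?z = (det2 ?z w2 / det2 w1 w2) *\<^sub>R w1 + (det2 w1 ?z / det2 w1 w2) *\<^sub>R w2"
      using d by (intro det2_basis) simp
    have "0 \<le> det2 ?z w2 \<and> 0 \<le> det2 w1 ?z"
    proof (cases "s = 0")
      case False
      then have "0 < det2 w1 ?z" "0 < det2 (- w2) ?z"
        using right_dirD[OF g(1), of 0 s] right_dirD[OF g(2), of 0 s] s by auto
      then show ?thesis
        using det2_commute[of w2 ?z] by simp
    qed (simp add: det2_Re_Im)
    then show "0 \<le> det2 ?z w2 / det2 w1 w2" "0 \<le> det2 w1 ?z / det2 w1 w2"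
      using d by auto
  qed
  from w show ?thesis
  proof
    assume "w = w1"
    then have "?z + y *\<^sub>R w = (a + y) *\<^sub>R w1 + b *\<^sub>R w2"
      by (simp add: ab(3) algebra_simps)
    moreover have "right_dir h e ((a + y) *\<^sub>R w1 + b *\<^sub>R w2)"
      by (rule right_dir_cone[OF h]) (use ab y in auto)
    ultimately show ?thesis
      by (simp only:)
  next
    assume "w = w2"
    then have "?z + y *\<^sub>R w = a *\<^sub>R w1 + (b + y) *\<^sub>R w2"
      by (simp add: ab(3) algebra_simps)
    moreover have "right_dir h e (a *\<^sub>R w1 + (b + y) *\<^sub>R w2)"
      by (rule right_dir_cone[OF h]) (use ab y in auto)
    ultimately show ?thesis
      by (simp only:)
  qed
qed

lemma double_pair:
  assumes "p \<in> params D" "q \<in> params D" "p \<noteq> q" "pt D p = pt D q"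
  shows "p \<in> double_params D" "q \<in> double_params D" "smooth_at D p" "smooth_at D q"
    and "\<And>r. \<lbrakk>r \<in> params D; pt D r = pt D p\<rbrakk> \<Longrightarrow> r \<in> {p, q}"
proof -
  show d: "p \<in> double_params D" "q \<in> double_params D"
    using assms by (auto simp: double_params_def)
  then show "smooth_at D p" "smooth_at D q"
    by (simp_all add: smooth_double)
  show "r \<in> {p, q}" if "r \<in> params D" "pt D r = pt D p" for r
    using no_triple[of r p q] that assms by auto
qed

text \<open>The signs single out a half of the strand of \<open>p\<close> and a direction of the
  other strand with that half on its right. The two choices of \<open>w\<close> point to the two
  sides of the half-strand, but both to the right of the other strand. Pushing the half-strand along
  \<open>w\<close> thus stays in one sector at the crossing.\<close>

lemma sector_wind:
  assumes pq: "p \<in> params D" "q \<in> params D" "p \<noteq> q" "pt D p = pt D q"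
    and \<sigma>: "\<sigma> = 1 \<or> \<sigma> = - 1" and \<tau>: "\<tau> = 1 \<or> \<tau> = - 1"
    and det: "0 < det2 (\<sigma> *\<^sub>R tangent D p) (\<tau> *\<^sub>R tangent D q)"
    and w: "w = \<sigma> *\<^sub>R tangent D p - \<tau> *\<^sub>R tangent D q \<or> w = \<sigma> *\<^sub>R tangent D p + \<tau> *\<^sub>R tangent D q"
  shows "\<exists>N. (\<forall>\<^sub>F y in at_right 0. wind D (pt D p + y *\<^sub>R w) = N) \<and>
    (\<forall>\<^sub>F s in at_right 0. \<forall>\<^sub>F y in at_right 0. wind D (strand D p (\<sigma> * s) + y *\<^sub>R w) = N)"
proof -
  note dp = double_pair[OF pq]
  define u where "u = \<sigma> *\<^sub>R tangent D p"
  define v where "v = \<tau> *\<^sub>R tangent D q"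
  define g where "g s = strand D p (\<sigma> * s)" for s
  define h where "h s = strand D q (\<tau> * s)" for s
  have uv: "0 < det2 u v"
    using det by (simp add: u_def v_def)
  have wuv: "w = u - v \<or> w = u + v"
    using w by (simp add: u_def v_def)
  have dets: "0 < det2 (u - v) u" "0 < det2 (- (u + v)) u" "0 < det2 (u - v) v" "0 < det2 (u + v) v"
    "0 < det2 (u - v) (u + v)"
    using uv by (simp_all add: det2_Re_Im algebra_simps)
  obtain e1 where e1: "0 < e1" "right_dir g e1 (u - v)"
    using right_dir_signed[OF pq(1) dp(3) \<sigma> dets(1)[unfolded u_def]] unfolding g_def u_def v_def by blast
  obtain e2 where e2: "0 < e2" "right_dir g e2 (- (u + v))"
    using right_dir_signed[OF pq(1) dp(3) \<sigma> dets(2)[unfolded u_def]] unfolding g_def u_def v_def by blast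
  obtain e3 where e3: "0 < e3" "right_dir h e3 (u - v)"
    using right_dir_signed[OF pq(2) dp(4) \<tau> dets(3)[unfolded v_def]] unfolding h_def u_def v_def by blast
  obtain e4 where e4: "0 < e4" "right_dir h e4 (u + v)"
    using right_dir_signed[OF pq(2) dp(4) \<tau> dets(4)[unfolded v_def]] unfolding h_def u_def v_def by blast
  define e where "e = min (min e1 e2) (min e3 e4)"
  have e: "0 < e"
    using e1 e2 e3 e4 by (simp add: e_def)
  have rd: "right_dir g e (u - v)" "right_dir g e (- (u + v))" "right_dir h e (u - v)" "right_dir h e (u + v)"
    using e1 e2 e3 e4 by (auto simp: e_def intro: right_dir_mono)
  obtain \<delta> where \<delta>: "0 < \<delta>"
    "\<And>r. \<lbrakk>r \<in> params D; dist (pt D r) (pt D p) < \<delta>\<rbrakk> \<Longrightarrow> \<exists>p'\<in>{p, q}. \<exists>s. \<bar>s\<bar> < e \<and> r = shift p' s"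
    using preimage_near[of "pt D p" "{p, q}", OF dp(5) e] by metis
  let ?k = "\<lambda>(s, y). g s + y *\<^sub>R w"
  have g0: "g 0 = pt D p" "h 0 = pt D p"
    by (simp_all add: g_def h_def pq(4))
  have cont: "continuous_on UNIV ?k"
    unfolding case_prod_unfold g_def
    by (intro continuous_intros continuous_on_compose2[OF strand_continuous[OF pq(1), of UNIV]]) auto
  then have "isCont ?k (0, 0)"
    by (simp add: continuous_on_eq_continuous_at)
  then obtain \<eta> where \<eta>: "0 < \<eta>" "\<And>x. dist x (0, 0) < \<eta> \<Longrightarrow> dist (?k x) (?k (0, 0)) < \<delta>"
    using \<delta>(1) unfolding continuous_at_eps_delta dist_norm by metis
  define a where "a = min (\<eta> / 2) e"
  have a: "0 < a" "a \<le> \<eta> / 2" "a \<le> e"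
    using \<eta> e by (auto simp: a_def)
  \<comment> \<open>The range of \<open>s\<close> includes 0, so that values seen from the crossing
    itself are compared with values along the half-strand.\<close>
  let ?X = "?k ` ({0..<a} \<times> {0<..<a})"
  have "connected ?X"
    by (intro connected_continuous_image continuous_on_subset[OF cont] connected_Times) auto
  moreover have "?X \<inter> drawn D = {}"
  proof (rule ccontr)
    assume "?X \<inter> drawn D \<noteq> {}"
    then obtain s y r where "s \<in> {0..<a}" "y \<in> {0<..<a}" and r: "r \<in> params D" "pt D r = ?k (s, y)"
      by force
    then have sy: "0 \<le> s" "s < a" "0 < y" "y < a"
      by auto
    have "dist (s, y) (0, 0) \<le> \<bar>s\<bar> + \<bar>y\<bar>"
      by (simp add: dist_Pair_Pair sqrt_sum_squares_le_sum_abs)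
    then have "dist (?k (s, y)) (?k (0, 0)) < \<delta>"
      using sy a by (intro \<eta>(2)) auto
    then have "dist (pt D r) (pt D p) < \<delta>"
      using r(2) g0 by simp
    then obtain p' t where t: "p' = p \<or> p' = q" "\<bar>t\<bar> < e" "r = shift p' t"
      using \<delta>(2)[OF r(1)] by blast
    from t(1) show False
    proof
      assume "p' = p"
      then have "pt D r = g (\<sigma> * t)"
        using t(3) \<sigma> by (auto simp: g_def)
      then have yw: "y *\<^sub>R w = g (\<sigma> * t) - g s" "- (y *\<^sub>R w) = g s - g (\<sigma> * t)"
        using r(2) by (simp_all add: algebra_simps)
      have st: "\<bar>s\<bar> \<le> e" "\<bar>\<sigma> * t\<bar> \<le> e"
        using sy a t(2) \<sigma> by auto
      have "right_dir g e (y *\<^sub>R w) \<or> right_dir g e (- (y *\<^sub>R w))"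
        using wuv right_dir_scaleR[OF rd(1) sy(3)] right_dir_scaleR[OF rd(2) sy(3)]
        unfolding scaleR_minus_right by blast
      then have "y *\<^sub>R w = 0"
        using right_dir_avoids[OF _ st yw(1)] right_dir_avoids[OF _ st(2,1) yw(2)] by auto
      then show False
        using sy wuv right_dir_nonzero[OF rd(1) e] right_dir_nonzero[OF rd(4) e] by auto
    next
      \<comment> \<open>Here the displacement from the crossing is a right direction of the other
        strand, so it cannot be a chord of it.\<close>
      assume "p' = q"
      then have "pt D r = h (\<tau> * t)"
        using t(3) \<tau> by (auto simp: h_def)
      then have z: "g s - g 0 + y *\<^sub>R w = h (\<tau> * t) - h 0"
        using r(2) g0 by (simp add: algebra_simps)
      have "right_dir h e (g s - g 0 + y *\<^sub>R w)"
        using right_dir_in_sector[OF rd dets(5) sy(1) _ sy(3) wuv] sy a by simp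
      moreover from this have "g s - g 0 + y *\<^sub>R w = 0"
        by (rule right_dir_avoids[OF _ _ _ z]) (use e t(2) \<tau> in auto)
      ultimately show False
        using right_dir_nonzero e by blast
    qed
  qed
  ultimately have const: "wind D (?k x) = wind D (?k x')"
    if "x \<in> {0..<a} \<times> {0<..<a}" "x' \<in> {0..<a} \<times> {0<..<a}" for x x'
    using that by (intro wind_eq[of ?X]) auto
  define N where "N = wind D (?k (0, a / 2))"
  have N: "wind D (g s + y *\<^sub>R w) = N" if "0 \<le> s" "s < a" "0 < y" "y < a" for s y
    using const[of "(s, y)" "(0, a / 2)"] that a(1) by (simp add: N_def)
  have ev: "\<forall>\<^sub>F y in at_right 0. 0 < y \<and> y < a"
    using a(1) by (intro eventually_at_rightI[of 0 a]) auto
  show ?thesis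
  proof (intro exI conjI)
    show "\<forall>\<^sub>F y in at_right 0. wind D (pt D p + y *\<^sub>R w) = N"
      using ev by eventually_elim (use N[of 0] a g0 in auto)
    show "\<forall>\<^sub>F s in at_right 0. \<forall>\<^sub>F y in at_right 0. wind D (strand D p (\<sigma> * s) + y *\<^sub>R w) = N"
      using ev
    proof eventually_elim
      case (elim s)
      show ?case
        using ev by eventually_elim (use N[of s] elim in \<open>auto simp: g_def\<close>)
    qed
  qed
qed

lemma eventually_at_right_signed:
  assumes "\<forall>\<^sub>F s in at 0. P s" "\<sigma> = 1 \<or> \<sigma> = - 1"
  shows "\<forall>\<^sub>F s in at_right (0::real). P (\<sigma> * s)"
proof -
  have "\<forall>\<^sub>F s in at_right 0. P s" "\<forall>\<^sub>F s in at_left 0. P s"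
    using assms(1) by (simp_all add: eventually_at_split)
  then show ?thesis
    using assms(2) eventually_at_left_to_right[of P 0] by auto
qed

lemma eventually_const_unique:
  assumes "\<forall>\<^sub>F y in at_right (0::real). f y = a" "\<forall>\<^sub>F y in at_right 0. f y = b"
  shows "a = b"
proof -
  have "\<forall>\<^sub>F y in at_right (0::real). a = b"
    using assms by eventually_elim simp
  then show ?thesis
    by (simp add: eventually_const_iff)
qed

text \<open>Translates the value \<open>N\<close> of a sector into the index on the right of the
  half-strand: the sector lies on the right if \<open>w\<close> is a right direction and on the
  left, one higher, if \<open>- w\<close> is.\<close>

lemma right_wind_nearby:
  assumes p: "p \<in> params D" and e: "0 < e" and \<sigma>: "\<sigma> = 1 \<or> \<sigma> = - 1"
    and N: "\<forall>\<^sub>F s in at_right 0. \<forall>\<^sub>F y in at_right 0. wind D (strand D p (\<sigma> * s) + y *\<^sub>R w) = N"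
  shows "right_dir (strand D p) e w \<Longrightarrow> \<forall>\<^sub>F s in at_right 0. right_wind D (shift p (\<sigma> * s)) = N"
    and "right_dir (strand D p) e (- w) \<Longrightarrow> \<forall>\<^sub>F s in at_right 0. right_wind D (shift p (\<sigma> * s)) + 1 = N"
proof -
  have "\<forall>\<^sub>F s in at 0. \<bar>s\<bar> < e / 2"
    using e by (auto simp: eventually_at dist_real_def intro!: exI[of _ "e / 2"])
  then have "\<forall>\<^sub>F s in at 0. \<bar>s\<bar> < e / 2 \<and> shift p s \<notin> double_params D"
    using eventually_shift_notin[OF finite_double p] by eventually_elim simp
  note near = eventually_at_right_signed[OF this \<sigma>]
  show "\<forall>\<^sub>F s in at_right 0. right_wind D (shift p (\<sigma> * s)) = N" if w: "right_dir (strand D p) e w"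
    using near N
  proof eventually_elim
    case (elim s)
    have "right_dir (strand D (shift p (\<sigma> * s))) (e / 2) w"
      by (rule right_dir_shift[OF w]) (use elim in auto)
    then have "\<forall>\<^sub>F y in at_right 0. wind D (strand D p (\<sigma> * s) + y *\<^sub>R w) = right_wind D (shift p (\<sigma> * s))"
      by (rule eventually_right_wind[rotated 3]) (use p e elim in auto)
    then show ?case
      by (rule eventually_const_unique) (use elim in blast)
  qed
  show "\<forall>\<^sub>F s in at_right 0. right_wind D (shift p (\<sigma> * s)) + 1 = N" if w: "right_dir (strand D p) e (- w)"
    using near N
  proof eventually_elim
    case (elim s)
    have "right_dir (strand D (shift p (\<sigma> * s))) (e / 2) (- w)"
      by (rule right_dir_shift[OF w]) (use elim in auto)
    then have "\<forall>\<^sub>F y in at_right 0. wind D (strand D p (\<sigma> * s) - y *\<^sub>R (- w)) = right_wind D (shift p (\<sigma> * s)) + 1"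
      by (rule eventually_left_wind[rotated 3]) (use p e elim in auto)
    then have "\<forall>\<^sub>F y in at_right 0. wind D (strand D p (\<sigma> * s) + y *\<^sub>R w) = right_wind D (shift p (\<sigma> * s)) + 1"
      by simp
    then show ?case
      by (rule eventually_const_unique) (use elim in blast)
  qed
qed

text \<open>The two sectors along one half-strand differ by one. For \<sigma> = -1 the vector
  \<open>u\<close> points against the orientation, so the sides on which \<open>u - v\<close> and
  \<open>u + v\<close> lie are exchanged.\<close>

lemma sector_winds:
  assumes pq: "p \<in> params D" "q \<in> params D" "p \<noteq> q" "pt D p = pt D q"
    and \<sigma>: "\<sigma> = 1 \<or> \<sigma> = - 1" and \<tau>: "\<tau> = 1 \<or> \<tau> = - 1"
    and u: "u = \<sigma> *\<^sub>R tangent D p" and v: "v = \<tau> *\<^sub>R tangent D q" and det: "0 < det2 u v"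
  shows "\<exists>n. (\<forall>\<^sub>F y in at_right 0. wind D (pt D p + y *\<^sub>R (u - v)) = (if \<sigma> = 1 then n else n + 1)) \<and>
    (\<forall>\<^sub>F y in at_right 0. wind D (pt D p + y *\<^sub>R (u + v)) = (if \<sigma> = 1 then n + 1 else n)) \<and>
    (\<forall>\<^sub>F s in at_right 0. right_wind D (shift p (\<sigma> * s)) = n)"
proof -
  obtain N1 where N1: "\<forall>\<^sub>F y in at_right 0. wind D (pt D p + y *\<^sub>R (u - v)) = N1"
    "\<forall>\<^sub>F s in at_right 0. \<forall>\<^sub>F y in at_right 0. wind D (strand D p (\<sigma> * s) + y *\<^sub>R (u - v)) = N1"
    using sector_wind[OF pq \<sigma> \<tau> det[unfolded u v], of "u - v"] unfolding u v by auto
  obtain N2 where N2: "\<forall>\<^sub>F y in at_right 0. wind D (pt D p + y *\<^sub>R (u + v)) = N2"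
    "\<forall>\<^sub>F s in at_right 0. \<forall>\<^sub>F y in at_right 0. wind D (strand D p (\<sigma> * s) + y *\<^sub>R (u + v)) = N2"
    using sector_wind[OF pq \<sigma> \<tau> det[unfolded u v], of "u + v"] unfolding u v by auto
  note rd = right_dir_smooth[OF pq(1) double_pair(3)[OF pq]]
  from \<sigma> show ?thesis
  proof
    assume \<sigma>1: "\<sigma> = 1"
    have "right_of (tangent D p) (u - v)" "right_of (tangent D p) (- (u + v))"
      using det u \<sigma>1 by (simp_all add: right_of_def det2_Re_Im algebra_simps)
    then obtain e e' where e: "0 < e" "right_dir (strand D p) e (u - v)"
      and e': "0 < e'" "right_dir (strand D p) e' (- (u + v))"
      using rd by blast
    have 1: "\<forall>\<^sub>F s in at_right 0. right_wind D (shift p (\<sigma> * s)) = N1"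
      by (rule right_wind_nearby(1)[OF pq(1) e(1) \<sigma> N1(2) e(2)])
    moreover have "\<forall>\<^sub>F s in at_right 0. right_wind D (shift p (\<sigma> * s)) + 1 = N2"
      by (rule right_wind_nearby(2)[OF pq(1) e'(1) \<sigma> N2(2) e'(2)])
    ultimately have "\<forall>\<^sub>F s in at_right (0::real). N2 = N1 + 1"
      by eventually_elim simp
    then show ?thesis
      using 1 N1(1) N2(1) \<sigma>1 by (intro exI[of _ N1]) (simp add: eventually_const_iff)
  next
    assume \<sigma>1: "\<sigma> = - 1"
    have "right_of (tangent D p) (- (u - v))" "right_of (tangent D p) (u + v)"
      using det u \<sigma>1 by (simp_all add: right_of_def det2_Re_Im algebra_simps)
    then obtain e e' where e: "0 < e" "right_dir (strand D p) e (- (u - v))"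
      and e': "0 < e'" "right_dir (strand D p) e' (u + v)"
      using rd by blast
    have 1: "\<forall>\<^sub>F s in at_right 0. right_wind D (shift p (\<sigma> * s)) = N2"
      by (rule right_wind_nearby(1)[OF pq(1) e'(1) \<sigma> N2(2) e'(2)])
    moreover have "\<forall>\<^sub>F s in at_right 0. right_wind D (shift p (\<sigma> * s)) + 1 = N1"
      by (rule right_wind_nearby(2)[OF pq(1) e(1) \<sigma> N1(2) e(2)])
    ultimately have "\<forall>\<^sub>F s in at_right (0::real). N1 = N2 + 1"
      by eventually_elim simp
    then show ?thesis
      using 1 N1(1) N2(1) \<sigma>1 by (intro exI[of _ N2]) (simp add: eventually_const_iff)
  qed
qed

text \<open>Each of the four half-strands separates two adjacent sectors. Going around the crossing,
  each sector is met from two half-strands, and the comparison expresses everything by the value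
  \<open>n\<close> of the sector on the right of both strands.\<close>

lemma crossing_winds:
  assumes pq: "p \<in> params D" "q \<in> params D" "p \<noteq> q" "pt D p = pt D q"
    and det: "0 < det2 (tangent D p) (tangent D q)"
  shows "\<exists>n. (\<forall>\<^sub>F y in at_right 0. wind D (pt D p + y *\<^sub>R (tangent D p - tangent D q)) = n) \<and>
    (\<forall>\<^sub>F s in at_right 0. right_wind D (shift p s) = n \<and> right_wind D (shift p (- s)) = n + 1 \<and>
       right_wind D (shift q s) = n + 1 \<and> right_wind D (shift q (- s)) = n)"
proof -
  define u where "u = tangent D p"
  define v where "v = tangent D q"
  note qp = pq(2,1) pq(3)[symmetric] pq(4)[symmetric]
  have uv: "0 < det2 u v"
    using det by (simp add: u_def v_def)
  have vu: "det2 v u = - det2 u v"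
    by (rule det2_commute)
  \<comment> \<open>In the four applications the sign of the other strand is chosen so that the
    determinant of the signed tangents is positive.\<close>
  obtain n1 where n1: "\<forall>\<^sub>F y in at_right 0. wind D (pt D p + y *\<^sub>R (u - v)) = n1"
    "\<forall>\<^sub>F y in at_right 0. wind D (pt D p + y *\<^sub>R (u + v)) = n1 + 1"
    "\<forall>\<^sub>F s in at_right 0. right_wind D (shift p s) = n1"
    using sector_winds[OF pq, of 1 1 u v] uv by (auto simp: u_def v_def)
  obtain n2 where n2: "\<forall>\<^sub>F y in at_right 0. wind D (pt D p + y *\<^sub>R (- v - u)) = n2 + 1"
    "\<forall>\<^sub>F y in at_right 0. wind D (pt D p + y *\<^sub>R (- v + u)) = n2"
    "\<forall>\<^sub>F s in at_right 0. right_wind D (shift q (- s)) = n2"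
    using sector_winds[OF qp, of "-1" 1 "- v" u] uv vu pq(4) by (auto simp: u_def v_def)
  obtain n3 where n3: "\<forall>\<^sub>F y in at_right 0. wind D (pt D p + y *\<^sub>R (- u + - v)) = n3"
    "\<forall>\<^sub>F s in at_right 0. right_wind D (shift p (- s)) = n3"
    using sector_winds[OF pq, of "-1" "-1" "- u" "- v"] uv by (auto simp: u_def v_def)
  obtain n4 where n4: "\<forall>\<^sub>F y in at_right 0. wind D (pt D p + y *\<^sub>R (v - - u)) = n4"
    "\<forall>\<^sub>F s in at_right 0. right_wind D (shift q s) = n4"
    using sector_winds[OF qp, of 1 "-1" v "- u"] uv vu pq(4) by (auto simp: u_def v_def)
  have dirs: "- v + u = u - v" "- u + - v = - v - u" "v - - u = u + v"
    by simp_all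
  have "n2 = n1"
    using eventually_const_unique[OF n2(2)[unfolded dirs] n1(1)] .
  moreover have "n3 = n2 + 1"
    using eventually_const_unique[OF n3(1)[unfolded dirs] n2(1)] .
  moreover have "n4 = n1 + 1"
    using eventually_const_unique[OF n4(1)[unfolded dirs] n1(2)] .
  moreover note n1(3) n2(3) n3(2) n4(2)
  ultimately have "\<forall>\<^sub>F s in at_right 0. right_wind D (shift p s) = n1 \<and> right_wind D (shift p (- s)) = n1 + 1 \<and>
       right_wind D (shift q s) = n1 + 1 \<and> right_wind D (shift q (- s)) = n1"
    by (simp add: eventually_conj_iff)
  then show ?thesis
    using n1(1) unfolding u_def v_def by blast
qed

text \<open>The common right directions of both strands form a convex cone, and near its apex this
  cone misses the diagram.\<close>

lemma right_of_both_connected: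
  assumes pq: "p \<in> params D" "q \<in> params D" "p \<noteq> q" "pt D p = pt D q"
    and w: "right_of (tangent D p) w" "right_of (tangent D q) w"
    and w': "right_of (tangent D p) w'" "right_of (tangent D q) w'"
  shows "\<exists>\<delta>>0. \<forall>y y'. 0 < y \<longrightarrow> y < \<delta> \<longrightarrow> 0 < y' \<longrightarrow> y' < \<delta> \<longrightarrow>
    connected_component (- drawn D) (pt D p + y *\<^sub>R w) (pt D p + y' *\<^sub>R w')"
proof -
  note dp = double_pair[OF pq]
  obtain e1 e2 e3 e4 where
    e1: "0 < e1" "right_dir (strand D p) e1 w" and e2: "0 < e2" "right_dir (strand D q) e2 w" and
    e3: "0 < e3" "right_dir (strand D p) e3 w'" and e4: "0 < e4" "right_dir (strand D q) e4 w'"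
    using right_dir_smooth[OF pq(1) dp(3) w(1)] right_dir_smooth[OF pq(2) dp(4) w(2)]
      right_dir_smooth[OF pq(1) dp(3) w'(1)] right_dir_smooth[OF pq(2) dp(4) w'(2)] by metis
  define e where "e = min (min e1 e2) (min e3 e4)"
  have e: "0 < e"
    using e1 e2 e3 e4 by (simp add: e_def)
  have rd: "right_dir (strand D p) e w" "right_dir (strand D q) e w"
    "right_dir (strand D p) e w'" "right_dir (strand D q) e w'"
    using e1 e2 e3 e4 by (auto simp: e_def intro: right_dir_mono)
  obtain \<delta> where \<delta>: "0 < \<delta>"
    "\<And>z. \<lbrakk>norm z < \<delta>; \<forall>r\<in>{p, q}. right_dir (strand D r) e z \<or> right_dir (strand D r) e (- z)\<rbrakk>
      \<Longrightarrow> z = 0 \<or> pt D p + z \<notin> drawn D"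
  proof (rule right_dir_clear[of "pt D p" "{p, q}", OF dp(5) _ e])
    show "pt D r = pt D p" if "r \<in> {p, q}" for r
      using that pq(4) by auto
  qed blast+
  let ?C = "\<lambda>r. {z. right_dir (strand D r) e z}"
  let ?X = "(+) (pt D p) ` (?C p \<inter> ?C q \<inter> ball 0 \<delta>)"
  have "convex (?C r)" for r
    unfolding convex_def by (auto intro!: right_dir_cone)
  then have "connected ?X"
    by (intro convex_connected convex_translation convex_Int convex_ball)
  moreover have "?X \<subseteq> - drawn D"
    using \<delta>(2) right_dir_nonzero[OF _ e] by force
  ultimately have conn: "connected_component (- drawn D) x x'" if "x \<in> ?X" "x' \<in> ?X" for x x'
    using that unfolding connected_component_def by blast
  have "\<forall>\<^sub>F y in at_right 0. norm (y *\<^sub>R w) < \<delta> \<and> norm (y *\<^sub>R w') < \<delta>"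
    by (intro eventually_conj eventually_norm_scaleR_less \<delta>(1))
  then obtain \<eta> where \<eta>: "0 < \<eta>" "\<And>y. \<lbrakk>0 < y; y < \<eta>\<rbrakk> \<Longrightarrow> norm (y *\<^sub>R w) < \<delta> \<and> norm (y *\<^sub>R w') < \<delta>"
    unfolding eventually_at_right_field by auto
  show ?thesis
  proof (intro exI[of _ \<eta>] conjI allI impI \<eta>(1) conn)
    fix y y' assume y: "0 < y" "y < \<eta>" "0 < y'" "y' < \<eta>"
    show "pt D p + y *\<^sub>R w \<in> ?X" "pt D p + y' *\<^sub>R w' \<in> ?X"
      using rd \<eta>(2)[OF y(1,2)] \<eta>(2)[OF y(3,4)] y by (auto intro!: imageI right_dir_scaleR)
  qed
qed

text \<open>Resolves the definite description: the component of one point near the crossing contains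
  nearby points in all admissible directions, and two candidates share points and hence
  coincide.\<close>

lemma source_region:
  assumes pq: "p \<in> params D" "q \<in> params D" "p \<noteq> q" "pt D p = pt D q"
    and w: "right_of (tangent D p) w" "right_of (tangent D q) w"
  shows "source_region D (p, q) \<in> regions D"
    and "\<forall>\<^sub>F y in at_right 0. pt D p + y *\<^sub>R w \<in> source_region D (p, q)"
proof -
  let ?P = "\<lambda>\<Delta>. \<Delta> \<in> regions D \<and> (\<forall>w. right_of (tangent D p) w \<and> right_of (tangent D q) w \<longrightarrow>
    (\<forall>\<^sub>F s in at_right 0. pt D p + s *\<^sub>R w \<in> \<Delta>))"
  obtain \<delta> where \<delta>: "0 < \<delta>" "\<And>y y'. \<lbrakk>0 < y; y < \<delta>; 0 < y'; y' < \<delta>\<rbrakk> \<Longrightarrow>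
      connected_component (- drawn D) (pt D p + y *\<^sub>R w) (pt D p + y' *\<^sub>R w)"
    using right_of_both_connected[OF pq w w] by blast
  define z where "z = pt D p + (\<delta> / 2) *\<^sub>R w"
  define \<Delta> where "\<Delta> = connected_component_set (- drawn D) z"
  have "connected_component (- drawn D) z z"
    unfolding z_def using \<delta>(2)[of "\<delta> / 2" "\<delta> / 2"] \<delta>(1) by simp
  then have "z \<notin> drawn D"
    using connected_component_in by fastforce
  then have \<Delta>: "\<Delta> \<in> regions D"
    by (auto simp: \<Delta>_def regions_def intro: componentsI)
  have ev: "\<forall>\<^sub>F s in at_right 0. pt D p + s *\<^sub>R w' \<in> \<Delta>"
    if w': "right_of (tangent D p) w'" "right_of (tangent D q) w'" for w'
  proof -
    obtain \<eta> where \<eta>: "0 < \<eta>" "\<And>y y'. \<lbrakk>0 < y; y < \<eta>; 0 < y'; y' < \<eta>\<rbrakk> \<Longrightarrow>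
        connected_component (- drawn D) (pt D p + y *\<^sub>R w) (pt D p + y' *\<^sub>R w')"
      using right_of_both_connected[OF pq w w'] by blast
    define y where "y = min \<delta> \<eta> / 2"
    have y: "0 < y" "y < \<delta>" "y < \<eta>"
      using \<delta>(1) \<eta>(1) by (auto simp: y_def)
    have "pt D p + s *\<^sub>R w' \<in> \<Delta>" if "s \<in> {0<..<\<eta>}" for s
    proof -
      have "connected_component (- drawn D) z (pt D p + y *\<^sub>R w)"
        unfolding z_def using \<delta> y by simp
      moreover have "connected_component (- drawn D) (pt D p + y *\<^sub>R w) (pt D p + s *\<^sub>R w')"
        using \<eta> y that by simp
      ultimately show ?thesis
        unfolding \<Delta>_def using connected_component_trans by blast
    qed
    then show ?thesis
      by (intro eventually_at_rightI[of 0 \<eta>] \<eta>(1))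
  qed
  have "(THE \<Delta>. ?P \<Delta>) = \<Delta>"
  proof (rule the_equality)
    show "?P \<Delta>" using \<Delta> ev by blast
    fix \<Delta>' assume \<Delta>': "?P \<Delta>'"
    then have "\<forall>\<^sub>F s in at_right 0. pt D p + s *\<^sub>R w \<in> \<Delta> \<inter> \<Delta>'"
      using ev[OF w] w by (simp add: eventually_conj_iff)
    then have "\<Delta> \<inter> \<Delta>' \<noteq> {}"
      using eventually_happens'[OF trivial_limit_at_right_real] by blast
    then show "\<Delta>' = \<Delta>"
      using \<Delta> \<Delta>' components_eq[of \<Delta> "- drawn D" \<Delta>'] by (auto simp: regions_def)
  qed
  then have "source_region D (p, q) = \<Delta>"
    by (simp add: source_region_def)
  then show "source_region D (p, q) \<in> regions D"
    "\<forall>\<^sub>F y in at_right 0. pt D p + y *\<^sub>R w \<in> source_region D (p, q)"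
    using \<Delta> ev[OF w] by simp_all
qed

lemma source_region_commute:
  assumes "pt D p = pt D q"
  shows "source_region D (p, q) = source_region D (q, p)"
  using assms by (simp add: source_region_def conj_commute)

lemma wind_region:
  assumes "\<Delta> \<in> regions D" "x \<in> \<Delta>" "y \<in> \<Delta>"
  shows "wind D x = wind D y"
  using assms in_components_connected[of \<Delta>] in_components_subset[of \<Delta>]
  by (intro wind_eq[of \<Delta>]) (auto simp: regions_def)

lemma right_wind_at_crossing:
  assumes pq: "p \<in> params D" "q \<in> params D" "p \<noteq> q" "pt D p = pt D q"
    and det: "0 < det2 (tangent D p) (tangent D q)" and z: "z \<in> source_region D (p, q)"
  shows "\<forall>\<^sub>F s in at_right 0. right_wind D (shift p s) = wind D z \<and>
    right_wind D (shift p (- s)) = wind D z + 1 \<and>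
    right_wind D (shift q s) = wind D z + 1 \<and> right_wind D (shift q (- s)) = wind D z"
proof -
  \<comment> \<open>At a crossing with positive determinant this difference points to the right of
    both strands, so it probes the source region.\<close>
  let ?w = "tangent D p - tangent D q"
  have w: "right_of (tangent D p) ?w" "right_of (tangent D q) ?w"
    using det by (simp_all add: right_of_def det2_Re_Im algebra_simps)
  obtain n where n: "\<forall>\<^sub>F y in at_right 0. wind D (pt D p + y *\<^sub>R ?w) = n"
    "\<forall>\<^sub>F s in at_right 0. right_wind D (shift p s) = n \<and> right_wind D (shift p (- s)) = n + 1 \<and>
       right_wind D (shift q s) = n + 1 \<and> right_wind D (shift q (- s)) = n"
    using crossing_winds[OF pq det] by blast
  have "\<forall>\<^sub>F y in at_right 0. wind D (pt D p + y *\<^sub>R ?w) = wind D z"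
    using source_region(2)[OF pq w] by eventually_elim (rule wind_region[OF source_region(1)[OF pq w] _ z])
  then have "n = wind D z"
    using eventually_const_unique[OF n(1)] by simp
  then show ?thesis
    using n(2) by simp
qed

end


section \<open>The index of a region is a winding number\<close>

lemma eventually_at_left_less_finite:
  fixes x :: real
  assumes "finite T"
  shows "\<forall>\<^sub>F y in at_left x. y < x \<and> (\<forall>t\<in>T. t < y \<longleftrightarrow> t < x) \<and> y \<notin> T"
proof -
  have "\<forall>\<^sub>F y in at_left x. t < x \<longrightarrow> t < y" for t
    by (cases "t < x") (auto intro: eventually_at_leftI[of t])
  then have "\<forall>\<^sub>F y in at_left x. \<forall>t\<in>T. t < x \<longrightarrow> t < y"
    using assms by (intro eventually_ball_finite) auto
  moreover have "\<forall>\<^sub>F y in at_left x. y < x"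
    by (simp add: eventually_at_filter)
  ultimately show ?thesis
    by eventually_elim (use less_trans in blast)
qed

lemma eventually_at_right_less_finite:
  fixes x :: real
  assumes "finite T"
  shows "\<forall>\<^sub>F y in at_right x. x < y \<and> (\<forall>t\<in>T. t < y \<longleftrightarrow> t \<le> x) \<and> y \<notin> T"
proof -
  have "\<forall>\<^sub>F y in at_right x. x < t \<longrightarrow> y < t" for t
    by (cases "x < t") (auto intro: eventually_at_rightI[of _ t])
  then have "\<forall>\<^sub>F y in at_right x. \<forall>t\<in>T. x < t \<longrightarrow> y < t"
    using assms by (intro eventually_ball_finite) auto
  moreover have "\<forall>\<^sub>F y in at_right x. x < y"
    by (simp add: eventually_at_filter)
  ultimately show ?thesis
    by eventually_elim (meson leI le_less_trans less_irrefl less_trans not_le)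
qed

lemma eventually_within_Icc:
  fixes x :: real
  assumes "a < x \<Longrightarrow> \<forall>\<^sub>F y in at_left x. P y" "x < b \<Longrightarrow> \<forall>\<^sub>F y in at_right x. P y" "x \<in> {a..b}"
  shows "\<forall>\<^sub>F y in at x within {a..b}. P y"
proof -
  have "\<forall>\<^sub>F y in at_left x. a \<le> y \<longrightarrow> P y"
  proof (cases "a < x")
    case True
    from assms(1)[OF this] show ?thesis by eventually_elim simp
  qed (auto simp: eventually_at_filter)
  moreover have "\<forall>\<^sub>F y in at_right x. y \<le> b \<longrightarrow> P y"
  proof (cases "x < b")
    case True
    from assms(2)[OF this] show ?thesis by eventually_elim simp
  qed (auto simp: eventually_at_filter)
  ultimately show ?thesis
    unfolding eventually_at_filter
    by eventually_elim (use linorder_neqE_linordered_idom in fastforce)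
qed

lemma has_vector_derivative_slope:
  assumes "(f has_vector_derivative d) (at s)"
  shows "((\<lambda>t. (f t - f s) /\<^sub>R (t - s)) \<longlongrightarrow> d) (at s)"
proof (rule Lim_null[THEN iffD2], rule tendsto_norm_zero_cancel, rule Lim_transform_eventually)
  have "((\<lambda>t. (1 / norm (t - s)) *\<^sub>R (f t - (f s + (t - s) *\<^sub>R d))) \<longlongrightarrow> 0) (at s)"
    using assms by (simp add: has_vector_derivative_def has_derivative_at2)
  then show "((\<lambda>t. norm ((1 / norm (t - s)) *\<^sub>R (f t - (f s + (t - s) *\<^sub>R d)))) \<longlongrightarrow> 0) (at s)"
    by (rule tendsto_norm_zero)
  have "norm ((1 / norm (t - s)) *\<^sub>R (f t - (f s + (t - s) *\<^sub>R d))) = norm ((f t - f s) /\<^sub>R (t - s) - d)"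
    if "t \<noteq> s" for t
  proof -
    have "(f t - f s) /\<^sub>R (t - s) - d = inverse (t - s) *\<^sub>R (f t - (f s + (t - s) *\<^sub>R d))"
      using that by (simp add: diff_diff_eq[symmetric] scaleR_diff_right[of _ "f t - f s"])
    then show ?thesis
      by (simp add: inverse_eq_divide)
  qed
  then show "\<forall>\<^sub>F t in at s. norm ((1 / norm (t - s)) *\<^sub>R (f t - (f s + (t - s) *\<^sub>R d)))
      = norm ((f t - f s) /\<^sub>R (t - s) - d)"
    by (auto simp: eventually_at_filter)
qed

text \<open>Subtracting the jumps already passed leaves a locally constant function on a connected
  interval. The group is arbitrary because the lemma serves both integer-valued winding numbers and
  module-valued functions on the circles.\<close>

lemma (in abelian_group) finsum_jumps:
  fixes f lo hi :: "real \<Rightarrow> 'a" and a b :: real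
  assumes ab: "a \<le> b" and T: "finite T" "T \<subseteq> {a<..<b}"
    and closed: "\<And>x. f x \<in> carrier G" "\<And>x. lo x \<in> carrier G" "\<And>x. hi x \<in> carrier G"
    and left: "\<And>x. \<lbrakk>a < x; x \<le> b\<rbrakk> \<Longrightarrow> \<forall>\<^sub>F y in at_left x. f y = lo x"
    and right: "\<And>x. \<lbrakk>a \<le> x; x < b\<rbrakk> \<Longrightarrow> \<forall>\<^sub>F y in at_right x. f y = hi x"
    and eq: "\<And>x. x \<notin> T \<Longrightarrow> lo x = f x" "\<And>x. x \<notin> T \<Longrightarrow> hi x = f x"
  shows "f b = f a \<oplus> (\<Oplus>t\<in>T. hi t \<ominus> lo t)"
proof -
  define S where "S x = (\<Oplus>t\<in>{t\<in>T. t < x}. hi t \<ominus> lo t)" for x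
  \<comment> \<open>\<open>S\<close> counts jumps strictly to the left of \<open>x\<close>, so at a
    jump point the left limit is the matching value.\<close>
  define h where "h x = (if x \<in> T then lo x else f x) \<ominus> S x" for x
  have Sc: "S x \<in> carrier G" for x
    unfolding S_def by (intro finsum_closed Pi_I minus_closed closed)
  have lo: "(if x \<in> T then lo x else f x) = lo x" for x
    using eq by simp
  have "h a = h b"
  proof (rule connected_local_const[of "{a..b}"])
    show "\<forall>x\<in>{a..b}. \<forall>\<^sub>F y in at x within {a..b}. h x = h y"
    proof
      fix x assume x: "x \<in> {a..b}"
      show "\<forall>\<^sub>F y in at x within {a..b}. h x = h y"
      proof (rule eventually_within_Icc[OF _ _ x])
        assume "a < x"
        then have "\<forall>\<^sub>F y in at_left x. f y = lo x"
          using left x by auto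
        then show "\<forall>\<^sub>F y in at_left x. h x = h y"
          using eventually_at_left_less_finite[OF T(1), of x]
        proof eventually_elim
          case (elim y)
          then have "{t\<in>T. t < y} = {t\<in>T. t < x}"
            by auto
          then have "S y = S x"
            by (simp add: S_def)
          then show ?case
            using elim unfolding h_def lo[of x] by simp
        qed
      next
        assume "x < b"
        then have "\<forall>\<^sub>F y in at_right x. f y = hi x"
          using right x by auto
        then show "\<forall>\<^sub>F y in at_right x. h x = h y"
          using eventually_at_right_less_finite[OF T(1), of x]
        proof eventually_elim
          case (elim y)
          then have h: "h y = hi x \<ominus> S y"
            by (simp add: h_def)
          show ?case
          proof (cases "x \<in> T")
            case False
            then have "{t\<in>T. t < y} = {t\<in>T. t < x}"
              using elim by (auto simp: order.order_iff_strict)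
            then have "S y = S x"
              by (simp add: S_def)
            moreover have "h x = f x \<ominus> S x"
              using False by (simp add: h_def)
            ultimately show ?thesis
              by (simp add: h eq(2)[OF False])
          next
            case True
            then have "{t\<in>T. t < y} = insert x {t\<in>T. t < x}"
              using elim by (auto simp: order.order_iff_strict)
            then have "S y = (hi x \<ominus> lo x) \<oplus> S x"
              unfolding S_def using T(1) closed by (subst \<open>_ = insert _ _\<close>) (simp add: finsum_insert Pi_I)
            then have "h y = hi x \<ominus> ((hi x \<ominus> lo x) \<oplus> S x)"
              by (simp add: h)
            also have "\<dots> = lo x \<ominus> S x"
              using closed[of x] Sc[of x] by (simp add: minus_eq minus_add a_assoc[symmetric] r_neg)
            finally show ?thesis
              using True by (simp add: h_def)
          qed
        qed
      qed
    qed
  qed (use ab in auto)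
  moreover have "a \<notin> T" "b \<notin> T"
    using T by auto
  ultimately have h: "f a \<ominus> S a = f b \<ominus> S b"
    by (simp add: h_def)
  define J where "J = (\<Oplus>t\<in>T. hi t \<ominus> lo t)"
  have below: "{t\<in>T. t < a} = {}" "{t\<in>T. t < b} = T"
    using T by auto
  have "S a = \<zero>" "S b = J"
    unfolding S_def J_def below by simp_all
  then have "f a = f b \<ominus> J"
    using h closed(1)[of a] minus_equality[of \<zero> \<zero>] by (simp add: minus_eq)
  moreover have "J \<in> carrier G"
    unfolding J_def by (intro finsum_closed Pi_I minus_closed closed)
  ultimately have "f a \<oplus> J = f b"
    using closed by (simp add: minus_eq a_assoc l_neg)
  then show ?thesis
    by (simp add: J_def)
qed

section \<open>Winding numbers along a transverse path\<close>

context diagram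
begin

text \<open>The segment from \<open>pt D p - w\<close> towards \<open>pt D p\<close> misses the
  diagram up to its end, so the limit statement \<open>eventually_left_wind\<close> extends to a
  bound uniform in \<open>w\<close>.\<close>

lemma wind_eq_left_wind:
  assumes p: "p \<in> params D" "p \<notin> double_params D" and e: "0 < e"
  shows "\<exists>\<delta>>0. \<forall>w. right_dir (strand D p) e w \<longrightarrow> norm w < \<delta> \<longrightarrow> wind D (pt D p - w) = right_wind D p + 1"
proof -
  obtain \<delta> where \<delta>: "0 < \<delta>"
    "\<And>z. \<lbrakk>norm z < \<delta>; \<forall>q\<in>{p}. right_dir (strand D q) e z \<or> right_dir (strand D q) e (- z)\<rbrakk>
      \<Longrightarrow> z = 0 \<or> pt D p + z \<notin> drawn D"
    by (rule right_dir_clear[of "pt D p" "{p}", OF unique_param[OF p] _ e]) blast+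
  have "wind D (pt D p - w) = right_wind D p + 1" if w: "right_dir (strand D p) e w" "norm w < \<delta>" for w
  proof -
    let ?X = "(\<lambda>y. pt D p - y *\<^sub>R w) ` {0<..1}"
    have "connected ?X"
      by (intro connected_continuous_image continuous_intros) auto
    moreover have "?X \<inter> drawn D = {}"
    proof -
      have "pt D p - y *\<^sub>R w \<notin> drawn D" if y: "0 < y" "y \<le> 1" for y
      proof -
        have "norm (- (y *\<^sub>R w)) < \<delta>"
          using w(2) y mult_right_mono[of y 1 "norm w"] by simp
        then show ?thesis
          using \<delta>(2)[of "- (y *\<^sub>R w)"] right_dir_scaleR[OF w(1) y(1)] right_dir_nonzero[OF w(1) e] y by auto
      qed
      then have "?X \<subseteq> - drawn D"
        unfolding image_subset_iff by simp
      then show ?thesis by blast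
    qed
    ultimately have const: "wind D (pt D p - w) = wind D (pt D p - y *\<^sub>R w)" if "0 < y" "y \<le> 1" for y
      using that by (intro wind_eq[of ?X]) (auto intro: image_eqI[of _ _ 1])
    have "\<forall>\<^sub>F y::real in at_right 0. 0 < y \<and> y \<le> 1"
      by (intro eventually_at_rightI[of 0 1]) auto
    with eventually_left_wind[OF p e w(1)]
    have "\<forall>\<^sub>F y::real in at_right 0. wind D (pt D p - w) = right_wind D p + 1"
      by eventually_elim (use const in auto)
    then show ?thesis
      by (simp add: eventually_const_iff)
  qed
  then show ?thesis
    using \<delta>(1) by blast
qed

text \<open>A path reaches \<open>p\<close> along directions that only converge to \<open>d\<close>.
  As \<open>d\<close> is interior to the cone spanned by \<open>d - u\<close> and
  \<open>d + u\<close>, these directions finally lie in it, and the whole cone consists of right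
  directions for one common \<open>e\<close>.\<close>

lemma wind_along_path:
  assumes p: "p \<in> params D" "p \<notin> double_params D" "smooth_at D p" and d: "right_of (tangent D p) d"
    and x: "(x \<longlongrightarrow> d) F" and c: "(c \<longlongrightarrow> 0) F" "\<forall>\<^sub>F t in F. (0::real) < c t"
  shows "\<forall>\<^sub>F t in F. wind D (pt D p + c t *\<^sub>R x t) = right_wind D p \<and>
    wind D (pt D p - c t *\<^sub>R x t) = right_wind D p + 1"
proof -
  define u where "u = tangent D p"
  have ud: "det2 u d < 0"
    using d by (simp add: right_of_def u_def)
  have "right_of u (d - u)" "right_of u (d + u)"
    using ud by (simp_all add: right_of_def det2_diff_right det2_add_right)
  then obtain e1 e2 where e1: "0 < e1" "right_dir (strand D p) e1 (d - u)"
    and e2: "0 < e2" "right_dir (strand D p) e2 (d + u)"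
    using right_dir_smooth[OF p(1,3)] unfolding u_def by blast
  define e where "e = min e1 e2"
  have e: "0 < e" "right_dir (strand D p) e (d - u)" "right_dir (strand D p) e (d + u)"
    using e1 e2 by (auto simp: e_def intro: right_dir_mono)
  obtain \<delta> where \<delta>: "0 < \<delta>"
    "\<And>w. \<lbrakk>right_dir (strand D p) e w; norm w < \<delta>\<rbrakk> \<Longrightarrow> wind D (pt D p + w) = right_wind D p"
    by (rule wind_eq_right_wind[OF p(1,2) e(1)]) blast
  obtain \<delta>' where \<delta>': "0 < \<delta>'"
    "\<And>w. \<lbrakk>right_dir (strand D p) e w; norm w < \<delta>'\<rbrakk> \<Longrightarrow> wind D (pt D p - w) = right_wind D p + 1"
    using wind_eq_left_wind[OF p(1,2) e(1)] by blast
  have det: "0 < det2 (d - u) (d + u)"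
    using ud by (simp add: det2_Re_Im algebra_simps)
  have "0 < det2 d (d + u)" "0 < det2 (d - u) d"
    using ud by (simp_all add: det2_Re_Im algebra_simps)
  then have ev: "\<forall>\<^sub>F t in F. 0 < det2 (x t) (d + u)" "\<forall>\<^sub>F t in F. 0 < det2 (d - u) (x t)"
    using x by (auto intro!: order_tendstoD(1)[OF tendsto_det2])
  have "((\<lambda>t. norm (c t *\<^sub>R x t)) \<longlongrightarrow> norm (0 *\<^sub>R d)) F"
    by (intro tendsto_intros c x)
  then have "\<forall>\<^sub>F t in F. norm (c t *\<^sub>R x t) < min \<delta> \<delta>'"
    by (rule order_tendstoD(2)) (use \<delta>(1) \<delta>'(1) in simp)
  with ev c(2) show ?thesis
  proof eventually_elim
    case (elim t)
    define a where "a = det2 (x t) (d + u) / det2 (d - u) (d + u)"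
    define b where "b = det2 (d - u) (x t) / det2 (d - u) (d + u)"
    have ab: "0 < a" "0 < b"
      using elim det by (simp_all add: a_def b_def)
    have "x t = a *\<^sub>R (d - u) + b *\<^sub>R (d + u)"
      unfolding a_def b_def using det by (intro det2_basis) simp
    moreover have "right_dir (strand D p) e (a *\<^sub>R (d - u) + b *\<^sub>R (d + u))"
      by (rule right_dir_cone[OF e(2,3)]) (use ab in auto)
    ultimately have "right_dir (strand D p) e (c t *\<^sub>R x t)"
      using right_dir_scaleR elim by simp
    then show ?case
      using \<delta>(2) \<delta>'(2) elim by simp
  qed
qed

text \<open>The secant slopes of the path converge to its derivative, so
  \<open>wind_along_path\<close> applies with the elapsed time as scale; if the path crosses towards
  the left, it applies to the negated slopes.\<close>

lemma wind_at_transverse_intersection: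
  assumes p: "p \<in> params D" "p \<notin> double_params D" "smooth_at D p" and \<beta>: "\<beta> s = pt D p"
    and d: "(\<beta> has_vector_derivative d) (at s)" "det2 (tangent D p) d \<noteq> 0"
  shows "\<forall>\<^sub>F t in at_right s. wind D (\<beta> t) = (if right_of (tangent D p) d then right_wind D p else right_wind D p + 1)"
    and "\<forall>\<^sub>F t in at_left s. wind D (\<beta> t) = (if right_of (tangent D p) d then right_wind D p + 1 else right_wind D p)"
proof -
  have slope: "((\<lambda>t. (\<beta> t - \<beta> s) /\<^sub>R (t - s)) \<longlongrightarrow> d) (at s)"
    by (rule has_vector_derivative_slope[OF d(1)])
  have lim: "((\<lambda>t. (\<beta> t - \<beta> s) /\<^sub>R (t - s)) \<longlongrightarrow> d) (at_right s)" "((\<lambda>t. (\<beta> t - \<beta> s) /\<^sub>R (t - s)) \<longlongrightarrow> d) (at_left s)"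
    using slope by (simp_all add: filterlim_at_split)
  have c: "((\<lambda>t. t - s) \<longlongrightarrow> 0) (at_right s)" "\<forall>\<^sub>F t in at_right s. 0 < t - s"
    "((\<lambda>t. s - t) \<longlongrightarrow> 0) (at_left s)" "\<forall>\<^sub>F t in at_left s. 0 < s - t"
    by (auto intro!: tendsto_eq_intros simp: eventually_at_filter)
  have ne: "\<forall>\<^sub>F t in at_right s. t \<noteq> s" "\<forall>\<^sub>F t in at_left s. t \<noteq> s"
    by (auto simp: eventually_at_filter)
  show "\<forall>\<^sub>F t in at_right s. wind D (\<beta> t) = (if right_of (tangent D p) d then right_wind D p else right_wind D p + 1)"
  proof (cases "right_of (tangent D p) d")
    case True
    from wind_along_path[OF p True lim(1) c(1,2)] ne(1) show ?thesis
      by eventually_elim (use True \<beta> in simp)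
  next
    case False
    then have R: "right_of (tangent D p) (- d)"
      using d(2) by (simp add: right_of_def)
    from wind_along_path[OF p R tendsto_minus[OF lim(1)] c(1,2)] ne(1) show ?thesis
      by eventually_elim (use False \<beta> in simp)
  qed
  show "\<forall>\<^sub>F t in at_left s. wind D (\<beta> t) = (if right_of (tangent D p) d then right_wind D p + 1 else right_wind D p)"
  proof (cases "right_of (tangent D p) d")
    case True
    from wind_along_path[OF p True lim(2) c(3,4)] ne(2) show ?thesis
    proof eventually_elim
      case (elim t)
      \<comment> \<open>Before time \<open>s\<close> the scale must be the positive number
        \<open>s - t\<close>, while the slope is divided by \<open>t - s\<close>; the sign exchanges
        the sides.\<close>
      have "(s - t) * inverse (t - s) = - 1"
        using elim by (simp add: field_simps)
      with elim show ?case using True \<beta> by simp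
    qed
  next
    case False
    then have R: "right_of (tangent D p) (- d)"
      using d(2) by (simp add: right_of_def)
    from wind_along_path[OF p R tendsto_minus[OF lim(2)] c(3,4)] ne(2) show ?thesis
    proof eventually_elim
      case (elim t)
      have "(s - t) * inverse (t - s) = - 1"
        using elim by (simp add: field_simps)
      with elim show ?case using False \<beta> by simp
    qed
  qed
qed

text \<open>A passage to the right counts +1 but lowers the winding number by one, so the number is
  start minus finish; it is the negated sum of the jumps along the path.\<close>

lemma intersection_number_wind:
  assumes \<beta>: "transverse_path D \<beta>" and ends: "pathstart \<beta> \<notin> drawn D" "pathfinish \<beta> \<notin> drawn D"
  shows "intersection_number D \<beta> = wind D (pathstart \<beta>) - wind D (pathfinish \<beta>)"
proof -
  let ?I = "intersections D \<beta>"
  define T where "T = snd ` ?I"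
  define R where "R p s \<longleftrightarrow> right_of (tangent D p) (vector_derivative \<beta> (at s))" for p s
  have path: "path \<beta>" and fin: "finite ?I"
    using \<beta> by (auto simp: transverse_path_def)
  have I: "p \<in> params D" "s \<in> {0..1}" "\<beta> s = pt D p" "p \<notin> double_params D" "smooth_at D p"
    "(\<beta> has_vector_derivative vector_derivative \<beta> (at s)) (at s)"
    "det2 (tangent D p) (vector_derivative \<beta> (at s)) \<noteq> 0" if "(p, s) \<in> ?I" for p s
  proof -
    have "\<forall>(p, s)\<in>?I. p \<notin> double_params D \<and> smooth_at D p \<and> \<beta> differentiable (at s) \<and>
        det2 (tangent D p) (vector_derivative \<beta> (at s)) \<noteq> 0"
      using \<beta> by (simp add: transverse_path_def)
    from bspec[OF this that] show "p \<notin> double_params D" "smooth_at D p"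
      "(\<beta> has_vector_derivative vector_derivative \<beta> (at s)) (at s)"
      "det2 (tangent D p) (vector_derivative \<beta> (at s)) \<noteq> 0"
      by (simp_all add: vector_derivative_works)
    show "p \<in> params D" "s \<in> {0..1}" "\<beta> s = pt D p"
      using that by (simp_all add: intersections_def)
  qed
  \<comment> \<open>A transverse path avoids double points, so its time determines the parameter of
    the diagram that it meets.\<close>
  have inj: "inj_on snd ?I"
  proof (rule inj_onI)
    fix x y assume xy: "x \<in> ?I" "y \<in> ?I" "snd x = snd y"
    obtain p q s where x: "x = (p, s)" and y: "y = (q, s)"
      using xy(3) by (cases x, cases y) simp
    then have "q \<in> {p}"
      using I[of p s] I[of q s] xy by (intro unique_param) simp_all
    then show "x = y"
      by (simp add: x y)
  qed
  define P where "P s = fst (inv_into ?I snd s)" for s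
  have P: "(P s, s) \<in> ?I" if "s \<in> T" for s
    using that inv_into_into[of s snd ?I] f_inv_into_f[of s snd ?I] unfolding T_def P_def
    by (metis prod.collapse)
  have P_eq: "P s = p" if "(p, s) \<in> ?I" for p s
    using inv_into_f_f[OF inj that] by (simp add: P_def)
  define hi where "hi s = (if s \<in> T then (if R (P s) s then right_wind D (P s) else right_wind D (P s) + 1) else wind D (\<beta> s))" for s
  define lo where "lo s = (if s \<in> T then (if R (P s) s then right_wind D (P s) + 1 else right_wind D (P s)) else wind D (\<beta> s))" for s
  have off: "\<forall>\<^sub>F t in at s within {0..1}. wind D (\<beta> t) = wind D (\<beta> s)" if s: "s \<in> {0..1}" "s \<notin> T" for s
  proof -
    have "\<beta> s \<in> - drawn D"
    proof
      assume "\<beta> s \<in> drawn D"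
      then obtain p where "(p, s) \<in> ?I"
        using s by (auto simp: intersections_def)
      then have "snd (p, s) \<in> T"
        unfolding T_def by (rule imageI)
      then show False using s by simp
    qed
    then obtain r where r: "0 < r" "ball (\<beta> s) r \<subseteq> - drawn D"
      using compact_imp_closed[OF compact_drawn] by (metis open_Compl open_contains_ball)
    have "(\<beta> \<longlongrightarrow> \<beta> s) (at s within {0..1})"
      using path s by (simp add: path_def continuous_on_def)
    then have "\<forall>\<^sub>F t in at s within {0..1}. dist (\<beta> t) (\<beta> s) < r"
      using r(1) tendstoD by blast
    then show ?thesis
    proof eventually_elim
      case (elim t)
      show ?case
        by (rule wind_eq[of "ball (\<beta> s) r"]) (use r elim in \<open>auto simp: dist_commute\<close>)
    qed
  qed
  have "wind D (\<beta> 1) = wind D (\<beta> 0) + (\<Sum>s\<in>T. hi s - lo s)"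
  proof (rule int.finsum_jumps[of 0 1 T "\<lambda>s. wind D (\<beta> s)" lo hi, unfolded int_finsum_eq])
    show "finite T" using fin by (simp add: T_def)
    show "T \<subseteq> {0<..<1}"
    proof
      fix s assume s: "s \<in> T"
      have "\<beta> s \<in> drawn D" "s \<in> {0..1}"
        using I[OF P[OF s]] by auto
      moreover from this have "s \<noteq> 0" "s \<noteq> 1"
        using ends by (auto simp: pathstart_def pathfinish_def)
      ultimately show "s \<in> {0<..<1}" by auto
    qed
    show "\<forall>\<^sub>F t in at_left s. wind D (\<beta> t) = lo s" if s: "0 < s" "s \<le> 1" for s
    proof (cases "s \<in> T")
      case True
      then show ?thesis
        using wind_at_transverse_intersection(2)[OF I(1,4,5,3,6,7)[OF P[OF True]]]
        by (simp add: lo_def R_def)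
    next
      case False
      then have "\<forall>\<^sub>F t in at s within {0..1}. wind D (\<beta> t) = wind D (\<beta> s)"
        using off s by auto
      then have "\<forall>\<^sub>F t in at s within {0..s}. wind D (\<beta> t) = wind D (\<beta> s)"
        by (rule filter_leD[rotated]) (use s in \<open>auto intro!: at_le\<close>)
      then show ?thesis
        using False s by (simp add: at_within_Icc_at_left lo_def)
    qed
    show "\<forall>\<^sub>F t in at_right s. wind D (\<beta> t) = hi s" if s: "0 \<le> s" "s < 1" for s
    proof (cases "s \<in> T")
      case True
      then show ?thesis
        using wind_at_transverse_intersection(1)[OF I(1,4,5,3,6,7)[OF P[OF True]]]
        by (simp add: hi_def R_def)
    next
      case False
      then have "\<forall>\<^sub>F t in at s within {0..1}. wind D (\<beta> t) = wind D (\<beta> s)"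
        using off s by auto
      then have "\<forall>\<^sub>F t in at s within {s..1}. wind D (\<beta> t) = wind D (\<beta> s)"
        by (rule filter_leD[rotated]) (use s in \<open>auto intro!: at_le\<close>)
      then show ?thesis
        using False s by (simp add: at_within_Icc_at_right hi_def)
    qed
  qed (auto simp: lo_def hi_def)
  moreover have "intersection_number D \<beta> = (\<Sum>s\<in>T. - (hi s - lo s))"
    unfolding intersection_number_def T_def sum.reindex[OF inj]
  proof (rule sum.cong)
    fix x assume x: "x \<in> ?I"
    obtain p s where ps: "x = (p, s)" by (cases x)
    have "s \<in> T"
      using x unfolding T_def ps by force
    then show "(case x of (p, s) \<Rightarrow> if right_of (tangent D p) (vector_derivative \<beta> (at s)) then 1 else - 1)
        = ((\<lambda>s. - (hi s - lo s)) \<circ> snd) x"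
      using P_eq[of p s] x by (simp add: ps hi_def lo_def R_def)
  qed simp
  ultimately show ?thesis
    by (simp add: pathstart_def pathfinish_def sum_negf del: minus_diff_eq)
qed

end

section \<open>Existence of a transverse path by Sard's theorem\<close>

lemma negligible_critical_values:
  fixes f :: "real \<Rightarrow> real"
  assumes "\<And>x. x \<in> S \<Longrightarrow> (f has_real_derivative 0) (at x)"
  shows "negligible (f ` S)"
proof -
  let ?g = "\<lambda>x::real^1. (\<chi> i. f (x $ 1)) :: real^1"
  have "negligible (?g ` {x. x $ 1 \<in> S})"
  \<comment> \<open>The one-dimensional case is obtained on \<open>real^1\<close>, where a vanishing
    derivative is a matrix of rank less than 1.\<close>
  proof (rule baby_Sard[of "{x. x $ 1 \<in> S}" ?g "\<lambda>_ _. 0"])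
    fix x :: "real^1" assume x: "x \<in> {x. x $ 1 \<in> S}"
    have "((\<lambda>x::real^1. f (x $ 1)) has_derivative (\<lambda>_. 0)) (at x)"
    proof (rule has_derivative_eq_rhs[OF has_derivative_compose[of "\<lambda>x::real^1. x $ 1" "\<lambda>x. x $ 1" x UNIV f "(*) 0"]])
      show "((\<lambda>x::real^1. x $ 1) has_derivative (\<lambda>x. x $ 1)) (at x)"
        by (intro bounded_linear_imp_has_derivative bounded_linear_vec_nth)
      show "(f has_derivative (*) 0) (at (x $ 1))"
        using assms[of "x $ 1"] x by (auto simp: has_field_derivative_def)
    qed simp
    then have "(?g has_derivative (\<lambda>_. 0)) (at x)"
      by (subst has_derivative_componentwise_within) (auto simp: Basis_vec_def inner_axis)
    then show "(?g has_derivative (\<lambda>_. 0)) (at x within {x. x $ 1 \<in> S})"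
      by (rule has_derivative_at_withinI)
    have "matrix (\<lambda>_::real^1. 0 :: real^1) = 0"
      by (simp add: matrix_def vec_eq_iff)
    then show "rank (matrix (\<lambda>_::real^1. 0 :: real^1)) < CARD(1)"
      by simp
  qed simp
  then have "negligible ((\<lambda>x::real^1. x $ 1) ` ?g ` {x. x $ 1 \<in> S})"
  proof (rule negligible_differentiable_image_negligible[rotated])
    show "(\<lambda>x::real^1. x $ 1) differentiable_on ?g ` {x. x $ 1 \<in> S}"
      by (intro differentiable_at_imp_differentiable_on bounded_linear_imp_differentiable bounded_linear_vec_nth)
  qed simp
  moreover have "(\<lambda>x::real^1. x $ 1) ` ?g ` {x. x $ 1 \<in> S} = f ` S"
  proof -
    have "f s \<in> (\<lambda>x::real^1. x $ 1) ` ?g ` {x. x $ 1 \<in> S}" if "s \<in> S" for s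
      by (rule image_eqI[OF _ imageI[of "\<chi> i. s"]]) (use that in auto)
    then show ?thesis by auto
  qed
  ultimately show ?thesis by simp
qed

context diagram
begin

text \<open>The outside of a large disc is connected and misses the diagram, so it lies in one
  region, the only unbounded one; loops inside the disc do not wind about its points.\<close>

lemma exterior:
  obtains B where "exterior_region D \<in> regions D"
    "\<And>z. B < norm z \<Longrightarrow> z \<in> exterior_region D" "\<And>z. z \<in> exterior_region D \<Longrightarrow> wind D z = 0"
proof -
  obtain B where B: "0 < B" "drawn D \<subseteq> ball 0 B"
    using bounded_subset_ballD[OF compact_imp_bounded[OF compact_drawn], of 0] by blast
  define X where "X = - cball (0 :: complex) B"
  define z0 where "z0 = complex_of_real (B + 1)"
  define E where "E = connected_component_set (- drawn D) z0"
  have z0: "z0 \<in> X"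
    using B by (simp add: X_def z0_def)
  have X: "connected X" "X \<subseteq> - drawn D"
    using B connected_complement_bounded_convex[of "cball (0::complex) B"]
    by (force simp: X_def)+
  have XE: "X \<subseteq> E"
    unfolding E_def by (rule connected_component_maximal[OF z0 X])
  have "\<not> bounded X"
    unfolding X_def using cobounded_imp_unbounded[of "X"] by (simp add: X_def cobounded_imp_unbounded)
  then have unb: "\<not> bounded E"
    using XE bounded_subset by blast
  have E: "E \<in> regions D"
    using z0 X(2) by (auto simp: E_def regions_def intro!: componentsI)
  have "exterior_region D = E"
    unfolding exterior_region_def
  proof (rule the_equality)
    show "E \<in> regions D \<and> \<not> bounded E" using E unb by blast
    fix \<Delta> assume "\<Delta> \<in> regions D \<and> \<not> bounded \<Delta>"
    then show "\<Delta> = E"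
      using cobounded_unique_unbounded_components[of "- drawn D" E \<Delta>] E unb
        compact_imp_bounded[OF compact_drawn] by (simp add: regions_def)
  qed
  moreover have "wind D z = 0" if "z \<in> E" for z
  proof -
    have "winding_number (loop D j) z0 = 0" if "j < ncomp D" for j
    proof (rule winding_number_zero_outside[OF path_loop[OF that] convex_cball[of 0 B] loop_closed])
      show "z0 \<notin> cball 0 B"
        using z0 by (simp add: X_def)
      show "path_image (loop D j) \<subseteq> cball 0 B"
        using path_image_loop[OF that] B(2) ball_subset_cball by blast
    qed
    then have "wind D z0 = 0"
      by (simp add: wind_def)
    then show ?thesis
      using wind_region[OF E that] XE z0 by auto
  qed
  moreover have "z \<in> E" if "B < norm z" for z
    using that XE by (auto simp: X_def)
  ultimately show thesis
    using that[of B] E by simp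
qed

lemma Im_derivative_eq_0_negligible:
  "negligible ((\<lambda>p. Im (pt D p)) ` {p \<in> params D. smooth_at D p \<and> Im (tangent D p) = 0})"
proof -
  let ?S = "\<lambda>j. {t. smooth_at D (shift (j, 1) t) \<and> Im (tangent D (shift (j, 1) t)) = 0}"
  have "negligible ((\<lambda>t. Im (strand D (j, 1) t)) ` ?S j)" for j
  proof (rule negligible_critical_values)
    fix t assume t: "t \<in> ?S j"
    \<comment> \<open>\<open>det2 1\<close> is the imaginary part, so the derivative rule for
      determinants differentiates the height along the strand.\<close>
    have "((\<lambda>t. det2 1 (strand D (j, 1) t)) has_real_derivative det2 1 (tangent D (shift (j, 1) t))) (at t)"
      using t by (intro has_vector_derivative_det2 strand_has_derivative) simp
    then show "((\<lambda>t. Im (strand D (j, 1) t)) has_real_derivative 0) (at t)"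
      using t by (simp add: det2_Re_Im)
  qed
  then have "negligible (\<Union>j<ncomp D. (\<lambda>t. Im (strand D (j, 1) t)) ` ?S j)"
    by (intro negligible_Union) auto
  then show ?thesis
  proof (rule negligible_subset, intro image_subsetI)
    fix p assume p: "p \<in> {p \<in> params D. smooth_at D p \<and> Im (tangent D p) = 0}"
    then obtain t where t: "p = shift (fst p, 1) t"
      using params_eq_shift[of p D] by auto
    have "fst p < ncomp D"
      using p by (auto simp: params_def)
    moreover have "t \<in> ?S (fst p)"
      using p t by (metis (mono_tags, lifting) mem_Collect_eq)
    moreover have "Im (pt D p) = Im (strand D (fst p, 1) t)"
      using t by simp
    ultimately show "Im (pt D p) \<in> (\<Union>j<ncomp D. (\<lambda>t. Im (strand D (j, 1) t)) ` ?S j)"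
      by blast
  qed
qed

text \<open>An infinite level set accumulates at some parameter by compactness; the difference
  quotient of the height vanishes along it, against the nonzero derivative there.\<close>

lemma finite_regular_level:
  assumes "\<And>p. \<lbrakk>p \<in> params D; Im (pt D p) = h\<rbrakk> \<Longrightarrow> smooth_at D p \<and> Im (tangent D p) \<noteq> 0"
  shows "finite {p \<in> params D. Im (pt D p) = h}"
proof -
  have "finite {t \<in> {0..2 * pi}. Im (strand D (j, 1) t) = h}" if j: "j < ncomp D" for j
  proof (rule ccontr)
    let ?f = "\<lambda>t. Im (strand D (j, 1) t)"
    assume "infinite {t \<in> {0..2 * pi}. ?f t = h}"
    moreover have "{t \<in> {0..2 * pi}. ?f t = h} \<subseteq> {0..2 * pi}"
      by auto
    ultimately obtain t where t: "t \<in> {0..2 * pi}" "t islimpt {t \<in> {0..2 * pi}. ?f t = h}"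
      using Heine_Borel_imp_Bolzano_Weierstrass[OF compact_Icc, of "{t \<in> {0..2 * pi}. ?f t = h}" 0 "2 * pi"]
      by blast
    have j1: "(j, 1) \<in> params D"
      using j by (simp add: params_def)
    have "closed {t \<in> {0..2 * pi}. ?f t = h}"
      by (intro continuous_closed_preimage_constant continuous_intros strand_continuous[OF j1])
    then have ft: "?f t = h"
      using t(2) closed_limpt by blast
    then have reg: "smooth_at D (shift (j, 1) t)" "Im (tangent D (shift (j, 1) t)) \<noteq> 0"
      using assms[of "shift (j, 1) t"] j1 by auto
    have "((\<lambda>t. det2 1 (strand D (j, 1) t)) has_real_derivative det2 1 (tangent D (shift (j, 1) t))) (at t)"
      using reg by (intro has_vector_derivative_det2 strand_has_derivative) simp
    then have "(?f has_real_derivative Im (tangent D (shift (j, 1) t))) (at t)"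
      by (simp add: det2_Re_Im)
    then have "((\<lambda>s. (?f s - ?f t) / (s - t)) \<longlongrightarrow> Im (tangent D (shift (j, 1) t))) (at t)"
      by (simp add: has_field_derivative_iff)
    then have "\<forall>\<^sub>F s in at t. (?f s - ?f t) / (s - t) \<noteq> 0"
      using reg(2) by (rule tendsto_imp_eventually_ne)
    then have "\<forall>\<^sub>F s in at t. s \<notin> {t \<in> {0..2 * pi}. ?f t = h}"
      by eventually_elim (use ft in auto)
    then show False
      using t(2) by (simp add: islimpt_iff_eventually)
  qed
  then have "finite (\<Union>j<ncomp D. shift (j, 1) ` {t \<in> {0..2 * pi}. Im (strand D (j, 1) t) = h})"
    by auto
  then show ?thesis
  proof (rule rev_finite_subset, intro subsetI)
    fix p assume p: "p \<in> {p \<in> params D. Im (pt D p) = h}"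
    then obtain t where t: "0 \<le> t" "t < 2 * pi" "p = shift (fst p, 1) t"
      using params_eq_shift[of p D] by auto
    have "fst p < ncomp D"
      using p by (auto simp: params_def)
    moreover have "t \<in> {t \<in> {0..2 * pi}. Im (strand D (fst p, 1) t) = h}"
      using p t by (metis (mono_tags, lifting) atLeastAtMost_iff less_imp_le mem_Collect_eq)
    ultimately show "p \<in> (\<Union>j<ncomp D. shift (j, 1) ` {t \<in> {0..2 * pi}. Im (strand D (j, 1) t) = h})"
      using t(3) by blast
  qed
qed

text \<open>By Sard's theorem almost every horizontal ray issuing from the region is transverse.\<close>

lemma transverse_path_exists:
  assumes \<Delta>: "\<Delta> \<in> regions D"
  shows "\<exists>\<beta>. transverse_path D \<beta> \<and> pathstart \<beta> \<in> \<Delta> \<and> pathfinish \<beta> \<in> exterior_region D"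
proof -
  obtain B where B: "exterior_region D \<in> regions D" "\<And>z. B < norm z \<Longrightarrow> z \<in> exterior_region D"
    using exterior by metis
  have "open (- drawn D)"
    using compact_imp_closed[OF compact_drawn] by blast
  then have "open \<Delta>"
    using \<Delta> open_components by (auto simp: regions_def)
  moreover obtain z0 where "z0 \<in> \<Delta>"
    using \<Delta> in_components_nonempty by (auto simp: regions_def)
  ultimately obtain r where r: "0 < r" "ball z0 r \<subseteq> \<Delta>"
    by (metis open_contains_ball)
  \<comment> \<open>Heights to avoid: critical values of the height, a null set by Sard, and the
    finitely many heights of non-smooth and double parameters.\<close>
  let ?bad = "(\<lambda>p. Im (pt D p)) ` {p \<in> params D. smooth_at D p \<and> Im (tangent D p) = 0} \<union>
    (\<lambda>p. Im (pt D p)) ` ({p \<in> params D. \<not> smooth_at D p} \<union> double_params D)"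
  have "negligible ?bad"
    using Im_derivative_eq_0_negligible finite_not_smooth finite_double
    by (intro negligible_Un[OF _ negligible_finite]) auto
  moreover have "\<not> negligible {Im z0 - r<..<Im z0 + r}"
    using r(1) by (intro open_not_negligible) auto
  ultimately have "\<not> {Im z0 - r<..<Im z0 + r} \<subseteq> ?bad"
    using negligible_subset by blast
  then obtain h where "h \<in> {Im z0 - r<..<Im z0 + r}" and bad: "h \<notin> ?bad"
    by blast
  then have h: "Im z0 - r < h" "h < Im z0 + r"
    by auto
  have reg: "smooth_at D p" "Im (tangent D p) \<noteq> 0" "p \<notin> double_params D"
    if "p \<in> params D" "Im (pt D p) = h" for p
    using bad that by blast+
  define z where "z = Complex (Re z0) h"
  have "dist z0 z = \<bar>Im z0 - h\<bar>"
    by (simp add: z_def dist_norm cmod_def)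
  then have z: "z \<in> \<Delta>"
    using r(2) h by (auto simp: abs_less_iff)
  \<comment> \<open>A horizontal segment of this length ends with real part at least
    \<open>\<bar>B\<bar> + 1\<close>, hence in the exterior region.\<close>
  define M where "M = \<bar>B\<bar> + \<bar>Re z0\<bar> + 1"
  have M: "0 < M"
    by (simp add: M_def)
  define \<beta> where "\<beta> s = z + of_real (s * M)" for s :: real
  have d: "(\<beta> has_vector_derivative of_real M) (at s)" for s
  proof -
    have "((\<lambda>s. complex_of_real (s * M)) has_vector_derivative of_real M) (at s)"
      by (intro has_vector_derivative_of_real) (auto intro!: derivative_eq_intros)
    then show ?thesis
      unfolding \<beta>_def by (auto intro!: derivative_eq_intros)
  qed
  have on: "Im (pt D p) = h" if "(p, s) \<in> intersections D \<beta>" for p s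
  proof -
    have "pt D p = \<beta> s"
      using that by (simp add: intersections_def)
    then show ?thesis
      by (simp add: \<beta>_def z_def)
  qed
  have "intersections D \<beta> \<subseteq> (\<lambda>p. (p, (Re (pt D p) - Re z) / M)) ` {p \<in> params D. Im (pt D p) = h}"
  proof
    fix x assume x: "x \<in> intersections D \<beta>"
    obtain p s where ps: "x = (p, s)" by (cases x)
    have "\<beta> s = pt D p" "p \<in> params D"
      using x by (simp_all add: ps intersections_def)
    moreover from this(1) have "s = (Re (pt D p) - Re z) / M"
      using M unfolding \<beta>_def by (metis Re_complex_of_real add_diff_cancel_left' nonzero_mult_div_cancel_right
          less_irrefl minus_complex.simps(1))
    ultimately show "x \<in> (\<lambda>p. (p, (Re (pt D p) - Re z) / M)) ` {p \<in> params D. Im (pt D p) = h}"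
      using on[of p s] x unfolding ps by (intro image_eqI[of _ _ p]) simp_all
  qed
  then have "finite (intersections D \<beta>)"
    using finite_regular_level[of h] reg finite_surj by blast
  moreover have "path \<beta>"
    unfolding path_def \<beta>_def by (intro continuous_intros)
  moreover have "p \<notin> double_params D \<and> smooth_at D p \<and> \<beta> differentiable (at s) \<and>
      det2 (tangent D p) (vector_derivative \<beta> (at s)) \<noteq> 0" if ps: "(p, s) \<in> intersections D \<beta>" for p s
  proof -
    have p: "p \<in> params D"
      using ps by (simp add: intersections_def)
    show ?thesis
      using reg[OF p on[OF ps]] M d[of s]
      by (auto simp: vector_derivative_at[OF d] det2_Re_Im intro: differentiableI_vector)
  qed
  ultimately have "transverse_path D \<beta>"
    unfolding transverse_path_def by blast
  moreover have "pathstart \<beta> \<in> \<Delta>"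
    using z by (simp add: pathstart_def \<beta>_def)
  moreover have "pathfinish \<beta> \<in> exterior_region D"
  proof (rule B(2))
    have "B < Re z0 + M"
      by (simp add: M_def)
    also have "\<dots> \<le> norm (pathfinish \<beta>)"
      using complex_Re_le_cmod[of "pathfinish \<beta>"] by (simp add: pathfinish_def \<beta>_def z_def)
    finally show "B < norm (pathfinish \<beta>)" .
  qed
  ultimately show ?thesis by blast
qed

text \<open>Every admissible path gives the same number, because the winding number vanishes at its
  exterior end; together with the existence of such a path this resolves the definite
  description.\<close>

lemma region_index_eq_wind:
  assumes \<Delta>: "\<Delta> \<in> regions D" and z: "z \<in> \<Delta>"
  shows "region_index D \<Delta> = wind D z"
proof -
  obtain B where B: "exterior_region D \<in> regions D" "\<And>z. z \<in> exterior_region D \<Longrightarrow> wind D z = 0"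
    using exterior by metis
  have off: "x \<notin> drawn D" if "\<Delta>' \<in> regions D" "x \<in> \<Delta>'" for x \<Delta>'
    using that in_components_subset by (auto simp: regions_def)
  have number: "intersection_number D \<beta> = wind D z"
    if "transverse_path D \<beta>" "pathstart \<beta> \<in> \<Delta>" "pathfinish \<beta> \<in> exterior_region D" for \<beta>
    using intersection_number_wind[OF that(1) off[OF \<Delta> that(2)] off[OF B(1) that(3)]]
      wind_region[OF \<Delta> that(2) z] B(2)[OF that(3)] by simp
  show ?thesis
    unfolding region_index_def
    by (rule the_equality) (use transverse_path_exists[OF \<Delta>] number in metis)+
qed

end


section \<open>Sums of jumps over the double points\<close>

context diagram
begin

text \<open>Cutting the circle open at a parameter that is not double puts all double parameters
  into an open interval. After a full turn the function returns to its value, so the jumps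
  cancel.\<close>

lemma finsum_component_jumps:
  fixes G (structure)
  assumes "abelian_group G" and j: "j < ncomp D"
    and closed: "\<And>p. f p \<in> carrier G" "\<And>p. lo p \<in> carrier G" "\<And>p. hi p \<in> carrier G"
    and right: "\<And>p. p \<in> params D \<Longrightarrow> \<forall>\<^sub>F s in at_right 0. f (shift p s) = hi p"
    and left: "\<And>p. p \<in> params D \<Longrightarrow> \<forall>\<^sub>F s in at_right 0. f (shift p (- s)) = lo p"
    and eq: "\<And>p. p \<notin> double_params D \<Longrightarrow> lo p = f p" "\<And>p. p \<notin> double_params D \<Longrightarrow> hi p = f p"
  shows "(\<Oplus>p\<in>{p \<in> double_params D. fst p = j}. hi p \<ominus> lo p) = \<zero>"
proof -
  interpret abelian_group G by fact
  have j1: "(j, 1) \<in> params D"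
    using j by (simp add: params_def)
  obtain t0 where t0: "shift (j, 1) t0 \<notin> double_params D"
    using eventually_happens'[OF _ eventually_shift_notin[OF finite_double j1]] by auto
  define p0 where "p0 = shift (j, 1) t0"
  have p0: "p0 \<in> params D" "fst p0 = j" "p0 \<notin> double_params D"
    using t0 j1 by (simp_all add: p0_def)
  let ?A = "{p \<in> double_params D. fst p = j}"
  define T where "T = {s \<in> {0<..<2 * pi}. shift p0 s \<in> double_params D}"
  have inj: "inj_on (shift p0) T"
  proof (rule inj_onI)
    fix s t assume st: "s \<in> T" "t \<in> T" "shift p0 s = shift p0 t"
    then have "shift (shift p0 t) (s - t) = shift p0 t"
      by simp
    then obtain n :: int where n: "s - t = 2 * pi * n"
      using shift_eq_self[of "shift p0 t" "s - t" D] p0 by auto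
    have "\<bar>s - t\<bar> < 2 * pi"
      using st by (auto simp: T_def)
    then have "\<bar>real_of_int n\<bar> < 1"
      by (simp add: n abs_mult)
    then have "n = 0"
      by linarith
    then show "s = t"
      using n by simp
  qed
  have image: "shift p0 ` T = ?A"
  proof (intro equalityI subsetI)
    fix p assume p: "p \<in> ?A"
    then have "p \<in> params D"
      by (auto simp: double_params_def)
    then obtain t where "0 \<le> t" "t < 2 * pi" "p = shift (j, 1) t"
      using params_eq_shift[of p D] p by auto
    \<comment> \<open>The representative of \<open>t - t0\<close> modulo 2 pi in the interval from 0
      to 2 pi.\<close>
    define s where "s = 2 * pi * frac ((t - t0) / (2 * pi))"
    have s: "0 \<le> s" "s < 2 * pi"
      by (simp_all add: s_def frac_lt_1)
    have "t - t0 = s + 2 * pi * of_int \<lfloor>(t - t0) / (2 * pi)\<rfloor>"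
      by (simp add: s_def frac_def field_simps)
    then have "cis t = cis (t0 + s) * cis (2 * pi * of_int \<lfloor>(t - t0) / (2 * pi)\<rfloor>)"
      by (simp add: cis_mult algebra_simps)
    then have "p = shift p0 s"
      using \<open>p = _\<close> by (simp add: p0_def shift_def cis_mult cis_multiple_2pi)
    moreover from this have "s \<noteq> 0"
      using p p0 by auto
    ultimately show "p \<in> shift p0 ` T"
      using s p by (auto simp: T_def)
  qed (auto simp: T_def p0)
  have "finite ?A"
    using finite_double by simp
  then have "finite T"
    using image inj finite_image_iff by metis
  define lo' where "lo' x = (if x \<in> T then lo (shift p0 x) else f (shift p0 x))" for x
  define hi' where "hi' x = (if x \<in> T then hi (shift p0 x) else f (shift p0 x))" for x
  have nondouble: "shift p0 x \<notin> double_params D" if "0 \<le> x" "x \<le> 2 * pi" "x \<notin> T" for x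
    using that p0(3) by (cases "x = 0 \<or> x = 2 * pi") (auto simp: T_def)
  have lohi': "lo' x = lo (shift p0 x)" "hi' x = hi (shift p0 x)" if "0 \<le> x" "x \<le> 2 * pi" for x
    using nondouble[OF that] eq by (auto simp: lo'_def hi'_def)
  have "f (shift p0 (2 * pi)) = f (shift p0 0) \<oplus> (\<Oplus>s\<in>T. hi' s \<ominus> lo' s)"
  proof (rule finsum_jumps)
    show "\<forall>\<^sub>F y in at_right x. f (shift p0 y) = hi' x" if "0 \<le> x" "x < 2 * pi" for x
      using right[of "shift p0 x"] p0 that
      by (subst eventually_at_right_to_0) (simp add: add.commute lohi')
    have "\<forall>\<^sub>F y in at_left x. f (shift (shift p0 x) (- (x - y))) = lo (shift p0 x)" for x
      using left[of "shift p0 x"] p0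
      by (subst eventually_at_left_to_right, subst eventually_at_right_to_0) simp
    then show "\<forall>\<^sub>F y in at_left x. f (shift p0 y) = lo' x" if "0 < x" "x \<le> 2 * pi" for x
      using that by (simp add: lohi')
  qed (use \<open>finite T\<close> closed in \<open>auto simp: T_def lo'_def hi'_def\<close>)
  then have f0: "f p0 = f p0 \<oplus> (\<Oplus>s\<in>T. hi' s \<ominus> lo' s)"
    by simp
  define J where "J = (\<Oplus>s\<in>T. hi' s \<ominus> lo' s)"
  have J: "J \<in> carrier G"
    unfolding J_def by (intro finsum_closed Pi_I minus_closed) (auto simp: lo'_def hi'_def closed)
  have "f p0 \<oplus> J = f p0 \<oplus> \<zero>"
    using f0[folded J_def] closed(1)[of p0] by simp
  then have "J = \<zero>"
    using J closed(1)[of p0] by simp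
  have "(\<Oplus>p\<in>shift p0 ` T. hi p \<ominus> lo p) = (\<Oplus>s\<in>T. hi (shift p0 s) \<ominus> lo (shift p0 s))"
    by (rule finsum_reindex) (use inj closed in auto)
  also have "\<dots> = J"
    unfolding J_def by (rule finsum_cong') (auto simp: lo'_def hi'_def closed)
  finally show ?thesis
    by (simp add: image \<open>J = \<zero>\<close>)
qed

lemma finsum_double_jumps:
  fixes G (structure)
  assumes "abelian_group G"
    and closed: "\<And>p. f p \<in> carrier G" "\<And>p. lo p \<in> carrier G" "\<And>p. hi p \<in> carrier G"
    and "\<And>p. p \<in> params D \<Longrightarrow> \<forall>\<^sub>F s in at_right 0. f (shift p s) = hi p"
    and "\<And>p. p \<in> params D \<Longrightarrow> \<forall>\<^sub>F s in at_right 0. f (shift p (- s)) = lo p"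
    and "\<And>p. p \<notin> double_params D \<Longrightarrow> lo p = f p" "\<And>p. p \<notin> double_params D \<Longrightarrow> hi p = f p"
  shows "(\<Oplus>p\<in>double_params D. hi p \<ominus> lo p) = \<zero>"
proof -
  interpret abelian_group G by fact
  have partial: "(\<Oplus>p\<in>{p \<in> double_params D. fst p < n}. hi p \<ominus> lo p) = \<zero>" if "n \<le> ncomp D" for n
    using that
  proof (induction n)
    case (Suc n)
    have "{p \<in> double_params D. fst p < Suc n} = {p \<in> double_params D. fst p < n} \<union> {p \<in> double_params D. fst p = n}"
      by auto
    moreover have "(\<Oplus>p\<in>{p \<in> double_params D. fst p < n} \<union> {p \<in> double_params D. fst p = n}. hi p \<ominus> lo p) =
      (\<Oplus>p\<in>{p \<in> double_params D. fst p < n}. hi p \<ominus> lo p) \<oplus> (\<Oplus>p\<in>{p \<in> double_params D. fst p = n}. hi p \<ominus> lo p)"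
      using finite_double closed by (intro finsum_Un_disjoint) auto
    ultimately show ?case
      using Suc finsum_component_jumps[OF assms(1), of n f lo hi] assms(2-) by simp
  qed simp
  have "{p \<in> double_params D. fst p < ncomp D} = double_params D"
    by (auto simp: double_params_def params_def)
  then show ?thesis
    using partial[OF order_refl] by simp
qed

lemma crossingD:
  assumes "(p, q) \<in> crossings D"
  shows "p \<in> params D" "q \<in> params D" "p \<noteq> q" "pt D p = pt D q" "q \<in> under D" "p \<notin> under D"
proof -
  show *: "p \<in> params D" "p \<noteq> q" "pt D p = pt D q" "q \<in> under D"
    using assms by (auto simp: crossings_def)
  show **: "q \<in> params D"
    using * under_double by (auto simp: double_params_def)
  show "p \<notin> under D"
    using under_over[of p q] * ** by blast
qed

text \<open>As triple points are excluded, each double parameter belongs to exactly one crossing, as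
  its over- or its under-parameter but not both. Sums over double parameters therefore regroup into
  sums over crossings.\<close>

lemma crossings_fst_snd:
  "inj_on fst (crossings D)" "inj_on snd (crossings D)"
  "fst ` crossings D \<inter> snd ` crossings D = {}" "fst ` crossings D \<union> snd ` crossings D = double_params D"
proof -
  show "inj_on fst (crossings D)"
  proof (rule inj_onI)
    fix x y assume xy: "x \<in> crossings D" "y \<in> crossings D" "fst x = fst y"
    obtain p q r where x: "x = (p, q)" and y: "y = (p, r)"
      using xy(3) by (cases x, cases y) simp
    note cq = crossingD[OF xy(1)[unfolded x]] and cr = crossingD[OF xy(2)[unfolded y]]
    have "q = r"
      using no_triple[OF cq(2,1) cr(2) cq(4)[symmetric] cr(4)] cq(3) cr(3) by simp
    then show "x = y"
      by (simp add: x y)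
  qed
  show "inj_on snd (crossings D)"
  proof (rule inj_onI)
    fix x y assume xy: "x \<in> crossings D" "y \<in> crossings D" "snd x = snd y"
    obtain p q r where x: "x = (p, q)" and y: "y = (r, q)"
      using xy(3) by (cases x, cases y) simp
    note cp = crossingD[OF xy(1)[unfolded x]] and cr = crossingD[OF xy(2)[unfolded y]]
    have "p = r"
      using no_triple[OF cp(1,2) cr(1) cp(4) cr(4)[symmetric]] cp(3) cr(3) by simp
    then show "x = y"
      by (simp add: x y)
  qed
  show "fst ` crossings D \<inter> snd ` crossings D = {}"
    using crossingD(5,6) by fastforce
  show "fst ` crossings D \<union> snd ` crossings D = double_params D"
  proof (intro equalityI subsetI)
    fix p assume "p \<in> fst ` crossings D \<union> snd ` crossings D"
    then obtain q r where "(q, r) \<in> crossings D" "p = q \<or> p = r"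
      by auto
    then show "p \<in> double_params D"
      using double_pair[of q r] crossingD[of q r] by metis
  next
    fix p assume "p \<in> double_params D"
    then obtain q where q: "p \<in> params D" "q \<in> params D" "q \<noteq> p" "pt D q = pt D p"
      by (auto simp: double_params_def)
    then have "(p, q) \<in> crossings D \<or> (q, p) \<in> crossings D"
      using under_over[of p q] by (auto simp: crossings_def)
    then show "p \<in> fst ` crossings D \<union> snd ` crossings D"
      by force
  qed
qed

lemma finite_crossings: "finite (crossings D)"
proof (rule finite_imageD[OF _ crossings_fst_snd(1)])
  show "finite (fst ` crossings D)"
    using finite_double crossings_fst_snd(4) by (metis finite_Un)
qed

lemma finsum_over_crossings:
  fixes G (structure)
  assumes "abelian_group G" and closed: "\<And>p. f p \<in> carrier G"
  shows "(\<Oplus>p\<in>double_params D. f p) = (\<Oplus>x\<in>crossings D. f (fst x) \<oplus> f (snd x))"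
proof -
  interpret abelian_group G by fact
  have "(\<Oplus>p\<in>double_params D. f p) = (\<Oplus>p\<in>fst ` crossings D. f p) \<oplus> (\<Oplus>p\<in>snd ` crossings D. f p)"
    unfolding crossings_fst_snd(4)[symmetric]
    by (intro finsum_Un_disjoint crossings_fst_snd(3)) (use finite_crossings closed in auto)
  also have "(\<Oplus>p\<in>fst ` crossings D. f p) = (\<Oplus>x\<in>crossings D. f (fst x))"
    by (rule finsum_reindex) (use closed crossings_fst_snd(1) in auto)
  also have "(\<Oplus>p\<in>snd ` crossings D. f p) = (\<Oplus>x\<in>crossings D. f (snd x))"
    by (rule finsum_reindex) (use closed crossings_fst_snd(2) in auto)
  also have "(\<Oplus>x\<in>crossings D. f (fst x)) \<oplus> (\<Oplus>x\<in>crossings D. f (snd x))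
      = (\<Oplus>x\<in>crossings D. f (fst x) \<oplus> f (snd x))"
    by (rule finsum_addf[symmetric]) (use closed in auto)
  finally show ?thesis .
qed

end


section \<open>Arcs\<close>

text \<open>Makes the arc a function of the parameter, which the definite descriptions of the arcs
  at a crossing are compared with. At an under-parameter the component is empty, so the value is not
  an arc.\<close>

definition arc_at :: "link_diagram \<Rightarrow> nat \<times> complex \<Rightarrow> nat \<times> complex set" where
  "arc_at D p = (fst p, connected_component_set (sphere 0 1 - {z. (fst p, z) \<in> under D}) (snd p))"

context diagram
begin

lemma arc_at:
  assumes "p \<in> params D" "p \<notin> under D"
  shows "arc_at D p \<in> arcs D" "lies_on p (arc_at D p)"
  using assms
  by (auto simp: arc_at_def arcs_def lies_on_def params_def connected_component_refl intro!: componentsI)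

lemma arc_at_unique:
  assumes "a \<in> arcs D" "lies_on p a"
  shows "a = arc_at D p"
proof -
  obtain K where K: "a = (fst p, K)" "K \<in> components (sphere 0 1 - {z. (fst p, z) \<in> under D})" "snd p \<in> K"
    using assms by (cases a) (auto simp: arcs_def lies_on_def)
  then obtain x where "K = connected_component_set (sphere 0 1 - {z. (fst p, z) \<in> under D}) x"
    by (auto elim: componentsE)
  then show ?thesis
    using K connected_component_eq[of "snd p"] by (simp add: arc_at_def)
qed

lemma arc_at_shift_eq:
  assumes q: "q \<in> params D" and S: "connected S" "s \<in> S" "t \<in> S" "\<And>x. x \<in> S \<Longrightarrow> shift q x \<notin> under D"
  shows "arc_at D (shift q s) = arc_at D (shift q t)"
proof -
  let ?X = "(\<lambda>x. snd (shift q x)) ` S"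
  have "connected ?X"
    unfolding shift_def by (intro connected_continuous_image S(1)) (auto intro!: continuous_intros)
  moreover have "?X \<subseteq> sphere 0 1 - {z. (fst q, z) \<in> under D}"
  proof (intro image_subsetI DiffI)
    fix x assume "x \<in> S"
    then have "shift q x \<in> params D" "shift q x \<notin> under D"
      using q S(4) by simp_all
    moreover have "shift q x = (fst q, snd (shift q x))"
      by (simp add: prod_eq_iff)
    ultimately show "snd (shift q x) \<in> sphere 0 1" "snd (shift q x) \<notin> {z. (fst q, z) \<in> under D}"
      unfolding params_def by (metis mem_Times_iff, metis mem_Collect_eq)
  qed
  ultimately have "connected_component (sphere 0 1 - {z. (fst q, z) \<in> under D}) (snd (shift q s)) (snd (shift q t))"
    using S(2,3) unfolding connected_component_def by blast
  then show ?thesis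
    using connected_component_eq by (fastforce simp: arc_at_def)
qed

lemma finite_under: "finite (under D)"
  using finite_double under_double finite_subset by blast

lemma arc_at_locally_constant:
  assumes "p \<in> params D" "p \<notin> under D"
  shows "\<forall>\<^sub>F s in at 0. arc_at D (shift p s) = arc_at D p"
proof -
  obtain e where e: "0 < e" "\<And>s. \<lbrakk>s \<noteq> 0; \<bar>s\<bar> < e\<rbrakk> \<Longrightarrow> shift p s \<notin> under D"
    using eventually_shift_notin[OF finite_under assms(1)] by (auto simp: eventually_at dist_real_def)
  have "arc_at D (shift p s) = arc_at D (shift p 0)" if "\<bar>s\<bar> < e" for s
  proof (rule arc_at_shift_eq[OF assms(1), of "{- e<..<e}"])
    show "shift p x \<notin> under D" if "x \<in> {- e<..<e}" for x
      using that e(2)[of x] assms(2) by (cases "x = 0") (auto simp: abs_less_iff)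
  qed (use that e(1) in auto)
  then show ?thesis
    using e(1) by (auto simp: eventually_at dist_real_def)
qed

text \<open>There are finitely many under-parameters, so each of the two short half-neighbourhoods
  of \<open>q\<close> is a connected piece of circle without any, even if \<open>q\<close> itself is
  one.\<close>

lemma arc_at_one_sided:
  assumes q: "q \<in> params D" and \<sigma>: "\<sigma> = 1 \<or> \<sigma> = - 1"
  shows "\<exists>a\<in>arcs D. \<forall>\<^sub>F s in at_right 0. arc_at D (shift q (\<sigma> * s)) = a \<and> lies_on (shift q (\<sigma> * s)) a"
proof -
  obtain e where e: "0 < e" "\<And>s. \<lbrakk>s \<noteq> 0; \<bar>s\<bar> < e\<rbrakk> \<Longrightarrow> shift q s \<notin> under D"
    using eventually_shift_notin[OF finite_under q] by (auto simp: eventually_at dist_real_def)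
  define a where "a = arc_at D (shift q (\<sigma> * (e / 2)))"
  have off: "shift q (\<sigma> * s) \<notin> under D" if "0 < s" "s < e" for s
    using e(2)[of "\<sigma> * s"] that \<sigma> by auto
  have *: "arc_at D (shift q (\<sigma> * s)) = a \<and> lies_on (shift q (\<sigma> * s)) a" if s: "0 < s" "s < e" for s
  proof -
    have "arc_at D (shift q (\<sigma> * s)) = a"
      unfolding a_def
    proof (rule arc_at_shift_eq[OF q, of "(*) \<sigma> ` {0<..<e}"])
      show "connected ((*) \<sigma> ` {0<..<e})"
        by (intro connected_continuous_image continuous_intros) auto
      show "\<sigma> * s \<in> (*) \<sigma> ` {0<..<e}" "\<sigma> * (e / 2) \<in> (*) \<sigma> ` {0<..<e}"
        using s e(1) by (intro imageI; simp)+
    qed (use off in auto)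
    then show ?thesis
      using arc_at(2)[of "shift q (\<sigma> * s)"] q off[OF s] by simp
  qed
  have "a \<in> arcs D"
    unfolding a_def using q e(1) by (intro arc_at(1) off) simp_all
  moreover have "\<forall>\<^sub>F s in at_right 0. arc_at D (shift q (\<sigma> * s)) = a \<and> lies_on (shift q (\<sigma> * s)) a"
    using e(1) * by (intro eventually_at_rightI[of 0 e]) auto
  ultimately show ?thesis by blast
qed

lemma arc_out:
  assumes "q \<in> params D"
  shows "arc_out D q \<in> arcs D" "\<forall>\<^sub>F s in at_right 0. arc_at D (shift q s) = arc_out D q"
proof -
  obtain a where a: "a \<in> arcs D"
    "\<forall>\<^sub>F s in at_right 0. arc_at D (shift q s) = a \<and> lies_on (shift q s) a"
    using arc_at_one_sided[OF assms, of 1] by auto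
  have "arc_out D q = a"
    unfolding arc_out_def
  proof (rule the_equality)
    show "a \<in> arcs D \<and> (\<forall>\<^sub>F s in at_right 0. lies_on (shift q s) a)"
      using a by (auto elim: eventually_mono)
    fix b assume b: "b \<in> arcs D \<and> (\<forall>\<^sub>F s in at_right 0. lies_on (shift q s) b)"
    from conjunct2[OF b] a(2) have "\<forall>\<^sub>F s in at_right (0::real). b = a"
      by eventually_elim (use arc_at_unique[OF conjunct1[OF b]] in simp)
    then show "b = a"
      by (simp add: eventually_const_iff)
  qed
  then show "arc_out D q \<in> arcs D" "\<forall>\<^sub>F s in at_right 0. arc_at D (shift q s) = arc_out D q"
    using a by (auto elim: eventually_mono)
qed

lemma arc_in:
  assumes "q \<in> params D"
  shows "arc_in D q \<in> arcs D" "\<forall>\<^sub>F s in at_right 0. arc_at D (shift q (- s)) = arc_in D q"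
proof -
  obtain a where a: "a \<in> arcs D"
    "\<forall>\<^sub>F s in at_right 0. arc_at D (shift q (- s)) = a \<and> lies_on (shift q (- s)) a"
    using arc_at_one_sided[OF assms, of "- 1"] by auto
  have left: "(\<forall>\<^sub>F s in at_left 0. lies_on (shift q s) b) \<longleftrightarrow> (\<forall>\<^sub>F s in at_right 0. lies_on (shift q (- s)) b)" for b
    by (subst eventually_at_left_to_right) simp
  have "arc_in D q = a"
    unfolding arc_in_def left
  proof (rule the_equality)
    show "a \<in> arcs D \<and> (\<forall>\<^sub>F s in at_right 0. lies_on (shift q (- s)) a)"
      using a by (auto elim: eventually_mono)
    fix b assume b: "b \<in> arcs D \<and> (\<forall>\<^sub>F s in at_right 0. lies_on (shift q (- s)) b)"
    from conjunct2[OF b] a(2) have "\<forall>\<^sub>F s in at_right (0::real). b = a"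
      by eventually_elim (use arc_at_unique[OF conjunct1[OF b]] in simp)
    then show "b = a"
      by (simp add: eventually_const_iff)
  qed
  then show "arc_in D q \<in> arcs D" "\<forall>\<^sub>F s in at_right 0. arc_at D (shift q (- s)) = arc_in D q"
    using a by (auto elim: eventually_mono)
qed

lemma over_arc:
  assumes "(p, q) \<in> crossings D"
  shows "over_arc D (p, q) = arc_at D p" "over_arc D (p, q) \<in> arcs D"
proof -
  have "arc_at D p \<in> arcs D \<and> lies_on p (arc_at D p)"
    using arc_at crossingD[OF assms] by blast
  then show "over_arc D (p, q) = arc_at D p"
    unfolding over_arc_def prod.case by (rule the_equality) (use arc_at_unique in blast)
  then show "over_arc D (p, q) \<in> arcs D"
    using arc_at crossingD[OF assms] by simp
qed

lemma under_arcs: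
  assumes "(p, q) \<in> crossings D"
  shows "under_arc_right D (p, q) \<in> arcs D" "under_arc_left D (p, q) \<in> arcs D"
  using arc_in(1) arc_out(1) crossingD(2)[OF assms]
  by (simp_all add: under_arc_right_def under_arc_left_def)

text \<open>A negative crossing is handled by exchanging the two strands: this makes the determinant
  positive and leaves the source region unchanged.\<close>

lemma crossing_index_right_wind:
  assumes x: "(p, q) \<in> crossings D"
  shows "0 < det2 (tangent D p) (tangent D q) \<Longrightarrow>
      \<forall>\<^sub>F s in at_right 0. right_wind D (shift p s) = crossing_index D (p, q) \<and>
        right_wind D (shift p (- s)) = crossing_index D (p, q) + 1 \<and>
        right_wind D (shift q s) = crossing_index D (p, q) + 1 \<and>
        right_wind D (shift q (- s)) = crossing_index D (p, q)"
    and "det2 (tangent D p) (tangent D q) < 0 \<Longrightarrow>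
      \<forall>\<^sub>F s in at_right 0. right_wind D (shift q s) = crossing_index D (p, q) \<and>
        right_wind D (shift q (- s)) = crossing_index D (p, q) + 1 \<and>
        right_wind D (shift p s) = crossing_index D (p, q) + 1 \<and>
        right_wind D (shift p (- s)) = crossing_index D (p, q)"
proof -
  note pq = crossingD(1-4)[OF x]
  note qp = pq(2,1) pq(3)[symmetric] pq(4)[symmetric]
  have index: "crossing_index D (p, q) = wind D z"
    if "z \<in> source_region D (p, q)" "source_region D (p, q) \<in> regions D" for z
    using region_index_eq_wind[OF that(2,1)] by (simp add: crossing_index_def)
  show "\<forall>\<^sub>F s in at_right 0. right_wind D (shift p s) = crossing_index D (p, q) \<and>
        right_wind D (shift p (- s)) = crossing_index D (p, q) + 1 \<and>
        right_wind D (shift q s) = crossing_index D (p, q) + 1 \<and>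
        right_wind D (shift q (- s)) = crossing_index D (p, q)"
    if det: "0 < det2 (tangent D p) (tangent D q)"
  proof -
    let ?w = "tangent D p - tangent D q"
    have "right_of (tangent D p) ?w" "right_of (tangent D q) ?w"
      using det by (simp_all add: right_of_def det2_Re_Im algebra_simps)
    note sr = source_region[OF pq this]
    obtain z where "z \<in> source_region D (p, q)"
      using eventually_happens'[OF trivial_limit_at_right_real sr(2)] by blast
    then show ?thesis
      using right_wind_at_crossing[OF pq det] index sr(1) by simp
  qed
  show "\<forall>\<^sub>F s in at_right 0. right_wind D (shift q s) = crossing_index D (p, q) \<and>
        right_wind D (shift q (- s)) = crossing_index D (p, q) + 1 \<and>
        right_wind D (shift p s) = crossing_index D (p, q) + 1 \<and>
        right_wind D (shift p (- s)) = crossing_index D (p, q)"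
    if det: "det2 (tangent D p) (tangent D q) < 0"
  proof -
    let ?w = "tangent D q - tangent D p"
    have det': "0 < det2 (tangent D q) (tangent D p)"
      using det det2_commute[of "tangent D q" "tangent D p"] by simp
    have "right_of (tangent D p) ?w" "right_of (tangent D q) ?w"
      using det by (simp_all add: right_of_def det2_Re_Im algebra_simps)
    note sr = source_region[OF pq this]
    obtain z where z: "z \<in> source_region D (p, q)"
      using eventually_happens'[OF trivial_limit_at_right_real sr(2)] by blast
    then have "z \<in> source_region D (q, p)"
      using source_region_commute[OF pq(4)] by simp
    then show ?thesis
      using right_wind_at_crossing[OF qp det'] index[OF z sr(1)] by simp
  qed
qed

end


section \<open>The weight of a translated coloring\<close>

text \<open>Integer powers obey the exponent laws only in a group, so the powers of a unit are
  computed in the group \<open>units_of R\<close>.\<close>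

lemma (in cring) unit_int_pow:
  assumes "\<alpha> \<in> Units R"
  shows "\<alpha> [^] (k::int) \<in> carrier R" "\<alpha> [^] (k + 1) = \<alpha> \<otimes> \<alpha> [^] k"
proof -
  interpret U: group "units_of R"
    by (rule units_group)
  have \<alpha>: "\<alpha> \<in> carrier (units_of R)"
    using assms by (simp only: units_of_carrier)
  have units: "\<alpha> [^] n \<in> Units R" for n :: nat
    using U.nat_pow_closed[OF \<alpha>, of n] by (simp only: units_of_pow[OF assms] units_of_carrier)
  have pow: "\<alpha> [^] k = \<alpha> [^]\<^bsub>units_of R\<^esub> k" for k :: int
    unfolding int_pow_def2 units_of_pow[OF assms] units_of_inv[OF units] ..
  from \<alpha> have "\<alpha> [^]\<^bsub>units_of R\<^esub> k \<in> carrier (units_of R)"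
    by simp
  then show "\<alpha> [^] k \<in> carrier R"
    unfolding pow by (simp add: units_of_carrier Units_closed)
  have "\<alpha> [^]\<^bsub>units_of R\<^esub> (1 + k) = \<alpha> [^]\<^bsub>units_of R\<^esub> (1::int) \<otimes>\<^bsub>units_of R\<^esub> \<alpha> [^]\<^bsub>units_of R\<^esub> k"
    by (rule U.int_pow_mult[OF \<alpha>])
  then show "\<alpha> [^] (k + 1) = \<alpha> \<otimes> \<alpha> [^] k"
    using \<alpha> unfolding pow by (simp add: units_of_mult add.commute)
qed

lemma (in abelian_group) add_pow_sign:
  assumes "x \<in> carrier G"
  shows "[(1::int)] \<cdot>\<^bsub>G\<^esub> x = x" "[(- 1::int)] \<cdot>\<^bsub>G\<^esub> x = \<ominus> x"
  using assms by (simp_all add: add_pow_int_ge add_pow_int_lt)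

text \<open>To be read with \<open>\<beta>\<close> = \<alpha>^-i, \<open>e\<close> =
  \<alpha>^(-i-1), \<open>w'\<close> = \<omega>(a \<lhd> c, b \<lhd> c) and \<open>wdc\<close> =
  \<omega>(a \<lhd> b, c). The first difference in the inner sum is the jump along the over-strand,
  the second that along the under-strand; the two conclusions belong to positive and negative
  crossings.\<close>

lemma (in module) cocycle_jump:
  assumes R: "\<alpha> \<in> carrier R" "e \<in> carrier R" "\<beta> = \<alpha> \<otimes> e"
    and M: "w' \<in> carrier M" "wab \<in> carrier M" "wdc \<in> carrier M" "wac \<in> carrier M" "wbc \<in> carrier M"
    and cocycle: "w' \<ominus>\<^bsub>M\<^esub> (\<alpha> \<odot>\<^bsub>M\<^esub> wab) \<ominus>\<^bsub>M\<^esub> wdc \<oplus>\<^bsub>M\<^esub> (\<alpha> \<odot>\<^bsub>M\<^esub> wac)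
      \<oplus>\<^bsub>M\<^esub> ((\<one> \<ominus> \<alpha>) \<odot>\<^bsub>M\<^esub> wbc) = \<zero>\<^bsub>M\<^esub>"
  shows "\<beta> \<odot>\<^bsub>M\<^esub> w' = \<alpha> \<odot>\<^bsub>M\<^esub> (\<beta> \<odot>\<^bsub>M\<^esub> wab) \<oplus>\<^bsub>M\<^esub>
      \<alpha> \<odot>\<^bsub>M\<^esub> ((\<beta> \<odot>\<^bsub>M\<^esub> wbc \<ominus>\<^bsub>M\<^esub> e \<odot>\<^bsub>M\<^esub> wbc) \<oplus>\<^bsub>M\<^esub> (e \<odot>\<^bsub>M\<^esub> wdc \<ominus>\<^bsub>M\<^esub> \<beta> \<odot>\<^bsub>M\<^esub> wac))"
    and "\<ominus>\<^bsub>M\<^esub> (\<beta> \<odot>\<^bsub>M\<^esub> w') = \<alpha> \<odot>\<^bsub>M\<^esub> (\<ominus>\<^bsub>M\<^esub> (\<beta> \<odot>\<^bsub>M\<^esub> wab)) \<oplus>\<^bsub>M\<^esub>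
      \<alpha> \<odot>\<^bsub>M\<^esub> ((e \<odot>\<^bsub>M\<^esub> wbc \<ominus>\<^bsub>M\<^esub> \<beta> \<odot>\<^bsub>M\<^esub> wbc) \<oplus>\<^bsub>M\<^esub> (\<beta> \<odot>\<^bsub>M\<^esub> wac \<ominus>\<^bsub>M\<^esub> e \<odot>\<^bsub>M\<^esub> wdc))"
proof -
  have \<beta>: "\<beta> \<in> carrier R" "e \<otimes> \<alpha> = \<beta>"
    using R by (simp_all add: m_comm)
  define X where "X = \<ominus>\<^bsub>M\<^esub> (\<alpha> \<odot>\<^bsub>M\<^esub> wab) \<oplus>\<^bsub>M\<^esub> (\<ominus>\<^bsub>M\<^esub> wdc \<oplus>\<^bsub>M\<^esub> (\<alpha> \<odot>\<^bsub>M\<^esub> wac \<oplus>\<^bsub>M\<^esub> (wbc \<oplus>\<^bsub>M\<^esub> \<ominus>\<^bsub>M\<^esub> (\<alpha> \<odot>\<^bsub>M\<^esub> wbc))))"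
  have X: "X \<in> carrier M"
    using R M by (simp add: X_def)
  have "w' \<oplus>\<^bsub>M\<^esub> X = \<zero>\<^bsub>M\<^esub>"
    using cocycle R M
    by (simp add: X_def R.minus_eq M.minus_eq smult_l_distr smult_l_minus M.a_assoc)
  then have "w' = \<ominus>\<^bsub>M\<^esub> X"
    using M.minus_equality[of w' X] X M by simp
  then have w': "w' = \<alpha> \<odot>\<^bsub>M\<^esub> wab \<oplus>\<^bsub>M\<^esub> (wdc \<oplus>\<^bsub>M\<^esub> (\<ominus>\<^bsub>M\<^esub> (\<alpha> \<odot>\<^bsub>M\<^esub> wac) \<oplus>\<^bsub>M\<^esub> (\<ominus>\<^bsub>M\<^esub> wbc \<oplus>\<^bsub>M\<^esub> \<alpha> \<odot>\<^bsub>M\<^esub> wbc)))"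
    using R M by (simp add: X_def M.minus_add)
  \<comment> \<open>Scaling the solved cocycle identity by \<open>e\<close> and using
    \<open>e \<otimes> \<alpha> = \<beta>\<close> produces the jumps; one more factor \<alpha> turns
    the left side into \<open>\<beta>\<close> times \<open>w'\<close>.\<close>
  have ew': "e \<odot>\<^bsub>M\<^esub> w' = \<beta> \<odot>\<^bsub>M\<^esub> wab \<oplus>\<^bsub>M\<^esub>
      ((\<beta> \<odot>\<^bsub>M\<^esub> wbc \<ominus>\<^bsub>M\<^esub> e \<odot>\<^bsub>M\<^esub> wbc) \<oplus>\<^bsub>M\<^esub> (e \<odot>\<^bsub>M\<^esub> wdc \<ominus>\<^bsub>M\<^esub> \<beta> \<odot>\<^bsub>M\<^esub> wac))"
    using R M \<beta> unfolding w'
    by (simp add: smult_r_distr smult_r_minus smult_assoc1[symmetric] M.minus_eq M.a_ac)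
  have "\<beta> \<odot>\<^bsub>M\<^esub> w' = \<alpha> \<odot>\<^bsub>M\<^esub> (e \<odot>\<^bsub>M\<^esub> w')"
    using R M by (simp add: smult_assoc1)
  also have "\<dots> = \<alpha> \<odot>\<^bsub>M\<^esub> (\<beta> \<odot>\<^bsub>M\<^esub> wab) \<oplus>\<^bsub>M\<^esub>
      \<alpha> \<odot>\<^bsub>M\<^esub> ((\<beta> \<odot>\<^bsub>M\<^esub> wbc \<ominus>\<^bsub>M\<^esub> e \<odot>\<^bsub>M\<^esub> wbc) \<oplus>\<^bsub>M\<^esub> (e \<odot>\<^bsub>M\<^esub> wdc \<ominus>\<^bsub>M\<^esub> \<beta> \<odot>\<^bsub>M\<^esub> wac))"
    unfolding ew' using R M \<beta>(1) by (intro smult_r_distr) simp_all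
  finally show plus: "\<beta> \<odot>\<^bsub>M\<^esub> w' = \<alpha> \<odot>\<^bsub>M\<^esub> (\<beta> \<odot>\<^bsub>M\<^esub> wab) \<oplus>\<^bsub>M\<^esub>
      \<alpha> \<odot>\<^bsub>M\<^esub> ((\<beta> \<odot>\<^bsub>M\<^esub> wbc \<ominus>\<^bsub>M\<^esub> e \<odot>\<^bsub>M\<^esub> wbc) \<oplus>\<^bsub>M\<^esub> (e \<odot>\<^bsub>M\<^esub> wdc \<ominus>\<^bsub>M\<^esub> \<beta> \<odot>\<^bsub>M\<^esub> wac))" .
  have neg: "\<ominus>\<^bsub>M\<^esub> ((\<beta> \<odot>\<^bsub>M\<^esub> wbc \<ominus>\<^bsub>M\<^esub> e \<odot>\<^bsub>M\<^esub> wbc) \<oplus>\<^bsub>M\<^esub> (e \<odot>\<^bsub>M\<^esub> wdc \<ominus>\<^bsub>M\<^esub> \<beta> \<odot>\<^bsub>M\<^esub> wac))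
      = (e \<odot>\<^bsub>M\<^esub> wbc \<ominus>\<^bsub>M\<^esub> \<beta> \<odot>\<^bsub>M\<^esub> wbc) \<oplus>\<^bsub>M\<^esub> (\<beta> \<odot>\<^bsub>M\<^esub> wac \<ominus>\<^bsub>M\<^esub> e \<odot>\<^bsub>M\<^esub> wdc)"
    using R M \<beta>(1) by (simp add: M.minus_add M.minus_eq M.a_ac)
  show "\<ominus>\<^bsub>M\<^esub> (\<beta> \<odot>\<^bsub>M\<^esub> w') = \<alpha> \<odot>\<^bsub>M\<^esub> (\<ominus>\<^bsub>M\<^esub> (\<beta> \<odot>\<^bsub>M\<^esub> wab)) \<oplus>\<^bsub>M\<^esub>
      \<alpha> \<odot>\<^bsub>M\<^esub> ((e \<odot>\<^bsub>M\<^esub> wbc \<ominus>\<^bsub>M\<^esub> \<beta> \<odot>\<^bsub>M\<^esub> wbc) \<oplus>\<^bsub>M\<^esub> (\<beta> \<odot>\<^bsub>M\<^esub> wac \<ominus>\<^bsub>M\<^esub> e \<odot>\<^bsub>M\<^esub> wdc))"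
    unfolding plus neg[symmetric]
    by (subst (1 2) smult_r_minus, use R M \<beta>(1) in simp_all) (intro M.minus_add; simp)
qed

context quandle
begin

text \<open>Both sides become \<open>a \<lhd> b\<close> under translation by \<open>c\<close>, which
  is injective and distributes over the product.\<close>

lemma tri_inv_distrib:
  assumes "a \<in> Q" "b \<in> Q" "c \<in> Q"
  shows "(a \<lhd> b) \<lhd>' c = (a \<lhd>' c) \<lhd> (b \<lhd>' c)"
proof -
  let ?a = "a \<lhd>' c" and ?b = "b \<lhd>' c"
  have Q: "?a \<in> Q" "?b \<in> Q"
    using assms tri_inv_closed by auto
  then have "(?a \<lhd> ?b) \<lhd> c = a \<lhd> b"
    using self_distrib[of ?a ?b c] assms by (simp add: tri_inv_tri)
  then show ?thesis
    using tri_tri_inv[of "?a \<lhd> ?b" c] Q assms tri_closed by simp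
qed

end

context diagram
begin

text \<open>Quandle endomorphisms act on colorings by composition, since the crossing condition
  involves only the quandle operation. This is used for translation by a fixed element and for its
  inverse; the restriction to \<open>arcs D\<close> keeps colorings extensional.\<close>

lemma coloring_map:
  assumes C: "C \<in> colorings Q tri D"
    and h: "\<And>a. a \<in> Q \<Longrightarrow> h a \<in> Q" "\<And>a b. \<lbrakk>a \<in> Q; b \<in> Q\<rbrakk> \<Longrightarrow> h (tri a b) = tri (h a) (h b)"
  shows "(\<lambda>a\<in>arcs D. h (C a)) \<in> colorings Q tri D"
proof -
  have CQ: "C a \<in> Q" if "a \<in> arcs D" for a
    using C that by (auto simp: colorings_def)
  have "(\<lambda>a\<in>arcs D. h (C a)) (under_arc_left D x) =
      tri ((\<lambda>a\<in>arcs D. h (C a)) (under_arc_right D x)) ((\<lambda>a\<in>arcs D. h (C a)) (over_arc D x))"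
    if x: "x \<in> crossings D" for x
  proof -
    obtain p q where pq: "x = (p, q)" by (cases x)
    then have arcs: "under_arc_right D x \<in> arcs D" "under_arc_left D x \<in> arcs D" "over_arc D x \<in> arcs D"
      using x under_arcs over_arc(2) by auto
    have "C (under_arc_left D x) = tri (C (under_arc_right D x)) (C (over_arc D x))"
      using C x by (simp add: colorings_def)
    then show ?thesis
      using arcs h CQ by simp
  qed
  then show ?thesis
    using CQ h(1) by (auto simp: colorings_def)
qed

lemma weight_of_translate:
  assumes "quandle Q tri tri_inv" "Module.module R A" and \<alpha>: "\<alpha> \<in> Units R"
    and \<omega>: "twisted_cocycle Q tri R A \<alpha> \<omega>" and C: "C \<in> colorings Q tri D" and c: "c \<in> Q"
  shows "twisted_weight R A \<alpha> \<omega> D (\<lambda>a\<in>arcs D. tri (C a) c) = \<alpha> \<odot>\<^bsub>A\<^esub> twisted_weight R A \<alpha> \<omega> D C"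
proof -
  interpret quandle Q tri tri_inv by fact
  interpret module R A by fact
  have \<alpha>R: "\<alpha> \<in> carrier R"
    using \<alpha> by (rule R.Units_closed)
  note pow = R.unit_int_pow[OF \<alpha>]
  have \<omega>A: "\<omega> a b \<in> carrier A" if "a \<in> Q" "b \<in> Q" for a b
    using \<omega> that by (simp add: twisted_cocycle_def)
  have CQ: "C a \<in> Q" if "a \<in> arcs D" for a
    using C that by (auto simp: colorings_def)
  define V where "V k a = \<alpha> [^]\<^bsub>R\<^esub> (- k) \<odot>\<^bsub>A\<^esub> \<omega> a c" for k :: int and a
  have V: "V k a \<in> carrier A" if "a \<in> Q" for k a
    using that c by (simp add: V_def pow(1) \<omega>A)
  \<comment> \<open>The default zero keeps \<open>f\<close> in the carrier everywhere; the value at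
    a double parameter is irrelevant, as only one-sided limits are taken there.\<close>
  define f where "f p = (if p \<in> params D \<and> p \<notin> double_params D
    then V (right_wind D p) (C (arc_at D p)) else \<zero>\<^bsub>A\<^esub>)" for p
  have fA: "f p \<in> carrier A" for p
    using under_double arc_at(1)[of p] by (auto simp: f_def intro!: V CQ)
  have f_ev: "\<forall>\<^sub>F s in at_right 0. f (shift p (\<sigma> * s)) = V k a"
    if "p \<in> params D" "\<sigma> = 1 \<or> \<sigma> = - 1" "\<forall>\<^sub>F s in at_right 0. right_wind D (shift p (\<sigma> * s)) = k"
      "\<forall>\<^sub>F s in at_right 0. C (arc_at D (shift p (\<sigma> * s))) = a" for p \<sigma> k a
    using eventually_at_right_signed[OF eventually_shift_notin[OF finite_double that(1)] that(2)] that(3,4)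
    by eventually_elim (use that(1) in \<open>simp add: f_def\<close>)
  have f_nondouble: "\<forall>\<^sub>F s in at_right 0. f (shift p (\<sigma> * s)) = f p"
    if p: "p \<in> params D" "\<sigma> = 1 \<or> \<sigma> = - 1" "p \<notin> double_params D" for p \<sigma>
  proof -
    have "p \<notin> under D"
      using p(3) under_double by blast
    from arc_at_locally_constant[OF p(1) this] right_wind_locally_constant[OF p(1,3)]
      eventually_shift_notin[OF finite_double p(1)]
    have "\<forall>\<^sub>F s in at 0. f (shift p s) = f p"
      by eventually_elim (use p in \<open>simp add: f_def\<close>)
    then show ?thesis
      by (rule eventually_at_right_signed[OF _ p(2)])
  qed
  \<comment> \<open>At double parameters \<open>hi\<close> and \<open>lo\<close> are the limits of
    \<open>f\<close> after and before the point; elsewhere they equal \<open>f\<close>, so that only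
    double parameters contribute jumps.\<close>
  define hi where "hi p = (if p \<in> double_params D then (THE v. \<forall>\<^sub>F s in at_right 0. f (shift p s) = v) else f p)" for p
  define lo where "lo p = (if p \<in> double_params D then (THE v. \<forall>\<^sub>F s in at_right 0. f (shift p (- s)) = v) else f p)" for p
  have hi_eq: "hi p = v" if "p \<in> double_params D" "\<forall>\<^sub>F s in at_right 0. f (shift p s) = v" for p v
  proof -
    have "(THE v. \<forall>\<^sub>F s in at_right 0. f (shift p s) = v) = v"
      by (rule the_equality) (use that(2) eventually_const_unique[OF _ that(2)] in blast)+
    then show ?thesis
      using that(1) by (simp add: hi_def)
  qed
  have lo_eq: "lo p = v" if "p \<in> double_params D" "\<forall>\<^sub>F s in at_right 0. f (shift p (- s)) = v" for p v
  proof -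
    have "(THE v. \<forall>\<^sub>F s in at_right 0. f (shift p (- s)) = v) = v"
      by (rule the_equality) (use that(2) eventually_const_unique[OF _ that(2)] in blast)+
    then show ?thesis
      using that(1) by (simp add: lo_def)
  qed
  \<comment> \<open>\<open>\<beta> x\<close> is the coefficient belonging to the index of the
    crossing and \<open>e x\<close> the one belonging to that index plus one, the only two values of
    the index on the right of the half-strands.\<close>
  define e where "e x = \<alpha> [^]\<^bsub>R\<^esub> (- crossing_index D x - 1)" for x
  define \<beta> where "\<beta> x = \<alpha> [^]\<^bsub>R\<^esub> (- crossing_index D x)" for x
  define wb where "wb x = \<omega> (C (over_arc D x)) c" for x
  define wa where "wa x = \<omega> (C (under_arc_right D x)) c" for x
  define wd where "wd x = \<omega> (C (under_arc_left D x)) c" for x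
  have jumps:
    "(\<forall>\<^sub>F s in at_right 0. f (shift p s) = hi p) \<and> (\<forall>\<^sub>F s in at_right 0. f (shift p (- s)) = lo p) \<and>
     (\<forall>\<^sub>F s in at_right 0. f (shift q s) = hi q) \<and> (\<forall>\<^sub>F s in at_right 0. f (shift q (- s)) = lo q) \<and>
     (if 0 < det2 (tangent D p) (tangent D q)
      then hi p = \<beta> x \<odot>\<^bsub>A\<^esub> wb x \<and> lo p = e x \<odot>\<^bsub>A\<^esub> wb x \<and> hi q = e x \<odot>\<^bsub>A\<^esub> wd x \<and> lo q = \<beta> x \<odot>\<^bsub>A\<^esub> wa x
      else hi p = e x \<odot>\<^bsub>A\<^esub> wb x \<and> lo p = \<beta> x \<odot>\<^bsub>A\<^esub> wb x \<and> hi q = \<beta> x \<odot>\<^bsub>A\<^esub> wa x \<and> lo q = e x \<odot>\<^bsub>A\<^esub> wd x)"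
    if x: "x = (p, q)" "x \<in> crossings D" for x p q
  proof -
    have pq: "(p, q) \<in> crossings D"
      using x by simp
    note cr = crossingD[OF pq]
    note dbl = double_pair(1,2)[OF cr(1-4)]
    note ipos = crossing_index_right_wind(1)[OF pq] and ineg = crossing_index_right_wind(2)[OF pq]
    have over: "\<forall>\<^sub>F s in at_right 0. C (arc_at D (shift p (1 * s))) = C (over_arc D x)"
      "\<forall>\<^sub>F s in at_right 0. C (arc_at D (shift p (- 1 * s))) = C (over_arc D x)"
      using eventually_at_right_signed[OF arc_at_locally_constant[OF cr(1,6)], of 1]
        eventually_at_right_signed[OF arc_at_locally_constant[OF cr(1,6)], of "- 1"]
      by (auto simp: x(1) over_arc(1)[OF pq] elim: eventually_mono)
    have underq: "\<forall>\<^sub>F s in at_right 0. C (arc_at D (shift q (1 * s))) = C (arc_out D q)"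
      "\<forall>\<^sub>F s in at_right 0. C (arc_at D (shift q (- 1 * s))) = C (arc_in D q)"
      using arc_out(2)[OF cr(2)] arc_in(2)[OF cr(2)] by (auto elim: eventually_mono)
    show ?thesis
    proof (cases "0 < det2 (tangent D p) (tangent D q)")
      case True
      let ?i = "crossing_index D x"
      \<comment> \<open>At a positive crossing the under-strand runs from the right to the left of
        the over-strand, so the color \<open>a\<close> is on its incoming half; at a negative
        crossing it is on the outgoing half.\<close>
      have arcs: "under_arc_right D x = arc_in D q" "under_arc_left D x = arc_out D q"
        using True by (simp_all add: x(1) under_arc_right_def under_arc_left_def right_of_def)
      have 1: "\<forall>\<^sub>F s in at_right 0. f (shift p (1 * s)) = V ?i (C (over_arc D x))"
        by (rule f_ev[OF cr(1) _ _ over(1)]) (use ipos[OF True] in \<open>auto simp: x(1) elim: eventually_mono\<close>)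
      have 2: "\<forall>\<^sub>F s in at_right 0. f (shift p (- 1 * s)) = V (?i + 1) (C (over_arc D x))"
        by (rule f_ev[OF cr(1) _ _ over(2)]) (use ipos[OF True] in \<open>auto simp: x(1) elim: eventually_mono\<close>)
      have 3: "\<forall>\<^sub>F s in at_right 0. f (shift q (1 * s)) = V (?i + 1) (C (arc_out D q))"
        by (rule f_ev[OF cr(2) _ _ underq(1)]) (use ipos[OF True] in \<open>auto simp: x(1) elim: eventually_mono\<close>)
      have 4: "\<forall>\<^sub>F s in at_right 0. f (shift q (- 1 * s)) = V ?i (C (arc_in D q))"
        by (rule f_ev[OF cr(2) _ _ underq(2)]) (use ipos[OF True] in \<open>auto simp: x(1) elim: eventually_mono\<close>)
      show ?thesis
        using 1 2 3 4 True hi_eq[OF dbl(1)] lo_eq[OF dbl(1)] hi_eq[OF dbl(2)] lo_eq[OF dbl(2)]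
        by (simp add: V_def e_def \<beta>_def wa_def wb_def wd_def arcs)
    next
      case False
      let ?i = "crossing_index D x"
      have neg: "det2 (tangent D p) (tangent D q) < 0"
        using False transverse[OF cr(1-4)] by simp
      have arcs: "under_arc_right D x = arc_out D q" "under_arc_left D x = arc_in D q"
        using neg by (simp_all add: x(1) under_arc_right_def under_arc_left_def right_of_def)
      have 1: "\<forall>\<^sub>F s in at_right 0. f (shift p (1 * s)) = V (?i + 1) (C (over_arc D x))"
        by (rule f_ev[OF cr(1) _ _ over(1)]) (use ineg[OF neg] in \<open>auto simp: x(1) elim: eventually_mono\<close>)
      have 2: "\<forall>\<^sub>F s in at_right 0. f (shift p (- 1 * s)) = V ?i (C (over_arc D x))"
        by (rule f_ev[OF cr(1) _ _ over(2)]) (use ineg[OF neg] in \<open>auto simp: x(1) elim: eventually_mono\<close>)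
      have 3: "\<forall>\<^sub>F s in at_right 0. f (shift q (1 * s)) = V ?i (C (arc_out D q))"
        by (rule f_ev[OF cr(2) _ _ underq(1)]) (use ineg[OF neg] in \<open>auto simp: x(1) elim: eventually_mono\<close>)
      have 4: "\<forall>\<^sub>F s in at_right 0. f (shift q (- 1 * s)) = V (?i + 1) (C (arc_in D q))"
        by (rule f_ev[OF cr(2) _ _ underq(2)]) (use ineg[OF neg] in \<open>auto simp: x(1) elim: eventually_mono\<close>)
      show ?thesis
        using 1 2 3 4 False hi_eq[OF dbl(1)] lo_eq[OF dbl(1)] hi_eq[OF dbl(2)] lo_eq[OF dbl(2)]
        by (simp add: V_def e_def \<beta>_def wa_def wb_def wd_def arcs)
    qed
  qed
  have e\<beta>: "e x \<in> carrier R" "\<beta> x \<in> carrier R" "\<beta> x = \<alpha> \<otimes>\<^bsub>R\<^esub> e x" for x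
    unfolding e_def \<beta>_def by (rule pow(1))+ (use pow(2)[of "- crossing_index D x - 1"] in simp)
  have carr: "wb x \<in> carrier A" "wa x \<in> carrier A" "wd x \<in> carrier A"
    "\<omega> (C (under_arc_right D x)) (C (over_arc D x)) \<in> carrier A"
    "\<omega> (tri (C (under_arc_right D x)) c) (tri (C (over_arc D x)) c) \<in> carrier A"
    "C (under_arc_right D x) \<in> Q" "C (over_arc D x) \<in> Q"
    "under_arc_right D x \<in> arcs D" "over_arc D x \<in> arcs D"
    if "x \<in> crossings D" for x
  proof -
    obtain p q where pq: "x = (p, q)" by (cases x)
    show arcs: "under_arc_right D x \<in> arcs D" "over_arc D x \<in> arcs D"
      using that under_arcs over_arc(2) by (auto simp: pq)
    have "under_arc_left D x \<in> arcs D"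
      using that under_arcs by (auto simp: pq)
    with arcs show "wb x \<in> carrier A" "wa x \<in> carrier A" "wd x \<in> carrier A"
      "\<omega> (C (under_arc_right D x)) (C (over_arc D x)) \<in> carrier A"
      "\<omega> (tri (C (under_arc_right D x)) c) (tri (C (over_arc D x)) c) \<in> carrier A"
      "C (under_arc_right D x) \<in> Q" "C (over_arc D x) \<in> Q"
      using c by (simp_all add: wb_def wa_def wd_def \<omega>A CQ tri_closed)
  qed
  have side: "(\<forall>\<^sub>F s in at_right 0. f (shift p s) = hi p) \<and> (\<forall>\<^sub>F s in at_right 0. f (shift p (- s)) = lo p) \<and>
      hi p \<in> carrier A \<and> lo p \<in> carrier A" if p: "p \<in> double_params D" for p
  proof -
    obtain x where x: "x \<in> crossings D" "p = fst x \<or> p = snd x"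
      using p crossings_fst_snd(4) by blast
    obtain q r where qr: "x = (q, r)" by (cases x)
    show ?thesis
      using jumps[OF qr x(1)] x(2) e\<beta>(1,2)[of x] carr[OF x(1)]
      by (auto simp: qr split: if_splits)
  qed
  have lohi: "lo p \<in> carrier A" "hi p \<in> carrier A" for p
    using side[of p] fA by (cases "p \<in> double_params D"; simp add: lo_def hi_def)+
  have "(\<Oplus>\<^bsub>A\<^esub>p\<in>double_params D. hi p \<ominus>\<^bsub>A\<^esub> lo p) = \<zero>\<^bsub>A\<^esub>"
  proof (rule finsum_double_jumps[OF M.abelian_group_axioms fA lohi])
    fix p assume p: "p \<in> params D"
    show "\<forall>\<^sub>F s in at_right 0. f (shift p s) = hi p"
      using side[of p] f_nondouble[OF p, of 1] by (cases "p \<in> double_params D") (simp_all add: hi_def)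
    show "\<forall>\<^sub>F s in at_right 0. f (shift p (- s)) = lo p"
      using side[of p] f_nondouble[OF p, of "- 1"] by (cases "p \<in> double_params D") (simp_all add: lo_def)
  qed (simp_all add: hi_def lo_def)
  then have zero: "(\<Oplus>\<^bsub>A\<^esub>x\<in>crossings D. (hi (fst x) \<ominus>\<^bsub>A\<^esub> lo (fst x)) \<oplus>\<^bsub>A\<^esub> (hi (snd x) \<ominus>\<^bsub>A\<^esub> lo (snd x))) = \<zero>\<^bsub>A\<^esub>"
    using finsum_over_crossings[OF M.abelian_group_axioms, of "\<lambda>p. hi p \<ominus>\<^bsub>A\<^esub> lo p"] lohi by simp
  define J where "J x = (hi (fst x) \<ominus>\<^bsub>A\<^esub> lo (fst x)) \<oplus>\<^bsub>A\<^esub> (hi (snd x) \<ominus>\<^bsub>A\<^esub> lo (snd x))" for x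
  have J: "J x \<in> carrier A" for x
    using lohi by (simp add: J_def)
  define t where "t C' x = [crossing_sign D x] \<cdot>\<^bsub>A\<^esub> (\<beta> x \<odot>\<^bsub>A\<^esub> \<omega> (C' (under_arc_right D x)) (C' (over_arc D x)))"
    for C' x
  let ?C' = "\<lambda>a\<in>arcs D. tri (C a) c"
  \<comment> \<open>The cocycle identity is used here, one crossing at a time. The correction
    \<open>J x\<close> need not vanish at a single crossing; only the sum over all crossings
    does.\<close>
  have t: "t C x \<in> carrier A \<and> t ?C' x = \<alpha> \<odot>\<^bsub>A\<^esub> t C x \<oplus>\<^bsub>A\<^esub> \<alpha> \<odot>\<^bsub>A\<^esub> J x" if x: "x \<in> crossings D" for x
  proof -
    obtain p q where pq: "x = (p, q)" by (cases x)
    note cx = carr[OF x]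
    have "C (under_arc_left D x) = tri (C (under_arc_right D x)) (C (over_arc D x))"
      using C x by (simp add: colorings_def)
    then have "\<omega> (tri (C (under_arc_right D x)) c) (tri (C (over_arc D x)) c)
        \<ominus>\<^bsub>A\<^esub> (\<alpha> \<odot>\<^bsub>A\<^esub> \<omega> (C (under_arc_right D x)) (C (over_arc D x))) \<ominus>\<^bsub>A\<^esub> wd x
        \<oplus>\<^bsub>A\<^esub> (\<alpha> \<odot>\<^bsub>A\<^esub> wa x) \<oplus>\<^bsub>A\<^esub> ((\<one>\<^bsub>R\<^esub> \<ominus>\<^bsub>R\<^esub> \<alpha>) \<odot>\<^bsub>A\<^esub> wb x) = \<zero>\<^bsub>A\<^esub>"
      using \<omega> cx(6,7) c by (simp add: twisted_cocycle_def wa_def wb_def wd_def)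
    note jump = cocycle_jump[OF \<alpha>R e\<beta>(1) e\<beta>(3) cx(5,4,3,2,1) this]
    show ?thesis
    proof (cases "0 < det2 (tangent D p) (tangent D q)")
      case True
      then have sign: "crossing_sign D x = 1"
        by (simp add: pq crossing_sign_def)
      have Jx: "J x = (\<beta> x \<odot>\<^bsub>A\<^esub> wb x \<ominus>\<^bsub>A\<^esub> e x \<odot>\<^bsub>A\<^esub> wb x) \<oplus>\<^bsub>A\<^esub> (e x \<odot>\<^bsub>A\<^esub> wd x \<ominus>\<^bsub>A\<^esub> \<beta> x \<odot>\<^bsub>A\<^esub> wa x)"
        using jumps[OF pq x] True by (simp add: J_def pq)
      have "t C x = \<beta> x \<odot>\<^bsub>A\<^esub> \<omega> (C (under_arc_right D x)) (C (over_arc D x))"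
        "t ?C' x = \<beta> x \<odot>\<^bsub>A\<^esub> \<omega> (tri (C (under_arc_right D x)) c) (tri (C (over_arc D x)) c)"
        using cx e\<beta>(2)[of x] by (simp_all add: t_def sign M.add_pow_sign)
      then show ?thesis
        using jump(1) cx e\<beta>(2)[of x] by (simp add: Jx)
    next
      case False
      then have sign: "crossing_sign D x = - 1"
        by (simp add: pq crossing_sign_def)
      have Jx: "J x = (e x \<odot>\<^bsub>A\<^esub> wb x \<ominus>\<^bsub>A\<^esub> \<beta> x \<odot>\<^bsub>A\<^esub> wb x) \<oplus>\<^bsub>A\<^esub> (\<beta> x \<odot>\<^bsub>A\<^esub> wa x \<ominus>\<^bsub>A\<^esub> e x \<odot>\<^bsub>A\<^esub> wd x)"
        using jumps[OF pq x] False by (simp add: J_def pq)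
      have "t C x = \<ominus>\<^bsub>A\<^esub> (\<beta> x \<odot>\<^bsub>A\<^esub> \<omega> (C (under_arc_right D x)) (C (over_arc D x)))"
        "t ?C' x = \<ominus>\<^bsub>A\<^esub> (\<beta> x \<odot>\<^bsub>A\<^esub> \<omega> (tri (C (under_arc_right D x)) c) (tri (C (over_arc D x)) c))"
        using cx e\<beta>(2)[of x] by (simp_all add: t_def sign M.add_pow_sign)
      then show ?thesis
        using jump(2) cx e\<beta>(2)[of x] by (simp add: Jx)
    qed
  qed
  have weight: "twisted_weight R A \<alpha> \<omega> D C' = (\<Oplus>\<^bsub>A\<^esub>x\<in>crossings D. t C' x)" for C'
    by (simp add: twisted_weight_def t_def \<beta>_def)
  have "twisted_weight R A \<alpha> \<omega> D ?C' = (\<Oplus>\<^bsub>A\<^esub>x\<in>crossings D. \<alpha> \<odot>\<^bsub>A\<^esub> t C x \<oplus>\<^bsub>A\<^esub> \<alpha> \<odot>\<^bsub>A\<^esub> J x)"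
    unfolding weight by (rule M.finsum_cong') (use t J \<alpha>R in auto)
  also have "\<dots> = (\<Oplus>\<^bsub>A\<^esub>x\<in>crossings D. \<alpha> \<odot>\<^bsub>A\<^esub> t C x) \<oplus>\<^bsub>A\<^esub> (\<Oplus>\<^bsub>A\<^esub>x\<in>crossings D. \<alpha> \<odot>\<^bsub>A\<^esub> J x)"
    by (rule M.finsum_addf) (use t J \<alpha>R in auto)
  also have "(\<Oplus>\<^bsub>A\<^esub>x\<in>crossings D. \<alpha> \<odot>\<^bsub>A\<^esub> J x) = \<alpha> \<odot>\<^bsub>A\<^esub> (\<Oplus>\<^bsub>A\<^esub>x\<in>crossings D. J x)"
    by (rule finsum_smult_ldistr[OF finite_crossings \<alpha>R, symmetric]) (use J in auto)
  also have "(\<Oplus>\<^bsub>A\<^esub>x\<in>crossings D. J x) = \<zero>\<^bsub>A\<^esub>"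
    using zero by (simp add: J_def)
  also have "(\<Oplus>\<^bsub>A\<^esub>x\<in>crossings D. \<alpha> \<odot>\<^bsub>A\<^esub> t C x) = \<alpha> \<odot>\<^bsub>A\<^esub> (\<Oplus>\<^bsub>A\<^esub>x\<in>crossings D. t C x)"
    by (rule finsum_smult_ldistr[OF finite_crossings \<alpha>R, symmetric]) (use t in auto)
  also have "\<alpha> \<odot>\<^bsub>A\<^esub> (\<Oplus>\<^bsub>A\<^esub>x\<in>crossings D. t C x) \<oplus>\<^bsub>A\<^esub> \<alpha> \<odot>\<^bsub>A\<^esub> \<zero>\<^bsub>A\<^esub> = \<alpha> \<odot>\<^bsub>A\<^esub> (\<Oplus>\<^bsub>A\<^esub>x\<in>crossings D. t C x)"
    using \<alpha>R t by (simp add: Pi_I)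
  finally show ?thesis
    unfolding weight[of C] .
qed

end

theorem proposition4p5:
  fixes Q :: "'q set" and tri tri_inv :: "'q \<Rightarrow> 'q \<Rightarrow> 'q"
    and R :: "('r, 'm) ring_scheme" and A :: "('r, 'a, 'n) module_scheme"
    and \<alpha> :: 'r and \<omega> :: "'q \<Rightarrow> 'q \<Rightarrow> 'a" and D :: link_diagram
  assumes "quandle Q tri tri_inv"
    and "Module.module R A"
    and "\<alpha> \<in> Units R"
    and "twisted_cocycle Q tri R A \<alpha> \<omega>"
    and "knot_diagram D"
  shows "same_multiset
    (colorings Q tri D) (\<lambda>C. twisted_weight R A \<alpha> \<omega> D C)
    (colorings Q tri D) (\<lambda>C. \<alpha> \<odot>\<^bsub>A\<^esub> twisted_weight R A \<alpha> \<omega> D C)"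
proof -
  interpret quandle Q tri tri_inv by fact
  interpret diagram D using assms(5) by unfold_locales
  obtain c where c: "c \<in> Q"
    using nonempty by blast
  \<comment> \<open>The bijection is the inverse translation: scaled weights are to be matched with
    unscaled ones, and translating \<open>\<phi> C\<close> back to \<open>C\<close> multiplies its
    weight by \<alpha>.\<close>
  define \<phi> where "\<phi> C = (\<lambda>a\<in>arcs D. tri_inv (C a) c)" for C
  define \<psi> where "\<psi> C = (\<lambda>a\<in>arcs D. tri (C a) c)" for C
  have \<phi>: "\<phi> C \<in> colorings Q tri D" if "C \<in> colorings Q tri D" for C
    unfolding \<phi>_def using coloring_map[OF that, of "\<lambda>a. tri_inv a c"] c tri_inv_closed tri_inv_distrib by blast
  have \<psi>: "\<psi> C \<in> colorings Q tri D" if "C \<in> colorings Q tri D" for C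
    unfolding \<psi>_def using coloring_map[OF that, of "\<lambda>a. tri a c"] c tri_closed self_distrib by blast
  have C: "C \<in> arcs D \<rightarrow>\<^sub>E Q" if "C \<in> colorings Q tri D" for C
    using that by (simp add: colorings_def)
  have \<psi>\<phi>: "\<psi> (\<phi> C) = C" "\<phi> (\<psi> C) = C" if "C \<in> colorings Q tri D" for C
  proof -
    have "\<psi> (\<phi> C) a = C a \<and> \<phi> (\<psi> C) a = C a" for a
    proof (cases "a \<in> arcs D")
      case True
      then have "C a \<in> Q"
        using C[OF that] by (rule PiE_mem[rotated])
      then show ?thesis
        using True c by (simp add: \<phi>_def \<psi>_def tri_inv_tri tri_tri_inv)
    next
      case False
      then show ?thesis
        using PiE_arb[OF C[OF that] False] by (simp add: \<phi>_def \<psi>_def)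
    qed
    then show "\<psi> (\<phi> C) = C" "\<phi> (\<psi> C) = C"
      by blast+
  qed
  have "bij_betw \<phi> (colorings Q tri D) (colorings Q tri D)"
    by (rule bij_betwI[of _ _ _ \<psi>]) (use \<phi> \<psi> \<psi>\<phi> in auto)
  moreover have "\<alpha> \<odot>\<^bsub>A\<^esub> twisted_weight R A \<alpha> \<omega> D (\<phi> C) = twisted_weight R A \<alpha> \<omega> D C"
    if "C \<in> colorings Q tri D" for C
    using weight_of_translate[OF assms(1-4) \<phi>[OF that] c] \<psi>\<phi>(1)[OF that] by (simp add: \<psi>_def)
  ultimately show ?thesis
    unfolding same_multiset_def by blast
qed

end
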